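(* Let $\Omega\subset\mathbb{R}^2$ be an open, bounded, connected set containing $0$, and for $\varepsilon>0$ small let $s_\varepsilon=[-\varepsilon,\varepsilon]\times\{0\}$. Let $u$ be an $L^2(\Omega)$-normalized eigenfunction of the Dirichlet Laplacian in $\Omega$, and let $k\in\mathbb{N}\cup\{0\}$, $\beta\in\mathbb{R}\setminus\{0\}$ and $\alpha\in[0,\pi)$ be such that $$r^{-k}u(r(\cos t,\sin t))\to\beta\sin(\alpha-kt)\quad\text{in }C^{1,\tau}([0,2\pi])\text{ (as functions of } t)\text{ as }r\to0^+,\ \text{for every }\tau\in(0,1).$$ (i) If $\alpha\neq0$, then, as $\varepsilon\to0^+$, $$\mathrm{Cap}_\Omega(s_\varepsilon,u)=\begin{cases}\dfrac{2\pi}{|\log\varepsilon|}\,u^2(0)\,(1+o(1)),&\text{if }k=0,\\[6pt] \varepsilon^{2k}\,\pi\,\beta^2\sin^2\alpha\;C_k\,(1+o(1)),&\text{if }k\ge1,\end{cases}$$ where $C_k=\sum_{j=1}^k j\,|A_{j,k}|^2>0$ with $A_{j,k}=\frac1\pi\int_0^{2\pi}(\cos\eta)^k\cos(j\eta)\,d\eta$. (ii) If $\alpha=0$, then $\mathrm{Cap}_\Omega(s_\varepsilon,u)=O(\varepsilon^{2k+2})$ as $\varepsilon\to0^+$.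
   Context: For a compact set $K\subset\Omega$ and $u\in H^1_0(\Omega)$, the $u$-capacity of $K$ in $\Omega$ is $$\mathrm{Cap}_\Omega(K,u)=\inf\Big\{\int_\Omega|\nabla f|^2\,dx:\ f\in H^1_0(\Omega),\ f-u\in H^1_0(\Omega\setminus K)\Big\}.$$ Eigenfunctions are real-valued. It is well known that for every eigenfunction $u$ of the Dirichlet Laplacian one has $u\in C^\infty(\Omega)$ and there exist $k,\beta,\alpha$ as in the claim; one then says that $u$ has a zero of order $k$ at $0$ (if $k=0$, then $\beta\sin\alpha=u(0)$). *)

theory Defs
  imports "HOL-Analysis.Analysis" "HOL-Library.Landau_Symbols"
begin

text \<open>These two notions are meant for open sets \<open>S\<close>: all iterated partial derivatives
  exist and are continuous.\<close>

primrec Ck_on :: "nat \<Rightarrow> 'a::euclidean_space set \<Rightarrow> ('a \<Rightarrow> real) \<Rightarrow> bool" where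
  "Ck_on 0 S f \<longleftrightarrow> continuous_on S f"
| "Ck_on (Suc n) S f \<longleftrightarrow> (\<forall>x\<in>S. f differentiable (at x)) \<and>
     (\<forall>b\<in>Basis. Ck_on n S (\<lambda>x. frechet_derivative f (at x) b))"

definition smooth_on :: "'a::euclidean_space set \<Rightarrow> ('a \<Rightarrow> real) \<Rightarrow> bool" where
  "smooth_on S f \<longleftrightarrow> (\<forall>n. Ck_on n S f)"

definition grad :: "('a::euclidean_space \<Rightarrow> real) \<Rightarrow> 'a \<Rightarrow> 'a" where
  "grad f x = (THE D. GDERIV f x :> D)"

definition test_functions :: "'a::euclidean_space set \<Rightarrow> ('a \<Rightarrow> real) set" where
  "test_functions U = {\<phi>. smooth_on UNIV \<phi> \<and> compact (closure {x. \<phi> x \<noteq> 0}) \<and>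
                          closure {x. \<phi> x \<noteq> 0} \<subseteq> U}"

text \<open>Elements of \<open>L\<^sup>2(U)\<close>, \<open>H\<^sup>1(U)\<close>, \<open>H\<^sup>1\<^sub>0(U)\<close> are represented by total functions;
  membership depends only on their values almost everywhere on \<open>U\<close>.\<close>

definition L2_on :: "'a::euclidean_space set \<Rightarrow> ('a \<Rightarrow> 'b::euclidean_space) \<Rightarrow> bool" where
  "L2_on U f \<longleftrightarrow> f \<in> borel_measurable (lebesgue_on U) \<and>
                 integrable (lebesgue_on U) (\<lambda>x. (norm (f x))\<^sup>2)"

definition weak_grad_on ::
    "'a::euclidean_space set \<Rightarrow> ('a \<Rightarrow> real) \<Rightarrow> ('a \<Rightarrow> 'a) \<Rightarrow> bool" where
  "weak_grad_on U f G \<longleftrightarrow> L2_on U G \<and>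
     (\<forall>\<phi>\<in>test_functions U.
        (LINT x|lebesgue_on U. f x *\<^sub>R grad \<phi> x) = - (LINT x|lebesgue_on U. \<phi> x *\<^sub>R G x))"

definition H1 :: "'a::euclidean_space set \<Rightarrow> ('a \<Rightarrow> real) set" where
  "H1 U = {f. L2_on U f \<and> (\<exists>G. weak_grad_on U f G)}"

text \<open>The weak gradient is unique up to null sets, so the choice below is immaterial.\<close>

definition wgrad :: "'a::euclidean_space set \<Rightarrow> ('a \<Rightarrow> real) \<Rightarrow> 'a \<Rightarrow> 'a" where
  "wgrad U f = (SOME G. weak_grad_on U f G)"

definition H10 :: "'a::euclidean_space set \<Rightarrow> ('a \<Rightarrow> real) set" where
  "H10 U = {f \<in> H1 U. \<exists>\<phi>. (\<forall>n. \<phi> n \<in> test_functions U) \<and>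
     (\<lambda>n::nat. LINT x|lebesgue_on U. (f x - \<phi> n x)\<^sup>2 + (norm (wgrad U f x - grad (\<phi> n) x))\<^sup>2)
       \<longlonglongrightarrow> 0}"

text \<open>As usual, \<open>H\<^sup>1\<^sub>0(\<Omega> - K)\<close> is regarded as a subspace of \<open>H\<^sup>1\<^sub>0(\<Omega>)\<close> through extension by
  zero. Hence \<open>f - u\<close> belonging to it also says that \<open>f = u\<close> almost everywhere on \<open>K\<close>
  (no condition if \<open>K\<close> is a null set).\<close>

definition u_capacity ::
    "'a::euclidean_space set \<Rightarrow> 'a set \<Rightarrow> ('a \<Rightarrow> real) \<Rightarrow> real" where
  "u_capacity \<Omega> K u = Inf {LINT x|lebesgue_on \<Omega>. (norm (wgrad \<Omega> f x))\<^sup>2 | f.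
     f \<in> H10 \<Omega> \<and> (\<lambda>x. f x - u x) \<in> H10 (\<Omega> - K) \<and> (AE x in lebesgue. x \<in> K \<longrightarrow> f x = u x)}"

text \<open>Eigenfunctions of the Dirichlet Laplacian in the usual variational sense. An eigenfunction
  is a class of functions modulo null sets; \<open>smooth_on \<Omega> u\<close> selects its unique smooth
  representative, which gives the pointwise values \<open>u x\<close> their meaning.\<close>

definition dirichlet_eigenfunction :: "'a::euclidean_space set \<Rightarrow> ('a \<Rightarrow> real) \<Rightarrow> bool" where
  "dirichlet_eigenfunction \<Omega> u \<longleftrightarrow>
     u \<in> H10 \<Omega> \<and> smooth_on \<Omega> u \<and> \<not> (AE x in lebesgue_on \<Omega>. u x = 0) \<and>
     (\<exists>\<mu>. \<forall>v\<in>H10 \<Omega>. (LINT x|lebesgue_on \<Omega>. wgrad \<Omega> u x \<bullet> wgrad \<Omega> v x)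
                     = \<mu> * (LINT x|lebesgue_on \<Omega>. u x * v x))"

text \<open>The space \<open>C\<^sup>1\<^sup>,\<^sup>\<tau>(I)\<close>, intended for a nondegenerate compact interval \<open>I\<close>, with one-sided derivatives at the
  endpoints.\<close>

definition C1_holder :: "real \<Rightarrow> real set \<Rightarrow> (real \<Rightarrow> real) set" where
  "C1_holder \<tau> I = {w. (\<forall>t\<in>I. w differentiable (at t within I)) \<and>
     (\<exists>C. \<forall>s\<in>I. \<forall>t\<in>I. \<bar>vector_derivative w (at s within I) - vector_derivative w (at t within I)\<bar>
                          \<le> C * \<bar>s - t\<bar> powr \<tau>)}"

definition C1_holder_norm :: "real \<Rightarrow> real set \<Rightarrow> (real \<Rightarrow> real) \<Rightarrow> real" where
  "C1_holder_norm \<tau> I w =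
     (SUP t\<in>I. \<bar>w t\<bar>) + (SUP t\<in>I. \<bar>vector_derivative w (at t within I)\<bar>) +
     (SUP (s, t)\<in>{(s, t). s \<in> I \<and> t \<in> I \<and> s \<noteq> t}.
        \<bar>vector_derivative w (at s within I) - vector_derivative w (at t within I)\<bar>
          / \<bar>s - t\<bar> powr \<tau>)"

definition tendsto_C1_holder ::
    "real \<Rightarrow> real set \<Rightarrow> ('i \<Rightarrow> real \<Rightarrow> real) \<Rightarrow> (real \<Rightarrow> real) \<Rightarrow> 'i filter \<Rightarrow> bool" where
  "tendsto_C1_holder \<tau> I w v F \<longleftrightarrow>
     v \<in> C1_holder \<tau> I \<and> (\<forall>\<^sub>F r in F. w r \<in> C1_holder \<tau> I) \<and>
     ((\<lambda>r. C1_holder_norm \<tau> I (\<lambda>t. w r t - v t)) \<longlongrightarrow> 0) F"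

definition segm :: "real \<Rightarrow> (real \<times> real) set" where
  "segm \<epsilon> = {-\<epsilon>..\<epsilon>} \<times> {0}"

definition A_coeff :: "nat \<Rightarrow> nat \<Rightarrow> real" where
  "A_coeff j k = 1 / pi * integral {0..2*pi} (\<lambda>\<eta>. cos \<eta> ^ k * cos (real j * \<eta>))"

definition C_const :: "nat \<Rightarrow> real" where
  "C_const k = (\<Sum>j=1..k. real j * \<bar>A_coeff j k\<bar>\<^sup>2)"

end

theory Submission
  imports Defs "HOL-Real_Asymp.Real_Asymp"
begin

text \<open>Only the behaviour of \<open>u\<close> on the line through the segment matters: with \<open>c = \<beta> * sin \<alpha>\<close>, Taylor's formula gives
  \<open>u (x, 0) = c * x ^ k + O(x ^ (k + 1))\<close>. Since \<open>u\<close> is smooth inside \<open>\<Omega>\<close>, a cutoff argument shows that the infimum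
  defining the capacity may be taken over test functions equal to \<open>u\<close> near the segment. In the elliptic coordinates
  \<open>x + i y = \<epsilon> * cosh (\<xi> + i \<eta>)\<close> the segment becomes \<open>\<xi> = 0\<close>, the Dirichlet integral is unchanged, and the boundary
  values are \<open>c * \<epsilon> ^ k * cos \<eta> ^ k\<close> up to lower order, a cosine polynomial with coefficients \<open>a j = A_coeff j k\<close> for \<open>j \<ge> 1\<close>.
  Its harmonic extension \<open>\<Sum>j. a j * exp (- j * \<xi>) * cos (j * \<eta>)\<close> has energy \<open>pi * (\<Sum>j. j * (a j)\<^sup>2)\<close>; the constant mode is cut off
  at \<open>\<xi> \<approx> \<bar>ln \<epsilon>\<bar>\<close>, at a cost of order \<open>1 / \<bar>ln \<epsilon>\<bar>\<close>, which is the leading term precisely when \<open>k = 0\<close>. This extension, glued to \<open>u\<close>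
  near the segment, is a competitor for the upper bound; for the lower bound one pairs an arbitrary competitor with it by Green's formula.\<close>

subsection \<open>Smooth functions\<close>

text \<open>Elements of \<open>H10\<close> have no values on the segment, a null set, so no boundary
  data can be read off them. Density replaces every admissible function by test functions equal to u
  on a neighbourhood of the segment; from then on all derivatives are classical. The second obstacle
  is the singularity of the elliptic coordinates at the foci: a function that is smooth in (\<xi>,
  \<eta>) need not be smooth on the segment. The competitor is therefore u itself for \<xi> < d, and
  d tends to 0 while the segment stays fixed. The Taylor remainder on the axis is not expanded in
  cosines. It is extended with the factor exp (- \<xi>), at an energy of order
  \<open>\<epsilon> ^ (2 * k + 2)\<close>. For \<alpha> = 0 nothing else is left, so one estimate
  serves both parts of the theorem. The height of the strip is arcosh (\<rho> / \<epsilon>), from a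
  disc inside the domain, in the upper bound and arsinh (R / \<epsilon>), from a disc around it, in
  the lower bound. Both are asymptotic to \<bar>ln \<epsilon>\<bar>, so the shape of the domain
  disappears from the leading order.\<close>

lemma Ck_on_cong:
  assumes "open S" "\<And>x. x \<in> S \<Longrightarrow> f x = g x"
  shows "Ck_on n S f \<longleftrightarrow> Ck_on n S g"
  using assms(2)
proof (induction n arbitrary: f g)
  case 0
  show ?case using continuous_on_cong[OF refl 0] by (simp only: Ck_on.simps)
next
  case (Suc n)
  have tr: "(f has_derivative f') (at x) \<longleftrightarrow> (g has_derivative f') (at x)" if "x \<in> S" for x f'
    using has_derivative_transform_within_open[OF _ assms(1) that, of f f' UNIV g]
      has_derivative_transform_within_open[OF _ assms(1) that, of g f' UNIV f] Suc.prems by metis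
  then have d: "f differentiable (at x) \<longleftrightarrow> g differentiable (at x)" if "x \<in> S" for x
    using that unfolding differentiable_def by blast
  have e: "frechet_derivative f (at x) = frechet_derivative g (at x)" if "x \<in> S" for x
    unfolding frechet_derivative_def by (simp only: tr[OF that])
  have "Ck_on n S (\<lambda>x. frechet_derivative f (at x) b) \<longleftrightarrow> Ck_on n S (\<lambda>x. frechet_derivative g (at x) b)" for b
    by (rule Suc.IH) (simp add: e)
  then show ?case using d by (simp only: Ck_on.simps) blast
qed

lemma Ck_on_subset: "Ck_on n S f \<Longrightarrow> T \<subseteq> S \<Longrightarrow> Ck_on n T f"
  by (induction n arbitrary: f) (auto intro: continuous_on_subset)

lemma Ck_on_Un:
  assumes "\<And>i. i \<in> I \<Longrightarrow> open (S i)" "\<And>i. i \<in> I \<Longrightarrow> Ck_on n (S i) f"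
  shows "Ck_on n (\<Union>i\<in>I. S i) f"
  using assms(2)
proof (induction n arbitrary: f)
  case 0
  then show ?case using continuous_on_open_UN[of I S f] assms(1) by auto
next
  case (Suc n)
  then show ?case by auto
qed

lemma Ck_on_imp_continuous: 
  assumes "Ck_on n S f" "open S" shows "continuous_on S f"
proof (cases n)
  case (Suc m)
  then show ?thesis using assms
    by (auto intro!: continuous_at_imp_continuous_on differentiable_imp_continuous_within)
qed (use assms in auto)

text \<open>The recursion speaks only of derivatives until it reaches order 0, so descending by one
  order needs continuity of f at the bottom; differentiability supplies it.\<close>

lemma Ck_on_Suc_imp:
  assumes "Ck_on (Suc n) S f" "open S" shows "Ck_on n S f"
  using assms(1)
proof (induction n arbitrary: f)
  case 0
  show ?case using Ck_on_imp_continuous[OF 0 assms(2)] by simp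
next
  case (Suc n)
  from Suc.prems have 1: "\<forall>x\<in>S. f differentiable (at x)" 
    and 2: "\<forall>b\<in>Basis. Ck_on (Suc n) S (\<lambda>x. frechet_derivative f (at x) b)"
    unfolding Ck_on.simps(2)[of "Suc n"] by blast+
  from 2 Suc.IH have "\<forall>b\<in>Basis. Ck_on n S (\<lambda>x. frechet_derivative f (at x) b)" by blast
  with 1 show ?case by simp
qed

lemma Ck_on_const [simp]: "Ck_on n S (\<lambda>x. c)"
proof (induction n arbitrary: c)
  case (Suc n)
  then show ?case by (simp add: frechet_derivative_const)
qed simp

lemma frechet_derivative_at': "(f has_derivative f') (at x) \<Longrightarrow> frechet_derivative f (at x) = f'"
  using frechet_derivative_at by metis

lemma frechet_derivative_add_at:
  fixes f g :: "'a::euclidean_space \<Rightarrow> real"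
  assumes "f differentiable (at x)" "g differentiable (at x)"
  shows "frechet_derivative (\<lambda>x. f x + g x) (at x) = (\<lambda>h. frechet_derivative f (at x) h + frechet_derivative g (at x) h)"
  using assms unfolding frechet_derivative_works by (rule frechet_derivative_at'[OF has_derivative_add])

lemma frechet_derivative_mult_at:
  fixes f g :: "'a::euclidean_space \<Rightarrow> real"
  assumes "f differentiable (at x)" "g differentiable (at x)"
  shows "frechet_derivative (\<lambda>x. f x * g x) (at x)
       = (\<lambda>h. f x * frechet_derivative g (at x) h + frechet_derivative f (at x) h * g x)"
  using assms unfolding frechet_derivative_works by (rule frechet_derivative_at'[OF has_derivative_mult])

lemma Ck_on_add:
  assumes "open S" "Ck_on n S f" "Ck_on n S g"
  shows "Ck_on n S (\<lambda>x. f x + g x)"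
  using assms(2,3)
proof (induction n arbitrary: f g)
  case 0
  then show ?case by (simp add: continuous_on_add)
next
  case (Suc n)
  have d: "f differentiable (at x)" "g differentiable (at x)" if "x \<in> S" for x
    using Suc.prems that by simp_all
  have "Ck_on n S (\<lambda>x. frechet_derivative (\<lambda>x. f x + g x) (at x) b)" if "b \<in> Basis" for b
  proof -
    have "Ck_on n S (\<lambda>x. frechet_derivative f (at x) b + frechet_derivative g (at x) b)"
      using Suc.prems that by (intro Suc.IH) simp_all
    then show ?thesis
      by (subst Ck_on_cong[OF assms(1)]) (simp_all add: d frechet_derivative_add_at)
  qed
  then show ?case using d by (simp add: differentiable_add)
qed

lemma Ck_on_mult:
  assumes "open S" "Ck_on n S f" "Ck_on n S g"
  shows "Ck_on n S (\<lambda>x. f x * g x)"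
  using assms(2,3)
proof (induction n arbitrary: f g)
  case 0
  then show ?case by (simp add: continuous_on_mult)
next
  case (Suc n)
  have fg: "Ck_on n S f" "Ck_on n S g"
    using Ck_on_Suc_imp[OF Suc.prems(1) assms(1)] Ck_on_Suc_imp[OF Suc.prems(2) assms(1)] .
  have d: "f differentiable (at x)" "g differentiable (at x)" if "x \<in> S" for x
    using Suc.prems that by simp_all
  have "Ck_on n S (\<lambda>x. frechet_derivative (\<lambda>x. f x * g x) (at x) b)" if "b \<in> Basis" for b
  proof -
    have "Ck_on n S (\<lambda>x. f x * frechet_derivative g (at x) b + frechet_derivative f (at x) b * g x)"
      using Suc.prems that fg by (intro Ck_on_add[OF assms(1)] Suc.IH) simp_all
    then show ?thesis
      by (subst Ck_on_cong[OF assms(1)]) (simp_all add: d frechet_derivative_mult_at)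
  qed
  then show ?case using d by (simp add: differentiable_mult)
qed

lemma Ck_on_sum:
  assumes "open S" "\<And>i. i \<in> I \<Longrightarrow> Ck_on n S (f i)"
  shows "Ck_on n S (\<lambda>x. \<Sum>i\<in>I. f i x)"
  using assms(2) by (induction I rule: infinite_finite_induct) (simp_all add: Ck_on_add[OF assms(1)])

lemma Ck_on_linear:
  fixes f :: "'a::euclidean_space \<Rightarrow> real"
  assumes "bounded_linear f"
  shows "Ck_on n S f"
proof (cases n)
  case 0
  then show ?thesis using assms by (simp add: linear_continuous_on)
next
  case (Suc m)
  have "frechet_derivative f (at x) = f" for x
    using frechet_derivative_at'[OF bounded_linear_imp_has_derivative[OF assms]] .
  then show ?thesis using assms Suc by (auto simp: bounded_linear_imp_differentiable)
qed

text \<open>The chain rule in coordinates expresses the derivative of \<open>f \<circ> g\<close> by sums of products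
  of functions of the same form, so a single induction gives closure under composition.\<close>

lemma Ck_on_compose:
  fixes f :: "'b::euclidean_space \<Rightarrow> real" and g :: "'a::euclidean_space \<Rightarrow> 'b"
  assumes S: "open S" and T: "open T" and f: "Ck_on n T f"
    and g: "\<And>b. b \<in> Basis \<Longrightarrow> Ck_on n S (\<lambda>x. g x \<bullet> b)" and gST: "g ` S \<subseteq> T"
  shows "Ck_on n S (\<lambda>x. f (g x))"
  using f g
proof (induction n arbitrary: f)
  case 0
  have "continuous_on S g"
    using 0 by (subst continuous_on_componentwise) auto
  then show ?case using 0 gST by (auto intro: continuous_on_compose2)
next
  case (Suc n)
  have gn: "Ck_on n S (\<lambda>x. g x \<bullet> b)" if "b \<in> Basis" for b
    using Ck_on_Suc_imp[OF Suc.prems(2)[OF that] S] .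
  have gd: "g differentiable (at x)" if "x \<in> S" for x
    using Suc.prems(2) that by (subst differentiable_componentwise_within) auto
  have fd: "f differentiable (at (g x))" if "x \<in> S" for x
    using Suc.prems(1) that gST by auto
  have chain: "((\<lambda>x. f (g x)) has_derivative (\<lambda>h. frechet_derivative f (at (g x)) (frechet_derivative g (at x) h))) (at x)"
    if "x \<in> S" for x
    using diff_chain_at[OF gd[OF that, unfolded frechet_derivative_works] fd[OF that, unfolded frechet_derivative_works]]
    by (simp add: o_def)
  have eq: "frechet_derivative (\<lambda>x. f (g x)) (at x) v
      = (\<Sum>b\<in>Basis. frechet_derivative f (at (g x)) b * frechet_derivative (\<lambda>x. g x \<bullet> b) (at x) v)"
    if "x \<in> S" for x v
  proof -
    have l: "linear (frechet_derivative f (at (g x)))"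
      using fd[OF that] by (simp add: linear_frechet_derivative)
    have ib: "frechet_derivative (\<lambda>x. g x \<bullet> b) (at x) v = frechet_derivative g (at x) v \<bullet> b" for b
      using frechet_derivative_at'[OF has_derivative_inner_left[OF gd[OF that, unfolded frechet_derivative_works]]]
      by metis
    have "frechet_derivative (\<lambda>x. f (g x)) (at x) v = frechet_derivative f (at (g x)) (frechet_derivative g (at x) v)"
      using frechet_derivative_at'[OF chain[OF that]] by simp
    also have "frechet_derivative g (at x) v = (\<Sum>b\<in>Basis. (frechet_derivative g (at x) v \<bullet> b) *\<^sub>R b)"
      by (simp add: euclidean_representation)
    also have "frechet_derivative f (at (g x)) \<dots> = (\<Sum>b\<in>Basis. (frechet_derivative g (at x) v \<bullet> b) * frechet_derivative f (at (g x)) b)"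
      using l by (simp add: linear_sum linear_cmul)
    finally show ?thesis by (simp add: ib mult.commute)
  qed
  have "Ck_on n S (\<lambda>x. frechet_derivative (\<lambda>x. f (g x)) (at x) v)" if v: "v \<in> Basis" for v
  proof (subst Ck_on_cong[OF S eq])
    have "Ck_on n S (\<lambda>x. frechet_derivative f (at (g x)) b)" if "b \<in> Basis" for b
      using Suc.IH[of "\<lambda>y. frechet_derivative f (at y) b"] Suc.prems(1) gn that by auto
    moreover have "Ck_on n S (\<lambda>x. frechet_derivative (\<lambda>x. g x \<bullet> b) (at x) v)" if "b \<in> Basis" for b
      using Suc.prems(2)[OF that] v by auto
    ultimately show "Ck_on n S (\<lambda>x. \<Sum>b\<in>Basis. frechet_derivative f (at (g x)) b * frechet_derivative (\<lambda>x. g x \<bullet> b) (at x) v)"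
      by (intro Ck_on_sum[OF S] Ck_on_mult[OF S])
  qed auto
  moreover have "\<forall>x\<in>S. (\<lambda>x. f (g x)) differentiable (at x)"
    using chain unfolding differentiable_def by blast
  ultimately show ?case by simp
qed

lemma smooth_on_cong:
  assumes "open S" "\<And>x. x \<in> S \<Longrightarrow> f x = g x"
  shows "smooth_on S f \<longleftrightarrow> smooth_on S g"
  using Ck_on_cong[OF assms(1), of f g] assms(2) unfolding smooth_on_def by blast

lemma smooth_on_subset: "smooth_on S f \<Longrightarrow> T \<subseteq> S \<Longrightarrow> smooth_on T f"
  unfolding smooth_on_def using Ck_on_subset by blast

text \<open>The gluing principle behind every extension by zero and every glued competitor below:
  different formulas are verified on the members of an open cover.\<close>

lemma smooth_on_Un:
  assumes "open S" "open T" "smooth_on S f" "smooth_on T f"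
  shows "smooth_on (S \<union> T) f"
proof -
  have "Ck_on n (\<Union>i\<in>{S,T}. i) f" for n
    using assms by (intro Ck_on_Un) (auto simp: smooth_on_def)
  then show ?thesis unfolding smooth_on_def by simp
qed

lemma smooth_on_const [simp]: "smooth_on S (\<lambda>x. c)"
  unfolding smooth_on_def by simp

lemma smooth_on_add: "open S \<Longrightarrow> smooth_on S f \<Longrightarrow> smooth_on S g \<Longrightarrow> smooth_on S (\<lambda>x. f x + g x)"
  by (simp add: smooth_on_def Ck_on_add)

lemma smooth_on_mult: "open S \<Longrightarrow> smooth_on S f \<Longrightarrow> smooth_on S g \<Longrightarrow> smooth_on S (\<lambda>x. f x * g x)"
  by (simp add: smooth_on_def Ck_on_mult)

lemma smooth_on_uminus: "open S \<Longrightarrow> smooth_on S f \<Longrightarrow> smooth_on S (\<lambda>x. - f x)"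
  using smooth_on_mult[of S "\<lambda>x. -1" f] by simp

lemma smooth_on_diff: "open S \<Longrightarrow> smooth_on S f \<Longrightarrow> smooth_on S g \<Longrightarrow> smooth_on S (\<lambda>x. f x - g x)"
  using smooth_on_add[of S f "\<lambda>x. - g x"] smooth_on_uminus[of S g] by simp

lemma smooth_on_power: "open S \<Longrightarrow> smooth_on S f \<Longrightarrow> smooth_on S (\<lambda>x. f x ^ n)"
  by (induction n) (simp_all add: smooth_on_mult)

lemma smooth_on_sum: "open S \<Longrightarrow> (\<And>i. i \<in> I \<Longrightarrow> smooth_on S (f i)) \<Longrightarrow> smooth_on S (\<lambda>x. \<Sum>i\<in>I. f i x)"
  by (simp add: smooth_on_def Ck_on_sum)

lemma smooth_on_prod: "open S \<Longrightarrow> (\<And>i. i \<in> I \<Longrightarrow> smooth_on S (f i)) \<Longrightarrow> smooth_on S (\<lambda>x. \<Prod>i\<in>I. f i x)"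
  by (induction I rule: infinite_finite_induct) (simp_all add: smooth_on_mult)

lemma smooth_on_linear: "bounded_linear f \<Longrightarrow> smooth_on S f"
  by (simp add: smooth_on_def Ck_on_linear)

lemma smooth_on_ident [simp]: "smooth_on S (\<lambda>x::real. x)"
  by (rule smooth_on_linear[OF bounded_linear_ident])

lemma smooth_on_fst [simp]: "smooth_on S (\<lambda>z::real \<times> real. fst z)"
  by (rule smooth_on_linear[OF bounded_linear_fst])

lemma smooth_on_snd [simp]: "smooth_on S (\<lambda>z::real \<times> real. snd z)"
  by (rule smooth_on_linear[OF bounded_linear_snd])

lemma smooth_on_compose:
  fixes f :: "'b::euclidean_space \<Rightarrow> real" and g :: "'a::euclidean_space \<Rightarrow> 'b"
  assumes "open S" "open T" "smooth_on T f"
    and "\<And>b. b \<in> Basis \<Longrightarrow> smooth_on S (\<lambda>x. g x \<bullet> b)" "\<And>x. x \<in> S \<Longrightarrow> g x \<in> T"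
  shows "smooth_on S (\<lambda>x. f (g x))"
proof -
  have "Ck_on n S (\<lambda>x. f (g x))" for n
    by (rule Ck_on_compose[OF assms(1,2)]) (use assms(3,4,5) in \<open>auto simp: smooth_on_def\<close>)
  then show ?thesis unfolding smooth_on_def by blast
qed

lemma smooth_on_compose_real:
  fixes f :: "real \<Rightarrow> real" and g :: "'a::euclidean_space \<Rightarrow> real"
  assumes "smooth_on T f" "open T" "open S" "smooth_on S g" "\<And>x. x \<in> S \<Longrightarrow> g x \<in> T"
  shows "smooth_on S (\<lambda>x. f (g x))"
  using smooth_on_compose[of S T f g] assms by auto

lemma smooth_on_compose_pair:
  fixes f :: "real \<times> real \<Rightarrow> real" and a b :: "'a::euclidean_space \<Rightarrow> real"
  assumes "smooth_on T f" "open T" "open S" "smooth_on S a" "smooth_on S b"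
    "\<And>x. x \<in> S \<Longrightarrow> (a x, b x) \<in> T"
  shows "smooth_on S (\<lambda>x. f (a x, b x))"
proof (rule smooth_on_compose[OF assms(3,2,1)])
  show "smooth_on S (\<lambda>x. (a x, b x) \<bullet> i)" if "i \<in> Basis" for i
    using that assms(4,5) by (auto simp: Basis_prod_def)
qed (use assms(6) in auto)

lemma smooth_on_imp_differentiable: "smooth_on S f \<Longrightarrow> x \<in> S \<Longrightarrow> f differentiable (at x)"
  unfolding smooth_on_def using Ck_on.simps(2)[of 0 S f] by blast

lemma smooth_on_imp_continuous: "smooth_on S f \<Longrightarrow> continuous_on S f"
  unfolding smooth_on_def using Ck_on.simps(1)[of S f] by blast

lemma smooth_on_frechet:
  "smooth_on S f \<Longrightarrow> b \<in> Basis \<Longrightarrow> smooth_on S (\<lambda>x. frechet_derivative f (at x) b)"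
  unfolding smooth_on_def using Ck_on.simps(2)[of _ S f] by blast

lemma Ck_on_real_Suc:
  fixes f :: "real \<Rightarrow> real"
  assumes "open S" "\<And>x. x \<in> S \<Longrightarrow> (f has_real_derivative f' x) (at x)" "Ck_on n S f'"
  shows "Ck_on (Suc n) S f"
proof -
  have "f differentiable (at x)" if "x \<in> S" for x
    using assms(2)[OF that] real_differentiable_def by blast
  moreover have "frechet_derivative f (at x) 1 = f' x" if "x \<in> S" for x
    using frechet_derivative_at'[OF assms(2)[OF that, unfolded has_field_derivative_def]] by simp
  ultimately show ?thesis
    using Ck_on_cong[OF assms(1), of "\<lambda>x. frechet_derivative f (at x) 1" f'] assms(3) by auto
qed

lemma smooth_on_exp: "smooth_on UNIV (exp :: real \<Rightarrow> real)"
proof -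
  have "Ck_on n UNIV (exp :: real \<Rightarrow> real)" for n
  proof (induction n)
    case (Suc n)
    then show ?case
      by (intro Ck_on_real_Suc[where f' = exp]) (auto intro!: derivative_eq_intros)
  qed (auto intro!: continuous_intros)
  then show ?thesis unfolding smooth_on_def by blast
qed

lemma smooth_on_inverse: "smooth_on (- {0}) (inverse :: real \<Rightarrow> real)"
proof -
  have "Ck_on n (- {0}) (inverse :: real \<Rightarrow> real)" for n
  proof (induction n)
    case (Suc n)
    have "Ck_on n (- {0}) (\<lambda>x::real. (- 1) * (inverse x * inverse x))"
      by (intro Ck_on_mult Ck_on_const Suc) auto
    then show ?case
      by (intro Ck_on_real_Suc[where f' = "\<lambda>x. (- 1) * (inverse x * inverse x)"])
         (auto intro!: derivative_eq_intros)
  qed (auto intro!: continuous_intros)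
  then show ?thesis unfolding smooth_on_def by blast
qed

lemma smooth_on_ln: "smooth_on {0<..} (ln :: real \<Rightarrow> real)"
proof -
  have "Ck_on n {0<..} (ln :: real \<Rightarrow> real)" for n
  proof (cases n)
    case (Suc m)
    have "Ck_on m {0<..} (inverse :: real \<Rightarrow> real)"
      using smooth_on_inverse Ck_on_subset[of m "- {0}" inverse "{0<..}"] unfolding smooth_on_def by auto
    then show ?thesis unfolding Suc
      by (intro Ck_on_real_Suc[where f' = inverse])
         (auto intro!: derivative_eq_intros simp: inverse_eq_divide)
  qed (auto intro!: continuous_intros)
  then show ?thesis unfolding smooth_on_def by blast
qed

lemma smooth_on_sqrt: "smooth_on {0<..} sqrt"
proof -
  have "smooth_on {0<..} (\<lambda>x::real. exp (ln x * (1 / 2)))"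
    by (intro smooth_on_compose_real[OF smooth_on_exp] smooth_on_mult smooth_on_ln) auto
  then show ?thesis
    by (subst smooth_on_cong[of _ _ "\<lambda>x. exp (ln x * (1 / 2))"]) (auto simp: powr_half_sqrt[symmetric] powr_def mult.commute)
qed

lemma smooth_on_divide:
  fixes f g :: "'a::euclidean_space \<Rightarrow> real"
  assumes "open S" "smooth_on S f" "smooth_on S g" "\<And>x. x \<in> S \<Longrightarrow> g x \<noteq> 0"
  shows "smooth_on S (\<lambda>x. f x / g x)"
  unfolding divide_inverse using assms
  by (intro smooth_on_mult smooth_on_compose_real[OF smooth_on_inverse]) auto

section \<open>Smooth cutoff functions of one variable\<close>

definition flat :: "nat \<Rightarrow> real \<Rightarrow> real" where
  "flat m t = (if t > 0 then exp (- (1 / t)) / t ^ m else 0)"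

lemma flat_at_0: "((\<lambda>t. flat m t / t) \<longlongrightarrow> 0) (at 0)"
proof (rule filterlim_split_at)
  show "((\<lambda>t. flat m t / t) \<longlongrightarrow> 0) (at_left 0)"
    by (rule tendsto_eventually) (auto simp: flat_def eventually_at_filter)
  have "((\<lambda>t::real. exp (- (1 / t)) / t ^ m / t) \<longlongrightarrow> 0) (at_right 0)"
    by real_asymp
  then show "((\<lambda>t. flat m t / t) \<longlongrightarrow> 0) (at_right 0)"
    by (rule Lim_transform_eventually) (auto simp: flat_def eventually_at_filter)
qed

lemma flat_deriv: "(flat m has_real_derivative flat (m + 2) t - real m * flat (m + 1) t) (at t)"
proof (cases t "0::real" rule: linorder_cases)
  case less
  have "((\<lambda>t. 0) has_real_derivative 0) (at t)" by simp
  then have "(flat m has_real_derivative 0) (at t)"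
    by (rule has_field_derivative_transform_within_open[where S = "{..<0}"]) (use less in \<open>auto simp: flat_def\<close>)
  with less show ?thesis by (simp add: flat_def)
next
  case equal
  have "(flat m has_real_derivative 0) (at 0)"
    unfolding has_field_derivative_iff using flat_at_0[of m] by (simp add: flat_def)
  then show ?thesis by (simp add: equal flat_def)
next
  case greater
  define E where "E = exp (- (1 / t))"
  have "((\<lambda>t. exp (- (1 / t)) / t ^ m) has_real_derivative
          ((E * (1 / t\<^sup>2)) * t ^ m - E * (real m * t ^ (m - 1))) / (t ^ m * t ^ m)) (at t)"
    unfolding E_def using greater
    by (intro DERIV_divide) (auto intro!: derivative_eq_intros simp: power2_eq_square)
  also have "((E * (1 / t\<^sup>2)) * t ^ m - E * (real m * t ^ (m - 1))) / (t ^ m * t ^ m)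
      = E / t ^ (m + 2) - real m * (E / t ^ (m + 1))"
  proof (cases m)
    case 0
    then show ?thesis by (simp add: power2_eq_square)
  next
    case (Suc j)
    define a where "a = t ^ j"
    have "a \<noteq> 0" "t \<noteq> 0" using greater by (auto simp: a_def)
    then have "((E * (1 / t\<^sup>2)) * (t * a) - E * (real m * a)) / ((t * a) * (t * a))
        = E / (t * t * (t * a)) - real m * (E / (t * (t * a)))"
      by (simp add: divide_simps power2_eq_square) (simp add: algebra_simps)
    then show ?thesis by (simp add: Suc a_def mult.assoc)
  qed
  finally have "((\<lambda>t. exp (- (1 / t)) / t ^ m) has_real_derivative
          (exp (- (1 / t)) / t ^ (m + 2) - real m * (exp (- (1 / t)) / t ^ (m + 1)))) (at t)"
    unfolding E_def .
  then have "(flat m has_real_derivative (exp (- (1 / t)) / t ^ (m + 2) - real m * (exp (- (1 / t)) / t ^ (m + 1)))) (at t)"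
    by (rule has_field_derivative_transform_within_open[where S = "{0<..}"]) (use greater in \<open>auto simp: flat_def\<close>)
  with greater show ?thesis by (simp add: flat_def)
qed

text \<open>The derivative of \<open>flat m\<close> is a combination of \<open>flat (m + 1)\<close>
  and \<open>flat (m + 2)\<close>, so the induction on the order of differentiability has to run
  over all m at once.\<close>

lemma smooth_on_flat: "smooth_on UNIV (flat m)"
proof -
  have "Ck_on n UNIV (flat m)" for n
  proof (induction n arbitrary: m)
    case 0
    show ?case 
      using flat_deriv by (auto intro!: continuous_at_imp_continuous_on DERIV_isCont)
  next
    case (Suc n)
    have "Ck_on n UNIV (\<lambda>t. flat (m + 2) t + (- real m) * flat (m + 1) t)"
      by (intro Ck_on_add Ck_on_mult Suc Ck_on_const) auto
    then show ?case
      using flat_deriv[of m] by (intro Ck_on_real_Suc[where f' = "\<lambda>t. flat (m + 2) t + (- real m) * flat (m + 1) t"]) auto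
  qed
  then show ?thesis unfolding smooth_on_def by blast
qed

lemma flat_pos_iff: "flat 0 t > 0 \<longleftrightarrow> t > 0"
  by (simp add: flat_def)

lemma flat_nonneg: "flat 0 t \<ge> 0" and flat_le_1: "flat 0 t \<le> 1"
  by (auto simp: flat_def)

text \<open>The usual partition-of-unity quotient. Since t and 1 - t are never both nonpositive, the
  denominator is positive, and the quotient passes smoothly from 0 for t \<le> 0 to 1 for t \<ge>
  1.\<close>

definition smooth_step :: "real \<Rightarrow> real" where
  "smooth_step t = flat 0 t / (flat 0 t + flat 0 (1 - t))"

lemma smooth_step_denom: "flat 0 t + flat 0 (1 - t) > 0"
  using flat_nonneg[of t] flat_nonneg[of "1 - t"] flat_pos_iff[of t] flat_pos_iff[of "1 - t"] by (cases "t > 0") auto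

lemma smooth_on_step: "smooth_on UNIV smooth_step"
proof -
  have ne: "flat 0 t + flat 0 (1 - t) \<noteq> 0" for t
    using smooth_step_denom[of t] by simp
  have 1: "smooth_on UNIV (\<lambda>t. flat 0 (1 - t))"
    by (rule smooth_on_compose_real[OF smooth_on_flat]) (simp_all add: smooth_on_diff)
  have "smooth_on UNIV (\<lambda>t. flat 0 t / (flat 0 t + flat 0 (1 - t)))"
    by (rule smooth_on_divide[OF open_UNIV smooth_on_flat smooth_on_add[OF open_UNIV smooth_on_flat 1]])
       (rule ne)
  then show ?thesis unfolding smooth_step_def[abs_def] .
qed

lemma smooth_step_0: "t \<le> 0 \<Longrightarrow> smooth_step t = 0"
  unfolding smooth_step_def flat_def[of 0 t] by simp

lemma smooth_step_1: "t \<ge> 1 \<Longrightarrow> smooth_step t = 1"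
  using flat_pos_iff[of t] unfolding smooth_step_def flat_def[of 0 "1 - t"] by simp

lemma smooth_step_nonneg: "0 \<le> smooth_step t"
  unfolding smooth_step_def by (intro divide_nonneg_nonneg add_nonneg_nonneg flat_nonneg)

lemma smooth_step_le_1: "smooth_step t \<le> 1"
proof -
  have "flat 0 t \<le> flat 0 t + flat 0 (1 - t)" using flat_nonneg[of "1 - t"] by simp
  then show ?thesis unfolding smooth_step_def using smooth_step_denom[of t] by (simp only: divide_le_eq_1_pos)
qed

subsection \<open>Gradients and test functions\<close>

lemma gderiv_unique:
  assumes "GDERIV f x :> D" "GDERIV f x :> D'" shows "D = D'"
proof -
  have "(\<lambda>h. h \<bullet> D) = (\<lambda>h. h \<bullet> D')"
    using has_derivative_unique assms unfolding gderiv_def by blast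
  then show ?thesis by (metis inner_commute vector_eq_ldot)
qed

lemma gradI: "GDERIV f x :> D \<Longrightarrow> grad f x = D"
  unfolding grad_def using gderiv_unique by blast

lemma GDERIV_grad:
  fixes f :: "'a::euclidean_space \<Rightarrow> real"
  assumes "f differentiable (at x)"
  shows "GDERIV f x :> grad f x"
proof -
  let ?D = "\<Sum>b\<in>Basis. frechet_derivative f (at x) b *\<^sub>R b"
  have l: "linear (frechet_derivative f (at x))"
    using assms by (simp add: linear_frechet_derivative)
  have "frechet_derivative f (at x) h = h \<bullet> ?D" for h
  proof -
    have "frechet_derivative f (at x) h = frechet_derivative f (at x) (\<Sum>b\<in>Basis. (h \<bullet> b) *\<^sub>R b)"
      by (simp add: euclidean_representation)
    also have "\<dots> = (\<Sum>b\<in>Basis. (h \<bullet> b) * frechet_derivative f (at x) b)"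
      using l by (simp add: linear_sum linear_cmul)
    finally show ?thesis by (simp add: inner_sum_right mult.commute)
  qed
  then have e: "frechet_derivative f (at x) = (\<lambda>h. h \<bullet> ?D)" by (rule ext)
  have D: "GDERIV f x :> ?D"
    using assms[unfolded frechet_derivative_works] by (simp only: gderiv_def e[symmetric])
  show ?thesis unfolding gradI[OF D] by (rule D)
qed

lemma grad_inner:
  fixes f :: "'a::euclidean_space \<Rightarrow> real"
  assumes "f differentiable (at x)"
  shows "grad f x \<bullet> h = frechet_derivative f (at x) h"
  using frechet_derivative_at'[OF GDERIV_grad[OF assms, unfolded gderiv_def]] by (simp add: inner_commute)

lemma has_derivative_grad:
  fixes f :: "'a::euclidean_space \<Rightarrow> real"
  assumes "f differentiable (at x)"
  shows "(f has_derivative (\<lambda>h. h \<bullet> grad f x)) (at x)"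
  using GDERIV_grad[OF assms] unfolding gderiv_def .

lemma grad_eq_on_open:
  assumes "open S" "x \<in> S" "\<And>y. y \<in> S \<Longrightarrow> f y = g y"
  shows "grad f x = grad g x"
proof -
  have "(f has_derivative f') (at x) \<longleftrightarrow> (g has_derivative f') (at x)" for f'
    using has_derivative_transform_within_open[OF _ assms(1,2), of f f' UNIV g]
      has_derivative_transform_within_open[OF _ assms(1,2), of g f' UNIV f] assms(3) by metis
  then show ?thesis unfolding grad_def gderiv_def by simp
qed

lemma grad_const [simp]: "grad (\<lambda>x. c) x = 0"
  by (rule gradI) (rule GDERIV_const)

lemma grad_add:
  fixes f g :: "'a::euclidean_space \<Rightarrow> real"
  assumes "f differentiable (at x)" "g differentiable (at x)"
  shows "grad (\<lambda>x. f x + g x) x = grad f x + grad g x"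
  by (rule gradI[OF GDERIV_add[OF GDERIV_grad[OF assms(1)] GDERIV_grad[OF assms(2)]]])

lemma grad_diff:
  fixes f g :: "'a::euclidean_space \<Rightarrow> real"
  assumes "f differentiable (at x)" "g differentiable (at x)"
  shows "grad (\<lambda>x. f x - g x) x = grad f x - grad g x"
  by (rule gradI[OF GDERIV_diff[OF GDERIV_grad[OF assms(1)] GDERIV_grad[OF assms(2)]]])

lemma grad_mult:
  fixes f g :: "'a::euclidean_space \<Rightarrow> real"
  assumes "f differentiable (at x)" "g differentiable (at x)"
  shows "grad (\<lambda>x. f x * g x) x = f x *\<^sub>R grad g x + g x *\<^sub>R grad f x"
  by (rule gradI[OF GDERIV_mult[OF GDERIV_grad[OF assms(1)] GDERIV_grad[OF assms(2)]]])

lemma continuous_on_grad: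
  fixes f :: "'a::euclidean_space \<Rightarrow> real"
  assumes "smooth_on S f"
  shows "continuous_on S (grad f)"
proof (subst continuous_on_componentwise, intro ballI)
  fix b :: 'a assume b: "b \<in> Basis"
  have "continuous_on S (\<lambda>x. frechet_derivative f (at x) b)"
    by (rule smooth_on_imp_continuous[OF smooth_on_frechet[OF assms b]])
  then show "continuous_on S (\<lambda>x. grad f x \<bullet> b)"
    using smooth_on_imp_differentiable[OF assms]
    by (subst continuous_on_cong[OF refl, of S _ "\<lambda>x. frechet_derivative f (at x) b"]) (simp_all add: grad_inner)
qed

section \<open>Integrals of continuous functions with compact support\<close>

lemma
  fixes f :: "'a::euclidean_space \<Rightarrow> 'b::euclidean_space"
  assumes U: "open U" and f: "continuous_on U f" and K: "compact K" "K \<subseteq> U" and z: "\<And>x. x \<notin> K \<Longrightarrow> f x = 0"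
  shows compact_support_integrable: "integrable lborel f"
    and compact_support_integrable_on: "integrable (lebesgue_on U) f"
    and compact_support_integral_on: "(LINT x|lebesgue_on U. f x) = (LINT x|lborel. f x)"
proof -
  \<comment> \<open>f is zero on the open set - K, which together with U covers the space;
    continuity on U thus gives continuity everywhere.\<close>
  have "continuous_on (- K) f"
    using z by (subst continuous_on_cong[OF refl, of _ _ "\<lambda>x. 0"]) auto
  then have "continuous_on (U \<union> - K) f"
    using U K f by (intro continuous_on_open_Un) (auto simp: compact_imp_closed)
  also have "U \<union> - K = UNIV" using K by auto
  finally have c: "continuous_on UNIV f" .
  have "(\<lambda>x. indicator K x *\<^sub>R f x) = f" using z by (auto simp: indicator_def fun_eq_iff)
  then show i: "integrable lborel f"
    using borel_integrable_compact[OF K(1), of f] continuous_on_subset[OF c] by auto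
  have U': "U \<inter> space lebesgue \<in> sets lebesgue" using U by auto
  have b: "f \<in> borel_measurable lborel" using i by auto
  have e: "(\<lambda>x. indicator U x *\<^sub>R f x) = f" using z K by (auto simp: indicator_def fun_eq_iff)
  show "integrable (lebesgue_on U) f" "(LINT x|lebesgue_on U. f x) = (LINT x|lborel. f x)"
    using i by (simp_all add: integrable_restrict_space[OF U'] integral_restrict_space[OF U'] e
      integrable_completion[OF b] integral_completion[OF b])
qed

section \<open>Test functions and integration by parts\<close>

lemma test_functionsI:
  assumes "smooth_on UNIV f" "compact K" "K \<subseteq> U" "\<And>x. x \<notin> K \<Longrightarrow> f x = 0"
  shows "f \<in> test_functions U"
proof -
  have "closure {x. f x \<noteq> 0} \<subseteq> K"
    using assms by (intro closure_minimal) (auto simp: compact_imp_closed)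
  moreover from this have "compact (closure {x. f x \<noteq> 0})"
    using assms(2) compact_Int_closed[of K "closure {x. f x \<noteq> 0}"] by (simp add: Int_absorb1)
  ultimately show ?thesis using assms unfolding test_functions_def by blast
qed

lemma test_functionsE:
  assumes "f \<in> test_functions U"
  obtains K where "compact K" "K \<subseteq> U" "\<And>x. x \<notin> K \<Longrightarrow> f x = 0" "\<And>x. x \<notin> K \<Longrightarrow> grad f x = 0"
proof -
  define K where "K = closure {x. f x \<noteq> 0}"
  have K: "compact K" "K \<subseteq> U" using assms unfolding test_functions_def K_def by simp_all
  have z: "f x = 0" if "x \<notin> K" for x
    using that closure_subset[of "{x. f x \<noteq> 0}"] unfolding K_def by blast
  have "open (- K)" using K(1) by (simp add: compact_imp_closed open_Compl)
  then have "grad f x = grad (\<lambda>x. 0) x" if "x \<notin> K" for x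
    by (rule grad_eq_on_open) (use that z in simp_all)
  then have g: "grad f x = 0" if "x \<notin> K" for x using that by simp
  show ?thesis by (rule that[OF K z g])
qed

lemma test_functions_smooth: "f \<in> test_functions U \<Longrightarrow> smooth_on UNIV f"
  by (simp add: test_functions_def)

lemma test_functions_differentiable: "f \<in> test_functions U \<Longrightarrow> f differentiable (at x)"
  using smooth_on_imp_differentiable[OF test_functions_smooth] by auto

lemma test_functions_mono: "U \<subseteq> V \<Longrightarrow> f \<in> test_functions U \<Longrightarrow> f \<in> test_functions V"
  by (auto simp: test_functions_def)

lemma test_functions_add:
  assumes "f \<in> test_functions U" "g \<in> test_functions U"
  shows "(\<lambda>x. f x + g x) \<in> test_functions U"
proof -
  obtain K where K: "compact K" "K \<subseteq> U" "\<And>x. x \<notin> K \<Longrightarrow> f x = 0" using test_functionsE[OF assms(1)] by metis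
  obtain L where L: "compact L" "L \<subseteq> U" "\<And>x. x \<notin> L \<Longrightarrow> g x = 0" using test_functionsE[OF assms(2)] by metis
  show ?thesis
    using K L by (intro test_functionsI[of _ "K \<union> L"] smooth_on_add assms[THEN test_functions_smooth]) auto
qed

text \<open>Nothing is known of u outside U, but the product is zero off K, and the open sets U and
  - K cover the space.\<close>

lemma smooth_on_mult_compact_support:
  assumes U: "open U" and u: "smooth_on U u" and f: "smooth_on UNIV f"
    and K: "closed K" "K \<subseteq> U" and z: "\<And>x. x \<notin> K \<Longrightarrow> f x = 0"
  shows "smooth_on UNIV (\<lambda>x. u x * f x)"
proof -
  have 1: "smooth_on U (\<lambda>x. u x * f x)"
    by (rule smooth_on_mult[OF U u smooth_on_subset[OF f]]) simp
  have "open (- K)" using K(1) by (simp add: open_Compl)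
  then have 2: "smooth_on (- K) (\<lambda>x. u x * f x)"
    by (subst smooth_on_cong[where g = "\<lambda>x. 0"]) (simp_all add: z)
  have "smooth_on (U \<union> - K) (\<lambda>x. u x * f x)"
    using smooth_on_Un[OF U _ 1 2] K(1) by (simp add: open_Compl)
  moreover have "U \<union> - K = UNIV" using K by auto
  ultimately show ?thesis by simp
qed

lemma test_functions_mult:
  assumes U: "open U" and u: "smooth_on U u" and f: "f \<in> test_functions U"
  shows "(\<lambda>x. u x * f x) \<in> test_functions U"
proof -
  obtain K where K: "compact K" "K \<subseteq> U" "\<And>x. x \<notin> K \<Longrightarrow> f x = 0" using test_functionsE[OF f] by metis
  show ?thesis
    by (rule test_functionsI[OF smooth_on_mult_compact_support[OF U u test_functions_smooth[OF f] _ K(2,3)] K(1,2)])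
       (use K in \<open>auto simp: compact_imp_closed\<close>)
qed

lemma test_functions_diff:
  assumes "f \<in> test_functions U" "g \<in> test_functions U"
  shows "(\<lambda>x. f x - g x) \<in> test_functions U"
proof -
  have "(\<lambda>x. -1 * g x) \<in> test_functions UNIV"
    by (rule test_functions_mult[OF open_UNIV smooth_on_const test_functions_mono[OF subset_UNIV assms(2)]])
  then have "(\<lambda>x. - g x) \<in> test_functions U"
    using assms(2) unfolding test_functions_def by auto
  then show ?thesis using test_functions_add[OF assms(1), of "\<lambda>x. - g x"] by simp
qed

text \<open>Lebesgue measure is translation invariant, so difference quotients of \<open>f\<close> have integral zero.\<close>

lemma integral_grad_eq_0:
  fixes f :: "'a::euclidean_space \<Rightarrow> real"
  assumes "f \<in> test_functions UNIV"
  shows "(LINT x|lborel. grad f x \<bullet> b) = 0"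
proof -
  obtain K where K: "compact K" "\<And>x. x \<notin> K \<Longrightarrow> f x = 0" "\<And>x. x \<notin> K \<Longrightarrow> grad f x = 0"
    using test_functionsE[OF assms] by metis
  have sm: "smooth_on UNIV f" using test_functions_smooth[OF assms] .
  have cf: "continuous_on UNIV f" using smooth_on_imp_continuous[OF sm] .
  have cg: "continuous_on UNIV (grad f)" using continuous_on_grad[OF sm] .
  obtain M where M: "\<And>x. norm (grad f x) \<le> M"
  proof -
    have "bounded (grad f ` K)" using K(1) cg by (intro compact_imp_bounded compact_continuous_image) (auto intro: continuous_on_subset)
    then obtain M where "\<forall>x\<in>K. norm (grad f x) \<le> M" by (auto simp: bounded_iff)
    then have "norm (grad f x) \<le> max M 0" for x using K(3)[of x] by (cases "x \<in> K") auto
    then show ?thesis using that by blast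
  qed
  obtain R where R: "\<And>x. x \<in> K \<Longrightarrow> norm x \<le> R" using compact_imp_bounded[OF K(1)] by (auto simp: bounded_iff)
  define D where "D n x = (f (x + (1 / real (Suc n)) *\<^sub>R b) - f x) * real (Suc n)" for n x
  have fi: "integrable lborel f" 
    by (rule compact_support_integrable[of UNIV _ K]) (use cf K in auto)
  have shift: "integrable lborel (\<lambda>x. f (x + c))" "(LINT x|lborel. f (x + c)) = (LINT x|lborel. f x)" for c
  proof -
    have m: "(+) c \<in> lborel \<rightarrow>\<^sub>M borel" "f \<in> borel_measurable borel" using fi by auto
    have "integrable (distr lborel borel ((+) c)) f" "(LINT x|distr lborel borel ((+) c). f x) = (LINT x|lborel. f x)"
      using fi by (simp_all only: lborel_distr_plus)
    then show "integrable lborel (\<lambda>x. f (x + c))" "(LINT x|lborel. f (x + c)) = (LINT x|lborel. f x)"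
      using integrable_distr_eq[OF m] integral_distr[OF m] by (simp_all add: add.commute)
  qed
  have D0: "(LINT x|lborel. D n x) = 0" for n
    unfolding D_def using shift fi by simp
  have lim: "(\<lambda>n. D n x) \<longlonglongrightarrow> grad f x \<bullet> b" for x
  proof -
    have "((\<lambda>t. f (x + t *\<^sub>R b)) has_derivative (\<lambda>t. (t *\<^sub>R b) \<bullet> grad f (x + 0 *\<^sub>R b))) (at 0)"
      by (rule has_derivative_compose[where f = "\<lambda>t. x + t *\<^sub>R b" and g = f, OF _ has_derivative_grad])
         (auto intro!: derivative_eq_intros smooth_on_imp_differentiable[OF sm])
    then have "((\<lambda>t. f (x + t *\<^sub>R b)) has_real_derivative (grad f x \<bullet> b)) (at 0)"
      unfolding has_field_derivative_def by (simp add: inner_commute mult_commute_abs)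
    then have "((\<lambda>t. (f (x + t *\<^sub>R b) - f x) / t) \<longlongrightarrow> grad f x \<bullet> b) (at 0)"
      unfolding has_field_derivative_iff by simp
    moreover have "filterlim (\<lambda>n. 1 / real (Suc n)) (at 0) sequentially"
      by real_asymp
    ultimately have "((\<lambda>n. (f (x + (1 / real (Suc n)) *\<^sub>R b) - f x) / (1 / real (Suc n))) \<longlongrightarrow> grad f x \<bullet> b) sequentially"
      by (rule filterlim_compose)
    then show ?thesis unfolding D_def by simp
  qed
  \<comment> \<open>The increments have length at most \<open>norm b\<close>, so all difference
    quotients vanish outside the ball of radius \<open>R + norm b\<close>; inside it the mean value
    inequality bounds them.\<close>
  define w where "w x = indicator (cball 0 (R + norm b)) x *\<^sub>R (M * norm b)" for x :: 'a
  have wi: "integrable lborel w"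
    unfolding w_def by (rule borel_integrable_compact) auto
  have bd: "norm (D n x) \<le> w x" for n x
  proof (cases "x \<in> cball 0 (R + norm b)")
    case True
    have "norm (f (x + (1 / real (Suc n)) *\<^sub>R b) - f x) \<le> M * norm (x + (1 / real (Suc n)) *\<^sub>R b - x)"
    proof (rule differentiable_bound[of UNIV f "\<lambda>x h. h \<bullet> grad f x"])
      show "onorm (\<lambda>h. h \<bullet> grad f x) \<le> M" for x
        by (rule onorm_le) (metis M Cauchy_Schwarz_ineq2 mult.commute mult_right_mono norm_ge_zero order_trans real_norm_def)
    qed (auto intro!: has_derivative_grad smooth_on_imp_differentiable[OF sm])
    also have "norm (x + (1 / real (Suc n)) *\<^sub>R b - x) = norm b / real (Suc n)" by simp
    finally have "norm (D n x) \<le> M * norm b"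
      unfolding D_def by (simp add: abs_mult pos_le_divide_eq)
    then show ?thesis using True by (simp add: w_def)
  next
    case False
    then have x: "norm x > R + norm b" by simp
    have "norm x \<le> norm (x + (1 / real (Suc n)) *\<^sub>R b) + norm ((1 / real (Suc n)) *\<^sub>R b)"
      using norm_triangle_ineq4[of "x + (1 / real (Suc n)) *\<^sub>R b" "(1 / real (Suc n)) *\<^sub>R b"] by simp
    also have "norm ((1 / real (Suc n)) *\<^sub>R b) \<le> norm b" by (simp add: divide_le_eq mult_le_cancel_left1)
    finally have "x + (1 / real (Suc n)) *\<^sub>R b \<notin> K" "x \<notin> K"
      using x R[of "x + (1 / real (Suc n)) *\<^sub>R b"] R[of x] norm_ge_zero[of b] by linarith+
    then show ?thesis using False K(2) by (simp add: D_def w_def)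
  qed
  have "(\<lambda>n. LINT x|lborel. D n x) \<longlonglongrightarrow> (LINT x|lborel. grad f x \<bullet> b)"
  proof (rule integral_dominated_convergence[where w = w])
    have "continuous_on UNIV (\<lambda>x. grad f x \<bullet> b)" using cg by (intro continuous_intros)
    then show "(\<lambda>x. grad f x \<bullet> b) \<in> borel_measurable lborel" by (simp add: borel_measurable_continuous_onI)
    show "D n \<in> borel_measurable lborel" for n
      unfolding D_def[abs_def] using shift(1) fi by (intro borel_measurable_times borel_measurable_diff borel_measurable_integrable) auto
  qed (use wi lim bd in auto)
  with D0 show ?thesis using LIMSEQ_unique[of "\<lambda>n. 0::real"] by simp
qed

lemma integral_grad_eq_0':
  fixes f :: "'a::euclidean_space \<Rightarrow> real"
  assumes "f \<in> test_functions UNIV"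
  shows "(LINT x|lborel. grad f x) = 0"
proof (rule euclidean_eqI)
  fix b :: 'a assume "b \<in> Basis"
  obtain K where K: "compact K" "\<And>x. x \<notin> K \<Longrightarrow> grad f x = 0"
    using test_functionsE[OF assms] by metis
  have "integrable lborel (grad f)"
    by (rule compact_support_integrable[of UNIV _ K]) (use K continuous_on_grad[OF test_functions_smooth[OF assms]] in auto)
  then show "(LINT x|lborel. grad f x) \<bullet> b = 0 \<bullet> b"
    using integral_grad_eq_0[OF assms, of b] by (simp add: integral_inner_left)
qed

text \<open>The gradient of a test function integrates to zero. This is applied to the product u *
  f, which is a test function although u is controlled only on U.\<close>

lemma integral_by_parts_test:
  fixes u :: "'a::euclidean_space \<Rightarrow> real"
  assumes U: "open U" and u: "smooth_on U u" and f: "f \<in> test_functions U"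
  shows "(LINT x|lebesgue_on U. u x *\<^sub>R grad f x) = - (LINT x|lebesgue_on U. f x *\<^sub>R grad u x)"
proof -
  obtain K where K: "compact K" "K \<subseteq> U" "\<And>x. x \<notin> K \<Longrightarrow> f x = 0" "\<And>x. x \<notin> K \<Longrightarrow> grad f x = 0"
    using test_functionsE[OF f] by metis
  have c: "continuous_on U u" "continuous_on U (grad u)" "continuous_on U f" "continuous_on U (grad f)"
    using smooth_on_imp_continuous[OF u] continuous_on_grad[OF u]
      smooth_on_imp_continuous[OF test_functions_smooth[OF f]] continuous_on_grad[OF test_functions_smooth[OF f]]
    by (auto intro: continuous_on_subset)
  have uf: "(\<lambda>x. u x * f x) \<in> test_functions U" by (rule test_functions_mult[OF U u f])
  have g: "grad (\<lambda>x. u x * f x) x = u x *\<^sub>R grad f x + f x *\<^sub>R grad u x" for x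
  proof (cases "x \<in> U")
    case True
    then show ?thesis
      using grad_mult[OF smooth_on_imp_differentiable[OF u] test_functions_differentiable[OF f]] by blast
  next
    case False
    then have x: "x \<in> - K" using K by auto
    have "grad (\<lambda>x. u x * f x) x = grad (\<lambda>x. 0) x"
      by (rule grad_eq_on_open[OF _ x]) (use K in \<open>auto simp: compact_imp_closed\<close>)
    then show ?thesis using K x by simp
  qed
  have i1: "integrable lborel (\<lambda>x. u x *\<^sub>R grad f x)"
   "(LINT x|lebesgue_on U. u x *\<^sub>R grad f x) = (LINT x|lborel. u x *\<^sub>R grad f x)"
    using c K by (auto intro!: compact_support_integrable[OF U _ K(1,2)] compact_support_integral_on[OF U _ K(1,2)] continuous_on_scaleR)
  have i2: "integrable lborel (\<lambda>x. f x *\<^sub>R grad u x)"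
   "(LINT x|lebesgue_on U. f x *\<^sub>R grad u x) = (LINT x|lborel. f x *\<^sub>R grad u x)"
    using c K by (auto intro!: compact_support_integrable[OF U _ K(1,2)] compact_support_integral_on[OF U _ K(1,2)] continuous_on_scaleR)
  have "0 = (LINT x|lborel. grad (\<lambda>x. u x * f x) x)"
    using integral_grad_eq_0'[OF test_functions_mono[OF subset_UNIV uf]] by simp
  also have "\<dots> = (LINT x|lborel. u x *\<^sub>R grad f x) + (LINT x|lborel. f x *\<^sub>R grad u x)"
    unfolding g by (rule Bochner_Integration.integral_add[OF i1(1) i2(1)])
  finally show ?thesis using i1 i2 by (metis add.inverse_inverse add_eq_0_iff)
qed

subsection \<open>The fundamental lemma of the calculus of variations\<close>

lemma sigma_finite_lebesgue: "sigma_finite_measure (lebesgue :: 'a::euclidean_space measure)"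
proof (rule sigma_finite_measure.intro)
  have *: "\<exists>A. countable A \<and> A \<subseteq> sets (lborel :: 'a measure) \<and> \<Union>A = space lborel \<and> (\<forall>a\<in>A. emeasure lborel a \<noteq> \<infinity>)"
    by (rule lborel.sigma_finite_countable)
  show "\<exists>A. countable A \<and> A \<subseteq> sets lebesgue \<and> \<Union>A = space (lebesgue :: 'a measure) \<and> (\<forall>a\<in>A. emeasure lebesgue a \<noteq> \<infinity>)"
    using * 
  proof (elim exE conjE, intro exI conjI)
    fix A :: "'a set set"
    assume A: "countable A" "A \<subseteq> sets lborel" "\<Union>A = space lborel" "\<forall>a\<in>A. emeasure lborel a \<noteq> \<infinity>"
    show "countable A" by fact
    show "A \<subseteq> sets lebesgue" using A(2) sets_completionI_sets by blast
    show "\<Union>A = space lebesgue" using A(3) by simp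
    show "\<forall>a\<in>A. emeasure lebesgue a \<noteq> \<infinity>"
    proof
      fix a assume "a \<in> A"
      then have "a \<in> sets lborel" "emeasure lborel a \<noteq> \<infinity>" using A(2,4) by blast+
      then show "emeasure lebesgue a \<noteq> \<infinity>" 
        using emeasure_completion[OF sets_completionI_sets] main_part by metis
    qed
  qed
qed

text \<open>Open boxes form an intersection-stable generator of the Borel sets, and the sets over
  which f integrates to zero form a Dynkin system; the total integral enters through complements.
  Lebesgue sets differ from Borel sets by null sets only.\<close>

lemma zero_on_boxes_imp_zero:
  fixes f :: "'a::euclidean_space \<Rightarrow> 'b::euclidean_space"
  assumes f: "integrable lebesgue f" and f0: "(LINT x|lebesgue. f x) = 0"
    and box: "\<And>c d. (LINT x:box c d|lebesgue. f x) = 0"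
  shows "AE x in lebesgue. f x = 0"
proof (rule sigma_finite_measure.density_zero[OF _ f])
  show "sigma_finite_measure (lebesgue :: 'a measure)" by (rule sigma_finite_lebesgue)
  have sf: "set_integrable lebesgue A f" if "A \<in> sets lebesgue" for A
    unfolding set_integrable_def using integrable_mult_indicator[OF that f] .
  have borel: "(LINT x:A|lebesgue. f x) = 0" if A: "A \<in> sets borel" for A
  proof -
    let ?G = "range (\<lambda>(a, b). box a b :: 'a set)"
    have sb: "sigma_sets UNIV ?G = sets borel"
      by (subst borel_eq_box) (simp add: sets_measure_of)
    then have sl: "X \<in> sets lebesgue" if "X \<in> sigma_sets UNIV ?G" for X
      using that by auto
    have "A \<in> sigma_sets UNIV ?G" using A sb by simp
    then show ?thesis
    proof (rule sigma_sets_induct_disjoint[of ?G UNIV A "\<lambda>A. (LINT x:A|lebesgue. f x) = 0", rotated 2])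
      show "Int_stable ?G" by (auto simp: Int_stable_def box_Int_box)
      show "?G \<subseteq> Pow UNIV" by simp
      show "(LINT x:A|lebesgue. f x) = 0" if "A \<in> ?G" for A
        using that box by auto
      show "(LINT x:{}|lebesgue. f x) = 0" by (simp add: set_lebesgue_integral_def)
      show "(LINT x:UNIV - A|lebesgue. f x) = 0" 
        if A: "A \<in> sigma_sets UNIV ?G" "(LINT x:A|lebesgue. f x) = 0" for A
      proof -
        have "(LINT x:UNIV - A|lebesgue. f x) = (LINT x|lebesgue. f x - indicator A x *\<^sub>R f x)"
          unfolding set_lebesgue_integral_def by (rule Bochner_Integration.integral_cong) (auto simp: indicator_def)
        also have "\<dots> = (LINT x|lebesgue. f x) - (LINT x:A|lebesgue. f x)"
          using sf[OF sl[OF A(1)]] f unfolding set_lebesgue_integral_def set_integrable_def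
          by (intro Bochner_Integration.integral_diff)
        finally show ?thesis using A(2) f0 by simp
      qed
      show "(LINT x:(\<Union>i. A i)|lebesgue. f x) = 0"
        if A: "disjoint_family A" "range A \<subseteq> sigma_sets UNIV ?G" "\<And>i::nat. (LINT x:A i|lebesgue. f x) = 0" for A
      proof -
        have "(LINT x:(\<Union>i. A i)|lebesgue. f x) = (\<Sum>i. (LINT x:A i|lebesgue. f x))"
        proof (rule lebesgue_integral_countable_add)
          show 1: "A i \<in> sets lebesgue" for i using A(2) sl by blast
          have "(\<Union>i. A i) \<in> sets lebesgue" using 1 by (intro sets.countable_UN) auto
          then show "set_integrable lebesgue (\<Union>i. A i) f" by (rule sf)
          show "A i \<inter> A j = {}" if "i \<noteq> j" for i j
            using A(1) that by (auto simp: disjoint_family_on_def)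
        qed
        then show ?thesis using A(3) by simp
      qed
    qed
  qed
  fix A :: "'a set" assume "A \<in> sets lebesgue"
  then obtain S N N' where A: "A = S \<union> N" "N \<subseteq> N'" "N' \<in> null_sets lborel" "S \<in> sets lborel"
    by (rule sets_completionE)
  have "(LINT x:A|lebesgue. f x) = (LINT x:S|lebesgue. f x)"
    unfolding set_lebesgue_integral_def
  proof (rule integral_cong_AE)
    have "AE x in lebesgue. x \<notin> N'"
      using AE_not_in[OF A(3)] by (rule AE_completion)
    then show "AE x in lebesgue. indicat_real A x *\<^sub>R f x = indicat_real S x *\<^sub>R f x"
      by (rule AE_mp) (use A in \<open>auto simp: indicator_def\<close>)
    have "S \<in> sets lebesgue" using A(4) by simp
    then show "(\<lambda>x. indicat_real A x *\<^sub>R f x) \<in> borel_measurable lebesgue"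
        "(\<lambda>x. indicat_real S x *\<^sub>R f x) \<in> borel_measurable lebesgue"
      using integrable_mult_indicator[OF _ f] \<open>A \<in> sets lebesgue\<close> borel_measurable_integrable by blast+
  qed
  then show "(LINT x:A|lebesgue. f x) = 0" using borel[of S] A(4) by simp
qed

section \<open>Functions annihilated by all test functions\<close>

definition box_bump :: "'a::euclidean_space \<Rightarrow> 'a \<Rightarrow> nat \<Rightarrow> 'a \<Rightarrow> real" where
  "box_bump a b n x = (\<Prod>i\<in>Basis. flat 0 (real (Suc n) * (x \<bullet> i - a \<bullet> i)) * flat 0 (real (Suc n) * (b \<bullet> i - x \<bullet> i)))"

lemma box_bump_bounds: "0 \<le> box_bump a b n x" "box_bump a b n x \<le> 1"
  unfolding box_bump_def by (auto intro!: prod_nonneg prod_le_1 mult_nonneg_nonneg flat_nonneg mult_le_one flat_le_1)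

lemma box_bump_outside:
  assumes "x \<notin> box a b" shows "box_bump a b n x = 0"
proof -
  obtain i where i: "i \<in> Basis" "\<not> (a \<bullet> i < x \<bullet> i \<and> x \<bullet> i < b \<bullet> i)" using assms by (auto simp: mem_box)
  have "flat 0 (real (Suc n) * (x \<bullet> i - a \<bullet> i)) * flat 0 (real (Suc n) * (b \<bullet> i - x \<bullet> i)) = 0"
    using i(2) by (auto simp: flat_def zero_less_mult_iff)
  then show ?thesis unfolding box_bump_def using i(1) by (intro prod_zero) auto
qed

lemma box_bump_test:
  fixes a b :: "'a::euclidean_space"
  assumes "cbox a b \<subseteq> U"
  shows "box_bump a b n \<in> test_functions U"
proof (rule test_functionsI[of _ "cbox a b"])
  have "smooth_on UNIV (\<lambda>x::'a. flat 0 (real (Suc n) * (x \<bullet> i - a \<bullet> i)))"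
    "smooth_on UNIV (\<lambda>x::'a. flat 0 (real (Suc n) * (b \<bullet> i - x \<bullet> i)))" for i
  proof -
    have l: "smooth_on UNIV (\<lambda>x::'a. x \<bullet> i)"
      by (rule smooth_on_linear[OF bounded_linear_inner_left])
    have "smooth_on UNIV (\<lambda>x::'a. real (Suc n) * (x \<bullet> i - a \<bullet> i))" "smooth_on UNIV (\<lambda>x::'a. real (Suc n) * (b \<bullet> i - x \<bullet> i))"
      by (simp_all only: smooth_on_mult smooth_on_diff l smooth_on_const open_UNIV)
    then show "smooth_on UNIV (\<lambda>x::'a. flat 0 (real (Suc n) * (x \<bullet> i - a \<bullet> i)))"
      "smooth_on UNIV (\<lambda>x::'a. flat 0 (real (Suc n) * (b \<bullet> i - x \<bullet> i)))"
      using smooth_on_compose_real[OF smooth_on_flat open_UNIV open_UNIV] by auto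
  qed
  then show "smooth_on UNIV (box_bump a b n)"
    unfolding box_bump_def[abs_def] by (intro smooth_on_prod smooth_on_mult open_UNIV)
  show "box_bump a b n x = 0" if "x \<notin> cbox a b" for x
    using that box_subset_cbox by (intro box_bump_outside) blast
qed (use assms in auto)

text \<open>Inside the box the argument of every factor grows to infinity, where
  \<open>flat 0\<close> tends to 1; outside, the bump is zero for every n. Together with the bound
  by 1 this is a dominated approximation of an indicator by test functions.\<close>

lemma box_bump_tendsto: "(\<lambda>n. box_bump a b n x) \<longlonglongrightarrow> indicator (box a b) x"
proof (cases "x \<in> box a b")
  case True
  have 1: "(\<lambda>n. flat 0 (real (Suc n) * t)) \<longlonglongrightarrow> 1" if "t > 0" for t
  proof -
    have "(\<lambda>n. exp (- (1 / (real (Suc n) * t)))) \<longlonglongrightarrow> 1"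
      using that by real_asymp
    then show ?thesis using that by (simp add: flat_def)
  qed
  have "(\<lambda>n. box_bump a b n x) \<longlonglongrightarrow> (\<Prod>i\<in>(Basis::'a set). 1 * 1)"
    unfolding box_bump_def by (intro tendsto_prod tendsto_mult 1) (use True in \<open>auto simp: mem_box\<close>)
  then show ?thesis using True by simp
qed (simp add: box_bump_outside)

text \<open>Testing against the bumps and passing to the limit gives integral zero over every box
  whose closed box lies in U. Integrability is asked only on closed boxes inside U, because the
  lemma is also applied to classical gradients not yet known to be square integrable on U.\<close>

lemma weak_zero:
  fixes D :: "'a::euclidean_space \<Rightarrow> 'b::euclidean_space"
  assumes U: "open U"
    and D: "\<And>a b. cbox a b \<subseteq> U \<Longrightarrow> integrable lebesgue (\<lambda>x. indicat_real (cbox a b) x *\<^sub>R D x)"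
    and z: "\<And>\<phi>. \<phi> \<in> test_functions U \<Longrightarrow> (LINT x|lebesgue_on U. \<phi> x *\<^sub>R D x) = 0"
  shows "AE x in lebesgue_on U. D x = 0"
proof -
  have U': "U \<inter> space lebesgue \<in> sets lebesgue" using U by auto
  have bx: "(LINT x|lebesgue. indicat_real (box a b) x *\<^sub>R D x) = 0" if ab: "cbox a b \<subseteq> U" for a b
  proof -
    let ?s = "\<lambda>n x. box_bump a b n x *\<^sub>R (indicat_real (cbox a b) x *\<^sub>R D x)"
    let ?f = "\<lambda>x. indicat_real (box a b) x *\<^sub>R (indicat_real (cbox a b) x *\<^sub>R D x)"
    have "(\<lambda>n. LINT x|lebesgue. ?s n x) \<longlonglongrightarrow> (LINT x|lebesgue. ?f x)"
    proof (rule integral_dominated_convergence[where w = "\<lambda>x. norm (indicat_real (cbox a b) x *\<^sub>R D x)"])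
      show "integrable lebesgue (\<lambda>x. norm (indicat_real (cbox a b) x *\<^sub>R D x))"
        using D[OF ab] by (rule integrable_norm)
      have Dm: "(\<lambda>x. indicat_real (cbox a b) x *\<^sub>R D x) \<in> borel_measurable lebesgue"
        using D[OF ab] by (rule borel_measurable_integrable)
      have "box a b \<in> sets lebesgue" by simp
      then show "?f \<in> borel_measurable lebesgue"
        using integrable_mult_indicator[OF _ D[OF ab]] borel_measurable_integrable by blast
      have "box_bump a b n \<in> borel_measurable lebesgue" for n
        using smooth_on_imp_continuous[OF test_functions_smooth[OF box_bump_test[OF ab]]]
        by (intro measurable_completion) (simp add: borel_measurable_continuous_onI)
      then show "?s n \<in> borel_measurable lebesgue" for n
        by (rule borel_measurable_scaleR[OF _ Dm])
      show "AE x in lebesgue. (\<lambda>n. ?s n x) \<longlonglongrightarrow> ?f x"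
        by (intro AE_I2 tendsto_scaleR box_bump_tendsto tendsto_const)
      show "AE x in lebesgue. norm (?s n x) \<le> norm (indicat_real (cbox a b) x *\<^sub>R D x)" for n
      proof (rule AE_I2)
        fix x
        have "norm (?s n x) = box_bump a b n x * norm (indicat_real (cbox a b) x *\<^sub>R D x)"
          using box_bump_bounds(1)[of a b n x] by simp
        also have "\<dots> \<le> 1 * norm (indicat_real (cbox a b) x *\<^sub>R D x)"
          by (intro mult_right_mono box_bump_bounds) simp
        finally show "norm (?s n x) \<le> norm (indicat_real (cbox a b) x *\<^sub>R D x)" by simp
      qed
    qed
    moreover have "(LINT x|lebesgue. ?s n x) = 0" for n
    proof -
      have "?s n x = indicat_real U x *\<^sub>R (box_bump a b n x *\<^sub>R D x)" for x
        using ab box_bump_outside[of x a b n] box_subset_cbox[of a b] by (auto simp: indicator_def)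
      then show ?thesis
        using z[OF box_bump_test[OF ab, of n]] by (simp only: integral_restrict_space[OF U'])
    qed
    ultimately have "(LINT x|lebesgue. ?f x) = 0" using LIMSEQ_unique[of "\<lambda>n. 0::'b"] by simp
    moreover have "?f x = indicat_real (box a b) x *\<^sub>R D x" for x
      using box_subset_cbox[of a b] by (auto simp: indicator_def)
    ultimately show ?thesis by (simp only:)
  qed
  have AEb: "AE x in lebesgue. x \<in> box a b \<longrightarrow> D x = 0" if ab: "cbox a b \<subseteq> U" for a b
  proof -
    let ?f = "\<lambda>x. indicat_real (box a b) x *\<^sub>R D x"
    have fi: "integrable lebesgue ?f"
    proof -
      have "box a b \<in> sets lebesgue" by simp
      moreover have "indicat_real (box a b) x *\<^sub>R (indicat_real (cbox a b) x *\<^sub>R D x) = ?f x" for x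
        using box_subset_cbox[of a b] by (auto simp: indicator_def)
      ultimately show ?thesis using integrable_mult_indicator[OF _ D[OF ab], of "box a b"] by (simp only:)
    qed
    have "AE x in lebesgue. ?f x = 0"
    proof (rule zero_on_boxes_imp_zero[OF fi bx[OF ab]])
      fix c d
      obtain p q where pq: "box c d \<inter> box a b = box p q" using box_Int_box by blast
      have e: "indicat_real (box c d) x *\<^sub>R ?f x = indicat_real (box p q) x *\<^sub>R D x" for x
        using pq by (auto simp: indicator_def)
      show "(LINT x:box c d|lebesgue. ?f x) = 0"
      \<comment> \<open>When the open box is empty, \<open>cbox p q\<close> may still be nonempty
        and leave U, so this case cannot go through the closure.\<close>
      proof (cases "box p q = {}")
        case True
        then show ?thesis unfolding set_lebesgue_integral_def e by simp
      next
        case False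
        have "cbox p q = closure (box p q)" using False by simp
        also have "\<dots> \<subseteq> cbox a b" using pq box_subset_cbox[of a b] by (intro closure_minimal) auto
        finally have "cbox p q \<subseteq> U" using ab by simp
        then show ?thesis unfolding set_lebesgue_integral_def e by (rule bx)
      qed
    qed
    then show ?thesis by (rule AE_mp) (auto simp: indicator_def)
  qed
  \<comment> \<open>Countably many closed boxes make up U and their boundaries are null, so the
    statements on open boxes combine into one on U.\<close>
  obtain \<D> where \<D>: "countable \<D>" "\<D> \<subseteq> Pow U" "\<And>X. X \<in> \<D> \<Longrightarrow> \<exists>a b. X = cbox a b" "\<Union>\<D> = U"
    by (rule open_countable_Union_open_cbox[OF U]) blast
  have "AE x in lebesgue. \<forall>X\<in>\<D>. x \<in> X \<longrightarrow> D x = 0"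
  proof (subst AE_ball_countable[OF \<D>(1)], intro ballI)
    fix X assume X: "X \<in> \<D>"
    then obtain a b where ab: "X = cbox a b" using \<D>(3) by blast
    have "AE x in lebesgue. x \<notin> cbox a b - box a b"
    proof -
      have "cbox a b - box a b \<in> null_sets lebesgue"
        using negligible_frontier_interval[of a b] by (simp add: negligible_iff_null_sets)
      then show ?thesis by (rule AE_not_in)
    qed
    moreover have "AE x in lebesgue. x \<in> box a b \<longrightarrow> D x = 0"
      by (rule AEb) (use \<D>(2) X ab in blast)
    ultimately show "AE x in lebesgue. x \<in> X \<longrightarrow> D x = 0"
      unfolding ab by eventually_elim blast
  qed
  then have "AE x in lebesgue. x \<in> U \<longrightarrow> D x = 0"
    by eventually_elim (use \<D>(4) in blast)
  then show ?thesis
    by (subst AE_restrict_space_iff[OF U']) simp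
qed

subsection \<open>Weak gradients\<close>

text \<open>Young's inequality with a free weight: the main term a keeps a factor arbitrarily close
  to 1, while the small term b pays for it with 1 / t. It serves the density argument and the
  separation of the Taylor remainder alike.\<close>

lemma norm_sq_add_le:
  fixes a b :: "'a::real_normed_vector"
  assumes "t > 0"
  shows "(norm (a + b))\<^sup>2 \<le> (1 + t) * (norm a)\<^sup>2 + (1 + 1 / t) * (norm b)\<^sup>2"
proof -
  have "(norm (a + b))\<^sup>2 \<le> (norm a + norm b)\<^sup>2"
    by (intro power_mono norm_triangle_ineq) simp
  also have "\<dots> = (norm a)\<^sup>2 + 2 * norm a * norm b + (norm b)\<^sup>2" by (simp add: power2_sum)
  also have "2 * norm a * norm b \<le> t * (norm a)\<^sup>2 + (1 / t) * (norm b)\<^sup>2"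
  proof -
    have "0 \<le> (t * norm a - norm b)\<^sup>2 / t" using assms by simp
    also have "\<dots> = t * (norm a)\<^sup>2 + (1 / t) * (norm b)\<^sup>2 - 2 * norm a * norm b"
      using assms by (simp add: power2_diff field_simps power2_eq_square)
    finally show ?thesis by simp
  qed
  finally show ?thesis by (simp add: algebra_simps)
qed

section \<open>Square-integrable functions on a set\<close>

lemma L2_on_measurable: "L2_on U f \<Longrightarrow> f \<in> borel_measurable (lebesgue_on U)"
  by (simp add: L2_on_def)

lemma L2_on_integrable: "L2_on U f \<Longrightarrow> integrable (lebesgue_on U) (\<lambda>x. (norm (f x))\<^sup>2)"
  by (simp add: L2_on_def)

lemma L2_on_bound:
  fixes f :: "'a::euclidean_space \<Rightarrow> 'b::euclidean_space"
  assumes "f \<in> borel_measurable (lebesgue_on U)" "integrable (lebesgue_on U) w"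
    "AE x in lebesgue_on U. (norm (f x))\<^sup>2 \<le> w x"
  shows "L2_on U f"
  unfolding L2_on_def
proof (rule conjI[OF assms(1)])
  have m: "(\<lambda>x. (norm (f x))\<^sup>2) \<in> borel_measurable (lebesgue_on U)"
    using assms(1) by measurable
  have "AE x in lebesgue_on U. norm ((norm (f x))\<^sup>2) \<le> norm (w x)"
    using assms(3) by eventually_elim simp
  then show "integrable (lebesgue_on U) (\<lambda>x. (norm (f x))\<^sup>2)"
    by (rule Bochner_Integration.integrable_bound[OF assms(2) m])
qed

lemma L2_on_cong_AE:
  fixes f g :: "'a::euclidean_space \<Rightarrow> 'b::euclidean_space"
  assumes "L2_on U f" "g \<in> borel_measurable (lebesgue_on U)" "AE x in lebesgue_on U. f x = g x"
  shows "L2_on U g"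
  by (rule L2_on_bound[OF assms(2) L2_on_integrable[OF assms(1)]]) (use assms(3) in \<open>eventually_elim, simp\<close>)

lemma L2_on_add:
  fixes f g :: "'a::euclidean_space \<Rightarrow> 'b::euclidean_space"
  assumes "L2_on U f" "L2_on U g"
  shows "L2_on U (\<lambda>x. f x + g x)"
proof (rule L2_on_bound)
  show "(\<lambda>x. f x + g x) \<in> borel_measurable (lebesgue_on U)"
    by (intro borel_measurable_add L2_on_measurable assms)
  show "integrable (lebesgue_on U) (\<lambda>x. (1 + 1) * (norm (f x))\<^sup>2 + (1 + 1 / 1) * (norm (g x))\<^sup>2)"
    by (intro Bochner_Integration.integrable_add integrable_mult_right L2_on_integrable assms)
  show "AE x in lebesgue_on U. (norm (f x + g x))\<^sup>2 \<le> (1 + 1) * (norm (f x))\<^sup>2 + (1 + 1 / 1) * (norm (g x))\<^sup>2"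
    by (intro AE_I2 norm_sq_add_le) simp
qed

lemma L2_on_scaleR_bounded:
  fixes f :: "'a::euclidean_space \<Rightarrow> 'b::euclidean_space"
  assumes "L2_on U f" "h \<in> borel_measurable (lebesgue_on U)" "\<And>x. x \<in> U \<Longrightarrow> \<bar>h x\<bar> \<le> B" "U \<in> sets lebesgue"
  shows "L2_on U (\<lambda>x. h x *\<^sub>R f x)"
proof (rule L2_on_bound)
  show "(\<lambda>x. h x *\<^sub>R f x) \<in> borel_measurable (lebesgue_on U)"
    by (rule borel_measurable_scaleR[OF assms(2) L2_on_measurable[OF assms(1)]])
  show "integrable (lebesgue_on U) (\<lambda>x. B\<^sup>2 * (norm (f x))\<^sup>2)"
    by (intro integrable_mult_right L2_on_integrable assms)
  show "AE x in lebesgue_on U. (norm (h x *\<^sub>R f x))\<^sup>2 \<le> B\<^sup>2 * (norm (f x))\<^sup>2"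
  proof (rule AE_I2)
    fix x assume "x \<in> space (lebesgue_on U)"
    then have "\<bar>h x\<bar>\<^sup>2 \<le> B\<^sup>2" using assms(3)[of x] by (intro power_mono) auto
    then have "\<bar>h x\<bar>\<^sup>2 * (norm (f x))\<^sup>2 \<le> B\<^sup>2 * (norm (f x))\<^sup>2" by (rule mult_right_mono) simp
    then show "(norm (h x *\<^sub>R f x))\<^sup>2 \<le> B\<^sup>2 * (norm (f x))\<^sup>2" by (simp add: power_mult_distrib)
  qed
qed

lemma L2_on_diff:
  fixes f g :: "'a::euclidean_space \<Rightarrow> 'b::euclidean_space"
  assumes "L2_on U f" "L2_on U g"
  shows "L2_on U (\<lambda>x. f x - g x)"
proof -
  have "L2_on U (\<lambda>x. - g x)"
    by (rule L2_on_bound[OF _ L2_on_integrable[OF assms(2)]]) (simp_all add: L2_on_measurable[OF assms(2)])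
  from L2_on_add[OF assms(1) this] show ?thesis by simp
qed

lemma L2_on_subset:
  fixes f :: "'a::euclidean_space \<Rightarrow> 'b::euclidean_space"
  assumes "L2_on U f" "V \<subseteq> U" "V \<in> sets lebesgue" "U \<in> sets lebesgue"
  shows "L2_on V f"
proof -
  have U': "U \<inter> space lebesgue \<in> sets lebesgue" and V': "V \<inter> space lebesgue \<in> sets lebesgue"
    using assms(3,4) by simp_all
  have r: "restrict_space (lebesgue_on U) V = lebesgue_on V"
    using assms(2) by (simp add: restrict_restrict_space assms Int_absorb1)
  have "f \<in> borel_measurable (lebesgue_on V)"
    using measurable_restrict_space1[OF L2_on_measurable[OF assms(1)], of V] r by simp
  moreover have "integrable (lebesgue_on V) (\<lambda>x. (norm (f x))\<^sup>2)"
  proof -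
    have "integrable lebesgue (\<lambda>x. indicat_real V x *\<^sub>R (indicat_real U x *\<^sub>R (norm (f x))\<^sup>2))"
      using L2_on_integrable[OF assms(1)] unfolding integrable_restrict_space[OF U'] by (rule integrable_mult_indicator[OF assms(3)])
    moreover have "indicat_real V x *\<^sub>R (indicat_real U x *\<^sub>R (norm (f x))\<^sup>2) = indicat_real V x *\<^sub>R (norm (f x))\<^sup>2" for x
      using assms(2) by (auto simp: indicator_def)
    ultimately show ?thesis unfolding integrable_restrict_space[OF V'] by (simp only:)
  qed
  ultimately show ?thesis by (simp add: L2_on_def)
qed

lemma L2_on_test:
  assumes "open U" "\<phi> \<in> test_functions U"
  shows "L2_on U \<phi>" "L2_on U (grad \<phi>)"
proof -
  obtain K where K: "compact K" "K \<subseteq> U" "\<And>x. x \<notin> K \<Longrightarrow> \<phi> x = 0" "\<And>x. x \<notin> K \<Longrightarrow> grad \<phi> x = 0"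
    by (rule test_functionsE[OF assms(2)]) blast
  have c: "continuous_on U \<phi>" "continuous_on U (grad \<phi>)"
    by (rule continuous_on_subset[OF smooth_on_imp_continuous[OF test_functions_smooth[OF assms(2)]] subset_UNIV])
       (rule continuous_on_subset[OF continuous_on_grad[OF test_functions_smooth[OF assms(2)]] subset_UNIV])
  have U: "U \<in> sets lebesgue" using assms(1) by simp
  have "integrable (lebesgue_on U) (\<lambda>x. (norm (\<phi> x))\<^sup>2)" "integrable (lebesgue_on U) (\<lambda>x. (norm (grad \<phi> x))\<^sup>2)"
    by (rule compact_support_integrable_on[OF assms(1) _ K(1,2)]; (intro continuous_intros c)?; simp add: K)+
  then show "L2_on U \<phi>" "L2_on U (grad \<phi>)"
    using continuous_imp_measurable_on_sets_lebesgue[OF c(1) U] continuous_imp_measurable_on_sets_lebesgue[OF c(2) U]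
    by (simp_all add: L2_on_def)
qed

lemma integrable_scaleR_L2:
  fixes g :: "'a::euclidean_space \<Rightarrow> 'b::euclidean_space"
  assumes "L2_on U f" "L2_on U g"
  shows "integrable (lebesgue_on U) (\<lambda>x. f x *\<^sub>R g x)"
proof (rule Bochner_Integration.integrable_bound)
  show "integrable (lebesgue_on U) (\<lambda>x. (norm (f x))\<^sup>2 + (norm (g x))\<^sup>2)"
    by (intro Bochner_Integration.integrable_add L2_on_integrable assms)
  show "(\<lambda>x. f x *\<^sub>R g x) \<in> borel_measurable (lebesgue_on U)"
    by (intro borel_measurable_scaleR L2_on_measurable assms)
  show "AE x in lebesgue_on U. norm (f x *\<^sub>R g x) \<le> norm ((norm (f x))\<^sup>2 + (norm (g x))\<^sup>2)"
  proof (rule AE_I2)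
    fix x
    have "2 * (norm (f x) * norm (g x)) \<le> (norm (f x))\<^sup>2 + (norm (g x))\<^sup>2"
      using sum_squares_bound[of "norm (f x)" "norm (g x)"] by (simp add: mult.assoc)
    moreover have "0 \<le> norm (f x) * norm (g x)" by simp
    ultimately show "norm (f x *\<^sub>R g x) \<le> norm ((norm (f x))\<^sup>2 + (norm (g x))\<^sup>2)"
      unfolding norm_scaleR real_norm_def by linarith
  qed
qed

text \<open>The constant 1 is square integrable on a bounded box, so f = 1 * f is a product of two
  square-integrable functions there.\<close>

lemma L2_on_integrable_cbox:
  fixes f :: "'a::euclidean_space \<Rightarrow> 'b::euclidean_space"
  assumes "open U" "L2_on U f" "cbox a b \<subseteq> U"
  shows "integrable lebesgue (\<lambda>x. indicat_real (cbox a b) x *\<^sub>R f x)"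
proof -
  have ab: "cbox a b \<inter> space lebesgue \<in> sets lebesgue" by simp
  have l: "L2_on (cbox a b) f" by (rule L2_on_subset[OF assms(2,3)]) (use assms(1) in simp_all)
  have "L2_on (cbox a b) (\<lambda>x. 1::real)"
  proof -
    have "integrable lebesgue (indicat_real (cbox a b))"
      using lmeasurable_cbox[of a b] by (intro integrable_real_indicator) (auto simp: fmeasurable_def)
    then show ?thesis
      unfolding L2_on_def using integrable_restrict_space[OF ab, of "\<lambda>x. 1::real"] by simp
  qed
  then have "integrable (lebesgue_on (cbox a b)) (\<lambda>x. (1::real) *\<^sub>R f x)"
    using l by (rule integrable_scaleR_L2)
  then show ?thesis using integrable_restrict_space[OF ab, of f] by simp
qed

lemma continuous_integrable_cbox:
  fixes f :: "'a::euclidean_space \<Rightarrow> 'b::euclidean_space"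
  assumes "continuous_on U f" "cbox a b \<subseteq> U"
  shows "integrable lebesgue (\<lambda>x. indicat_real (cbox a b) x *\<^sub>R f x)"
proof -
  have "integrable lborel (\<lambda>x. indicat_real (cbox a b) x *\<^sub>R f x)"
    by (rule borel_integrable_compact[OF compact_cbox continuous_on_subset[OF assms]])
  then show ?thesis by (subst integrable_completion) auto
qed

lemma test_scaleR_integrable:
  fixes f :: "'a::euclidean_space \<Rightarrow> 'b::euclidean_space"
  assumes "open U" "continuous_on U f" "\<phi> \<in> test_functions U"
  shows "integrable (lebesgue_on U) (\<lambda>x. \<phi> x *\<^sub>R f x)"
proof -
  obtain K where K: "compact K" "K \<subseteq> U" "\<And>x. x \<notin> K \<Longrightarrow> \<phi> x = 0"
    by (rule test_functionsE[OF assms(3)]) blast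
  have "continuous_on U \<phi>"
    by (rule continuous_on_subset[OF smooth_on_imp_continuous[OF test_functions_smooth[OF assms(3)]] subset_UNIV])
  then have c: "continuous_on U (\<lambda>x. \<phi> x *\<^sub>R f x)" using assms(2) by (rule continuous_on_scaleR)
  show ?thesis
    by (rule compact_support_integrable_on[OF assms(1) c K(1,2)]) (simp add: K(3))
qed

section \<open>Uniqueness of weak gradients and agreement with the classical ones\<close>

lemma weak_eq:
  fixes G1 G2 :: "'a::euclidean_space \<Rightarrow> 'b::euclidean_space"
  assumes U: "open U"
    and 1: "\<And>a b. cbox a b \<subseteq> U \<Longrightarrow> integrable lebesgue (\<lambda>x. indicat_real (cbox a b) x *\<^sub>R G1 x)"
      "\<And>\<phi>. \<phi> \<in> test_functions U \<Longrightarrow> integrable (lebesgue_on U) (\<lambda>x. \<phi> x *\<^sub>R G1 x)"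
    and 2: "\<And>a b. cbox a b \<subseteq> U \<Longrightarrow> integrable lebesgue (\<lambda>x. indicat_real (cbox a b) x *\<^sub>R G2 x)"
      "\<And>\<phi>. \<phi> \<in> test_functions U \<Longrightarrow> integrable (lebesgue_on U) (\<lambda>x. \<phi> x *\<^sub>R G2 x)"
    and e: "\<And>\<phi>. \<phi> \<in> test_functions U \<Longrightarrow> (LINT x|lebesgue_on U. \<phi> x *\<^sub>R G1 x) = (LINT x|lebesgue_on U. \<phi> x *\<^sub>R G2 x)"
  shows "AE x in lebesgue_on U. G1 x = G2 x"
proof -
  have "AE x in lebesgue_on U. G1 x - G2 x = 0"
  proof (rule weak_zero[OF U])
    show "integrable lebesgue (\<lambda>x. indicat_real (cbox a b) x *\<^sub>R (G1 x - G2 x))" if "cbox a b \<subseteq> U" for a b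
      using Bochner_Integration.integrable_diff[OF 1(1)[OF that] 2(1)[OF that]] by (simp only: scaleR_diff_right)
    show "(LINT x|lebesgue_on U. \<phi> x *\<^sub>R (G1 x - G2 x)) = 0" if "\<phi> \<in> test_functions U" for \<phi>
      using Bochner_Integration.integral_diff[OF 1(2)[OF that] 2(2)[OF that]] e[OF that] by (simp only: scaleR_diff_right) simp
  qed
  then show ?thesis by simp
qed

lemma weak_grad_unique:
  assumes U: "open U" and "weak_grad_on U f G1" "weak_grad_on U f G2"
  shows "AE x in lebesgue_on U. G1 x = G2 x"
proof (rule weak_eq[OF U])
  have L: "L2_on U G1" "L2_on U G2" using assms by (simp_all add: weak_grad_on_def)
  show "integrable lebesgue (\<lambda>x. indicat_real (cbox a b) x *\<^sub>R G1 x)" "integrable lebesgue (\<lambda>x. indicat_real (cbox a b) x *\<^sub>R G2 x)"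
    if "cbox a b \<subseteq> U" for a b using L2_on_integrable_cbox[OF U _ that] L by blast+
  show "integrable (lebesgue_on U) (\<lambda>x. \<phi> x *\<^sub>R G1 x)" "integrable (lebesgue_on U) (\<lambda>x. \<phi> x *\<^sub>R G2 x)"
    if "\<phi> \<in> test_functions U" for \<phi> using integrable_scaleR_L2[OF L2_on_test(1)[OF U that]] L by blast+
  show "(LINT x|lebesgue_on U. \<phi> x *\<^sub>R G1 x) = (LINT x|lebesgue_on U. \<phi> x *\<^sub>R G2 x)" if "\<phi> \<in> test_functions U" for \<phi>
  proof -
    have "- (LINT x|lebesgue_on U. \<phi> x *\<^sub>R G1 x) = - (LINT x|lebesgue_on U. \<phi> x *\<^sub>R G2 x)"
      using assms(2,3) that unfolding weak_grad_on_def by (metis (no_types))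
    then show ?thesis by simp
  qed
qed

text \<open>The classical gradient satisfies the same integration by parts, and being continuous it
  is integrable on closed boxes in U. This removes the choice hidden in \<open>wgrad\<close> for
  smooth functions, and square integrability of \<open>grad u\<close> becomes a consequence.\<close>

lemma weak_grad_smooth:
  assumes U: "open U" and u: "smooth_on U u" and G: "weak_grad_on U u G"
  shows "AE x in lebesgue_on U. G x = grad u x"
proof (rule weak_eq[OF U])
  have L: "L2_on U G" using G by (simp add: weak_grad_on_def)
  note c = continuous_on_grad[OF u]
  show "integrable lebesgue (\<lambda>x. indicat_real (cbox a b) x *\<^sub>R G x)" "integrable lebesgue (\<lambda>x. indicat_real (cbox a b) x *\<^sub>R grad u x)"
    if "cbox a b \<subseteq> U" for a b by (rule L2_on_integrable_cbox[OF U L that], rule continuous_integrable_cbox[OF c that])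
  show "integrable (lebesgue_on U) (\<lambda>x. \<phi> x *\<^sub>R G x)" "integrable (lebesgue_on U) (\<lambda>x. \<phi> x *\<^sub>R grad u x)"
    if "\<phi> \<in> test_functions U" for \<phi>
    by (rule integrable_scaleR_L2[OF L2_on_test(1)[OF U that] L], rule test_scaleR_integrable[OF U c that])
  show "(LINT x|lebesgue_on U. \<phi> x *\<^sub>R G x) = (LINT x|lebesgue_on U. \<phi> x *\<^sub>R grad u x)" if "\<phi> \<in> test_functions U" for \<phi>
  proof -
    have "- (LINT x|lebesgue_on U. \<phi> x *\<^sub>R G x) = - (LINT x|lebesgue_on U. \<phi> x *\<^sub>R grad u x)"
      using integral_by_parts_test[OF U u that] G that unfolding weak_grad_on_def by (metis (no_types))
    then show ?thesis by simp
  qed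
qed

lemma weak_grad_smoothI:
  assumes "open U" "smooth_on U u" "L2_on U (grad u)"
  shows "weak_grad_on U u (grad u)"
  unfolding weak_grad_on_def by (intro conjI ballI assms(3) integral_by_parts_test[OF assms(1,2)])

lemma wgrad_weak: "f \<in> H1 U \<Longrightarrow> weak_grad_on U f (wgrad U f)"
  using someI_ex[of "weak_grad_on U f"] by (simp add: H1_def wgrad_def)

lemma smooth_H1:
  assumes U: "open U" and u: "smooth_on U u" and H: "u \<in> H1 U"
  shows "AE x in lebesgue_on U. wgrad U u x = grad u x" "L2_on U (grad u)" "L2_on U u"
proof -
  show 1: "AE x in lebesgue_on U. wgrad U u x = grad u x"
    by (rule weak_grad_smooth[OF U u wgrad_weak[OF H]])
  have "U \<in> sets lebesgue" using U by simp
  then have m: "grad u \<in> borel_measurable (lebesgue_on U)"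
    by (rule continuous_imp_measurable_on_sets_lebesgue[OF continuous_on_grad[OF u]])
  have "L2_on U (wgrad U u)" using wgrad_weak[OF H] by (simp add: weak_grad_on_def)
  then show "L2_on U (grad u)" by (rule L2_on_cong_AE[OF _ m 1])
  show "L2_on U u" using H by (simp add: H1_def)
qed

lemma smooth_H1I:
  assumes "open U" "smooth_on U u" "L2_on U u" "L2_on U (grad u)"
  shows "u \<in> H1 U"
  using weak_grad_smoothI[OF assms(1,2,4)] assms(3) unfolding H1_def by blast

text \<open>The squared \<open>H^1\<close> norm, written with the classical gradient; for smooth
  functions it takes the place of the expression with \<open>wgrad\<close>.\<close>

definition sobolev :: "'a::euclidean_space set \<Rightarrow> ('a \<Rightarrow> real) \<Rightarrow> real" where
  "sobolev U f = (LINT x|lebesgue_on U. (f x)\<^sup>2 + (norm (grad f x))\<^sup>2)"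

lemma H10_smooth:
  assumes U: "open U" and u: "smooth_on U u" and H: "u \<in> H1 U"
  shows "u \<in> H10 U \<longleftrightarrow> (\<exists>\<phi>. (\<forall>n. \<phi> n \<in> test_functions U) \<and> (\<lambda>n::nat. sobolev U (\<lambda>x. u x - \<phi> n x)) \<longlonglongrightarrow> 0)"
proof -
  have "(LINT x|lebesgue_on U. (u x - \<phi> x)\<^sup>2 + (norm (wgrad U u x - grad \<phi> x))\<^sup>2) = sobolev U (\<lambda>x. u x - \<phi> x)"
    if \<phi>: "\<phi> \<in> test_functions U" for \<phi>
    unfolding sobolev_def
  proof (rule integral_cong_AE)
    have g: "grad (\<lambda>x. u x - \<phi> x) x = grad u x - grad \<phi> x" if "x \<in> U" for x
      by (rule grad_diff[OF smooth_on_imp_differentiable[OF u that] test_functions_differentiable[OF \<phi>]])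
    have "AE x in lebesgue_on U. x \<in> U" by (rule AE_I2) simp
    with smooth_H1(1)[OF U u H] show "AE x in lebesgue_on U. (u x - \<phi> x)\<^sup>2 + (norm (wgrad U u x - grad \<phi> x))\<^sup>2
        = (u x - \<phi> x)\<^sup>2 + (norm (grad (\<lambda>x. u x - \<phi> x) x))\<^sup>2"
      by eventually_elim (simp add: g)
    have L: "L2_on U (wgrad U u)" using wgrad_weak[OF H] by (simp add: weak_grad_on_def)
    have m: "u \<in> borel_measurable (lebesgue_on U)" "\<phi> \<in> borel_measurable (lebesgue_on U)"
       "wgrad U u \<in> borel_measurable (lebesgue_on U)" "grad \<phi> \<in> borel_measurable (lebesgue_on U)"
       "grad u \<in> borel_measurable (lebesgue_on U)"
      using smooth_H1[OF U u H] L2_on_test[OF U \<phi>] L by (simp_all add: L2_on_measurable)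
    then show "(\<lambda>x. (u x - \<phi> x)\<^sup>2 + (norm (wgrad U u x - grad \<phi> x))\<^sup>2) \<in> borel_measurable (lebesgue_on U)" by measurable
    have "(\<lambda>x. (u x - \<phi> x)\<^sup>2 + (norm (grad u x - grad \<phi> x))\<^sup>2) \<in> borel_measurable (lebesgue_on U)" using m by measurable
    then show "(\<lambda>x. (u x - \<phi> x)\<^sup>2 + (norm (grad (\<lambda>x. u x - \<phi> x) x))\<^sup>2) \<in> borel_measurable (lebesgue_on U)"
      by (subst measurable_cong[where g = "\<lambda>x. (u x - \<phi> x)\<^sup>2 + (norm (grad u x - grad \<phi> x))\<^sup>2"]) (simp_all add: g)
  qed
  then have "(\<lambda>n. LINT x|lebesgue_on U. (u x - \<phi> n x)\<^sup>2 + (norm (wgrad U u x - grad (\<phi> n) x))\<^sup>2)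
       = (\<lambda>n. sobolev U (\<lambda>x. u x - \<phi> n x))" if "\<forall>n::nat. \<phi> n \<in> test_functions U" for \<phi>
    using that by blast
  then show ?thesis unfolding H10_def using H by (simp cong: conj_cong)
qed

lemma test_H10:
  assumes U: "open U" and \<phi>: "\<phi> \<in> test_functions U"
  shows "\<phi> \<in> H10 U"
proof -
  have s: "smooth_on U \<phi>" by (rule smooth_on_subset[OF test_functions_smooth[OF \<phi>] subset_UNIV])
  have H: "\<phi> \<in> H1 U" by (rule smooth_H1I[OF U s L2_on_test[OF U \<phi>]])
  show ?thesis
    unfolding H10_smooth[OF U s H] by (intro exI[of _ "\<lambda>n. \<phi>"]) (simp add: \<phi> sobolev_def)
qed

subsection \<open>Reduction to smooth competitors\<close>

lemma grad_test_bounded: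
  assumes "f \<in> test_functions U"
  obtains B where "B \<ge> 0" "\<And>x. norm (grad f x) \<le> B"
proof -
  obtain K where K: "compact K" "\<And>x. x \<notin> K \<Longrightarrow> grad f x = 0"
    by (rule test_functionsE[OF assms]) blast
  have "compact (grad f ` K)"
    by (rule compact_continuous_image[OF continuous_on_subset[OF continuous_on_grad[OF test_functions_smooth[OF assms]] subset_UNIV] K(1)])
  then have "bounded (grad f ` K)" by (rule compact_imp_bounded)
  then obtain B where B: "B > 0" "\<And>x. x \<in> K \<Longrightarrow> norm (grad f x) \<le> B" by (auto simp: bounded_pos)
  have "norm (grad f x) \<le> B" for x using B K(2)[of x] by (cases "x \<in> K") auto
  with B(1) show ?thesis by (intro that[of B]) auto
qed

lemma sobolev_integrable:
  assumes "L2_on U f" "L2_on U (grad f)"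
  shows "integrable (lebesgue_on U) (\<lambda>x. (f x)\<^sup>2 + (norm (grad f x))\<^sup>2)"
  using L2_on_integrable[OF assms(1)] L2_on_integrable[OF assms(2)] by simp

text \<open>By the product rule the gradient of z * v costs twice the energy of v plus
  \<open>2 * B\<^sup>2\<close> times its squared \<open>L^2\<close> norm, and z * v itself at most
  one more such norm; the constant dominates both coefficients.\<close>

lemma sobolev_cutoff:
  fixes v z :: "'a::euclidean_space \<Rightarrow> real"
  assumes U: "open U" and v: "smooth_on U v" "L2_on U v" "L2_on U (grad v)"
    and z: "smooth_on UNIV z" "\<And>x. \<bar>z x\<bar> \<le> 1" "\<And>x. norm (grad z x) \<le> B"
  shows "L2_on U (\<lambda>x. z x * v x)" "L2_on U (grad (\<lambda>x. z x * v x))"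
    "sobolev U (\<lambda>x. z x * v x) \<le> (3 + 2 * B\<^sup>2) * sobolev U v"
proof -
  have Us: "U \<in> sets lebesgue" using U by simp
  have sm: "smooth_on U (\<lambda>x. z x * v x)"
    by (rule smooth_on_mult[OF U smooth_on_subset[OF z(1) subset_UNIV] v(1)])
  have zm: "z \<in> borel_measurable (lebesgue_on U)"
    by (rule continuous_imp_measurable_on_sets_lebesgue[OF continuous_on_subset[OF smooth_on_imp_continuous[OF z(1)] subset_UNIV] Us])
  show L1: "L2_on U (\<lambda>x. z x * v x)"
    using L2_on_scaleR_bounded[OF v(2) zm z(2) Us] by simp
  have b1: "(norm (z x * v x))\<^sup>2 \<le> (norm (v x))\<^sup>2" for x
  proof (rule power_mono)
    show "norm (z x * v x) \<le> norm (v x)"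
      using mult_right_mono[OF z(2)[of x], of "\<bar>v x\<bar>"] by (simp add: abs_mult)
  qed simp
  have b2: "(norm (grad (\<lambda>x. z x * v x) x))\<^sup>2 \<le> 2 * (norm (grad v x))\<^sup>2 + 2 * B\<^sup>2 * (norm (v x))\<^sup>2" if x: "x \<in> U" for x
  proof -
    have "grad (\<lambda>x. z x * v x) x = z x *\<^sub>R grad v x + v x *\<^sub>R grad z x"
      by (rule grad_mult[OF smooth_on_imp_differentiable[OF z(1)] smooth_on_imp_differentiable[OF v(1) x]]) simp
    then have "(norm (grad (\<lambda>x. z x * v x) x))\<^sup>2 \<le> 2 * (norm (z x *\<^sub>R grad v x))\<^sup>2 + 2 * (norm (v x *\<^sub>R grad z x))\<^sup>2"
      using norm_sq_add_le[of 1 "z x *\<^sub>R grad v x" "v x *\<^sub>R grad z x"] by simp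
    moreover have "(norm (z x *\<^sub>R grad v x))\<^sup>2 \<le> (norm (grad v x))\<^sup>2"
      using z(2)[of x] by (intro power_mono) (simp_all add: mult_left_le_one_le)
    moreover have "(norm (v x *\<^sub>R grad z x))\<^sup>2 \<le> B\<^sup>2 * (norm (v x))\<^sup>2"
    proof -
      have "norm (v x *\<^sub>R grad z x) \<le> B * norm (v x)"
        using z(3)[of x] by (simp add: mult.commute[of B] mult_left_mono)
      then have "(norm (v x *\<^sub>R grad z x))\<^sup>2 \<le> (B * norm (v x))\<^sup>2" by (intro power_mono) simp_all
      then show ?thesis by (simp only: power_mult_distrib)
    qed
    ultimately show ?thesis by linarith
  qed
  show L2: "L2_on U (grad (\<lambda>x. z x * v x))"
  proof (rule L2_on_bound)
    show "grad (\<lambda>x. z x * v x) \<in> borel_measurable (lebesgue_on U)"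
      by (rule continuous_imp_measurable_on_sets_lebesgue[OF continuous_on_grad[OF sm] Us])
    show "integrable (lebesgue_on U) (\<lambda>x. 2 * (norm (grad v x))\<^sup>2 + 2 * B\<^sup>2 * (norm (v x))\<^sup>2)"
      by (intro Bochner_Integration.integrable_add integrable_mult_right L2_on_integrable v)
    show "AE x in lebesgue_on U. (norm (grad (\<lambda>x. z x * v x) x))\<^sup>2 \<le> 2 * (norm (grad v x))\<^sup>2 + 2 * B\<^sup>2 * (norm (v x))\<^sup>2"
      by (rule AE_I2) (rule b2, simp)
  qed
  have "sobolev U (\<lambda>x. z x * v x) \<le> (LINT x|lebesgue_on U. (3 + 2 * B\<^sup>2) * ((v x)\<^sup>2 + (norm (grad v x))\<^sup>2))"
    unfolding sobolev_def
  proof (rule integral_mono[OF sobolev_integrable[OF L1 L2]])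
    show "integrable (lebesgue_on U) (\<lambda>x. (3 + 2 * B\<^sup>2) * ((v x)\<^sup>2 + (norm (grad v x))\<^sup>2))"
      by (intro integrable_mult_right sobolev_integrable v)
    fix x assume "x \<in> space (lebesgue_on U)"
    then have "(z x * v x)\<^sup>2 + (norm (grad (\<lambda>x. z x * v x) x))\<^sup>2 \<le> (v x)\<^sup>2 + (2 * (norm (grad v x))\<^sup>2 + 2 * B\<^sup>2 * (v x)\<^sup>2)"
      using b1[of x] b2[of x] by simp
    also have "\<dots> \<le> (3 + 2 * B\<^sup>2) * ((v x)\<^sup>2 + (norm (grad v x))\<^sup>2)"
    proof -
      have "0 \<le> 2 * (v x)\<^sup>2 + (norm (grad v x))\<^sup>2 + 2 * B\<^sup>2 * (norm (grad v x))\<^sup>2" by (intro add_nonneg_nonneg mult_nonneg_nonneg) auto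
      then show ?thesis by (simp add: algebra_simps)
    qed
    finally show "(z x * v x)\<^sup>2 + (norm (grad (\<lambda>x. z x * v x) x))\<^sup>2 \<le> (3 + 2 * B\<^sup>2) * ((v x)\<^sup>2 + (norm (grad v x))\<^sup>2)" .
  qed
  then show "sobolev U (\<lambda>x. z x * v x) \<le> (3 + 2 * B\<^sup>2) * sobolev U v"
    unfolding sobolev_def by simp
qed

lemma sobolev_nonneg: "0 \<le> sobolev U f"
  unfolding sobolev_def by (rule integral_nonneg_AE) simp

lemma smooth_diff_test:
  assumes "open U" "smooth_on U u" "L2_on U u" "L2_on U (grad u)" "p \<in> test_functions U"
  shows "smooth_on U (\<lambda>x. u x - p x)" "L2_on U (\<lambda>x. u x - p x)" "L2_on U (grad (\<lambda>x. u x - p x))"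
    "\<And>x. x \<in> U \<Longrightarrow> grad (\<lambda>x. u x - p x) x = grad u x - grad p x"
proof -
  show g: "grad (\<lambda>x. u x - p x) x = grad u x - grad p x" if "x \<in> U" for x
    by (rule grad_diff[OF smooth_on_imp_differentiable[OF assms(2) that] test_functions_differentiable[OF assms(5)]])
  show s: "smooth_on U (\<lambda>x. u x - p x)"
    by (rule smooth_on_diff[OF assms(1,2) smooth_on_subset[OF test_functions_smooth[OF assms(5)] subset_UNIV]])
  show "L2_on U (\<lambda>x. u x - p x)" by (rule L2_on_diff[OF assms(3) L2_on_test(1)[OF assms(1,5)]])
  have Us: "U \<in> sets lebesgue" using assms(1) by simp
  show "L2_on U (grad (\<lambda>x. u x - p x))"
  proof (rule L2_on_cong_AE[OF L2_on_diff[OF assms(4) L2_on_test(2)[OF assms(1,5)]]])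
    show "grad (\<lambda>x. u x - p x) \<in> borel_measurable (lebesgue_on U)"
      by (rule continuous_imp_measurable_on_sets_lebesgue[OF continuous_on_grad[OF s] Us])
    show "AE x in lebesgue_on U. grad u x - grad p x = grad (\<lambda>x. u x - p x) x"
      by (rule AE_I2) (simp add: g)
  qed
qed

text \<open>The functions \<open>u * \<eta> + (1 - \<eta>) * \<psi> n\<close> approximate u in the
  Sobolev norm and equal u exactly wherever \<eta> = 1. The quantities in the conclusion are their
  differences from u; multiplication by the fixed factor 1 - \<eta> keeps these small.\<close>

lemma H10_cutoff_approx:
  assumes U: "open U" and u: "smooth_on U u" "u \<in> H10 U" and \<eta>: "\<eta> \<in> test_functions U" "\<And>x. 0 \<le> \<eta> x" "\<And>x. \<eta> x \<le> 1"
  obtains \<psi> where "\<And>n::nat. \<psi> n \<in> test_functions U" "(\<lambda>n. sobolev U (\<lambda>x. (1 - \<eta> x) * (u x - \<psi> n x))) \<longlonglongrightarrow> 0"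
    "\<And>n. L2_on U (\<lambda>x. (1 - \<eta> x) * (u x - \<psi> n x))" "\<And>n. L2_on U (grad (\<lambda>x. (1 - \<eta> x) * (u x - \<psi> n x)))"
    "\<And>n. smooth_on U (\<lambda>x. (1 - \<eta> x) * (u x - \<psi> n x))"
proof -
  have H: "u \<in> H1 U" using u(2) by (simp add: H10_def)
  obtain \<psi> where \<psi>: "\<forall>n. \<psi> n \<in> test_functions U" "(\<lambda>n::nat. sobolev U (\<lambda>x. u x - \<psi> n x)) \<longlonglongrightarrow> 0"
    using u(2) unfolding H10_smooth[OF U u(1) H] by blast
  note L = smooth_H1(3,2)[OF U u(1) H]
  have z: "smooth_on UNIV (\<lambda>x. 1 - \<eta> x)"
    by (rule smooth_on_diff[OF open_UNIV smooth_on_const test_functions_smooth[OF \<eta>(1)]])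
  have z1: "\<bar>1 - \<eta> x\<bar> \<le> 1" for x using \<eta>(2)[of x] \<eta>(3)[of x] by simp
  obtain B where B: "\<And>x. norm (grad \<eta> x) \<le> B" by (rule grad_test_bounded[OF \<eta>(1)]) blast
  have zB: "norm (grad (\<lambda>x. 1 - \<eta> x) x) \<le> B" for x
  proof -
    have "grad (\<lambda>x. 1 - \<eta> x) x = grad (\<lambda>x. 1) x - grad \<eta> x"
      by (rule grad_diff[OF _ test_functions_differentiable[OF \<eta>(1)]]) simp
    then show ?thesis using B[of x] by simp
  qed
  note s = smooth_diff_test[OF U u(1) L \<psi>(1)[rule_format]]
  note c = sobolev_cutoff[OF U s(1) s(2) s(3) z z1 zB]
  have "(\<lambda>n. sobolev U (\<lambda>x. (1 - \<eta> x) * (u x - \<psi> n x))) \<longlonglongrightarrow> 0"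
  proof (rule tendsto_sandwich[OF always_eventually always_eventually tendsto_const])
    show "\<forall>n. 0 \<le> sobolev U (\<lambda>x. (1 - \<eta> x) * (u x - \<psi> n x))" using sobolev_nonneg by blast
    show "\<forall>n. sobolev U (\<lambda>x. (1 - \<eta> x) * (u x - \<psi> n x)) \<le> (3 + 2 * B\<^sup>2) * sobolev U (\<lambda>x. u x - \<psi> n x)"
      by (rule allI, rule c(3))
    show "(\<lambda>n. (3 + 2 * B\<^sup>2) * sobolev U (\<lambda>x. u x - \<psi> n x)) \<longlonglongrightarrow> 0"
      using tendsto_mult_right[OF \<psi>(2), of "3 + 2 * B\<^sup>2"] by (simp add: mult.commute)
  qed
  then show ?thesis
    by (rule that[OF \<psi>(1)[rule_format] _ c(1) c(2) smooth_on_mult[OF U smooth_on_subset[OF z subset_UNIV] s(1)]])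
qed

section \<open>The capacity in terms of smooth competitors\<close>

lemma integral_minus_null:
  fixes f :: "'a::euclidean_space \<Rightarrow> real"
  assumes "open U" "closed K" "negligible K" "f \<in> borel_measurable (lebesgue_on U)"
  shows "(LINT x|lebesgue_on (U - K). f x) = (LINT x|lebesgue_on U. f x)"
proof -
  have s: "U \<inter> space lebesgue \<in> sets lebesgue" "(U - K) \<inter> space lebesgue \<in> sets lebesgue"
    using assms(1) open_Diff[OF assms(1,2)] by simp_all
  have m: "(\<lambda>x. indicat_real U x *\<^sub>R f x) \<in> borel_measurable lebesgue"
    using assms(4) unfolding borel_measurable_restrict_space_iff[OF s(1)] .
  have "- K \<in> sets lebesgue" using assms(2) by (simp add: open_Compl)
  then have m2: "(\<lambda>x. indicat_real (- K) x *\<^sub>R (indicat_real U x *\<^sub>R f x)) \<in> borel_measurable lebesgue"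
    by (intro borel_measurable_scaleR[OF _ m] borel_measurable_indicator)
  have e: "indicat_real (- K) x *\<^sub>R (indicat_real U x *\<^sub>R f x) = indicat_real (U - K) x *\<^sub>R f x" for x
    by (auto simp: indicator_def)
  have "AE x in lebesgue. x \<notin> K"
    using assms(3) by (intro AE_not_in) (simp add: negligible_iff_null_sets)
  then have "AE x in lebesgue. indicat_real (U - K) x *\<^sub>R f x = indicat_real U x *\<^sub>R f x"
    by eventually_elim (simp add: indicator_def)
  then show ?thesis
    unfolding integral_restrict_space[OF s(1)] integral_restrict_space[OF s(2)]
    by (rule integral_cong_AE[OF m2[unfolded e] m])
qed

lemma capacity_set_bdd: "bdd_below {LINT x|lebesgue_on \<Omega>. (norm (wgrad \<Omega> f x))\<^sup>2 | f. P f}"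
  by (rule bdd_belowI[of _ 0]) (auto intro!: integral_nonneg_AE)

text \<open>The point is that g - u lies in \<open>H10\<close> of the complement of K. It vanishes
  near K, but u need not have compact support in the domain; so u is kept exact where \<eta> = 1 and
  replaced by test functions where \<eta> = 0, with a smooth transition between.\<close>

lemma u_capacity_le:
  fixes u :: "'a::euclidean_space \<Rightarrow> real"
  assumes \<Omega>: "open \<Omega>" and K: "closed K" "negligible K" and u: "smooth_on \<Omega> u" "u \<in> H10 \<Omega>"
    and \<eta>: "\<eta> \<in> test_functions \<Omega>" "\<And>x. 0 \<le> \<eta> x" "\<And>x. \<eta> x \<le> 1" "open V" "K \<subseteq> V" "\<And>x. x \<in> V \<Longrightarrow> \<eta> x = 1"
    and g: "g \<in> test_functions \<Omega>" "open W" "K \<subseteq> W" "\<And>x. x \<in> W \<Longrightarrow> g x = u x"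
  shows "u_capacity \<Omega> K u \<le> (LINT x|lebesgue_on \<Omega>. (norm (grad g x))\<^sup>2)"
proof -
  have H: "u \<in> H1 \<Omega>" using u(2) by (simp add: H10_def)
  note Lu = smooth_H1(3,2)[OF \<Omega> u(1) H]
  have O': "open (\<Omega> - K)" by (rule open_Diff[OF \<Omega> K(1)])
  have Os: "\<Omega> \<in> sets lebesgue" "\<Omega> - K \<in> sets lebesgue" using \<Omega> O' by simp_all
  have sg: "smooth_on \<Omega> g" by (rule smooth_on_subset[OF test_functions_smooth[OF g(1)] subset_UNIV])
  have gH: "g \<in> H10 \<Omega>" by (rule test_H10[OF \<Omega> g(1)])
  have gH1: "g \<in> H1 \<Omega>" using gH by (simp add: H10_def)
  obtain \<psi> where \<psi>: "\<And>n::nat. \<psi> n \<in> test_functions \<Omega>" "(\<lambda>n. sobolev \<Omega> (\<lambda>x. (1 - \<eta> x) * (u x - \<psi> n x))) \<longlonglongrightarrow> 0"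
    "\<And>n. L2_on \<Omega> (\<lambda>x. (1 - \<eta> x) * (u x - \<psi> n x))" "\<And>n. L2_on \<Omega> (grad (\<lambda>x. (1 - \<eta> x) * (u x - \<psi> n x)))"
    "\<And>n. smooth_on \<Omega> (\<lambda>x. (1 - \<eta> x) * (u x - \<psi> n x))"
    by (rule H10_cutoff_approx[OF \<Omega> u \<eta>(1-3)]) blast
  have sgu: "smooth_on \<Omega> (\<lambda>x. g x - u x)" by (rule smooth_on_diff[OF \<Omega> sg u(1)])
  have gu: "grad (\<lambda>x. g x - u x) x = grad g x - grad u x" if "x \<in> \<Omega>" for x
    by (rule grad_diff[OF test_functions_differentiable[OF g(1)] smooth_on_imp_differentiable[OF u(1) that]])
  have Lgu: "L2_on \<Omega> (\<lambda>x. g x - u x)" by (rule L2_on_diff[OF L2_on_test(1)[OF \<Omega> g(1)] Lu(1)])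
  have Lgu': "L2_on \<Omega> (grad (\<lambda>x. g x - u x))"
  proof (rule L2_on_cong_AE[OF L2_on_diff[OF L2_on_test(2)[OF \<Omega> g(1)] Lu(2)]])
    show "grad (\<lambda>x. g x - u x) \<in> borel_measurable (lebesgue_on \<Omega>)"
      by (rule continuous_imp_measurable_on_sets_lebesgue[OF continuous_on_grad[OF sgu] Os(1)])
    show "AE x in lebesgue_on \<Omega>. grad g x - grad u x = grad (\<lambda>x. g x - u x) x"
      by (rule AE_I2) (simp add: gu)
  qed
  have sub: "\<Omega> - K \<subseteq> \<Omega>" by blast
  note sgu' = smooth_on_subset[OF sgu sub]
  have guH1: "(\<lambda>x. g x - u x) \<in> H1 (\<Omega> - K)"
    by (rule smooth_H1I[OF O' sgu' L2_on_subset[OF Lgu sub Os(2,1)] L2_on_subset[OF Lgu' sub Os(2,1)]])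
  \<comment> \<open>This is g minus the approximation
    \<open>u * \<eta> + (1 - \<eta>) * \<psi> n\<close> of u. On \<open>V \<inter> W\<close> both
    are u, so the difference is supported away from K.\<close>
  let ?p = "\<lambda>n x. (g x - u x * \<eta> x) - (1 - \<eta> x) * \<psi> n x"
  have "(\<lambda>x. g x - u x) \<in> H10 (\<Omega> - K)"
    unfolding H10_smooth[OF O' sgu' guH1]
  proof (intro exI conjI allI)
    fix n
    have sz: "smooth_on \<Omega> (\<lambda>x. 1 - \<eta> x)"
      by (rule smooth_on_diff[OF \<Omega> smooth_on_const smooth_on_subset[OF test_functions_smooth[OF \<eta>(1)] subset_UNIV]])
    have p: "?p n \<in> test_functions \<Omega>"
      by (intro test_functions_diff g(1) test_functions_mult[OF \<Omega> u(1) \<eta>(1)] test_functions_mult[OF \<Omega> sz \<psi>(1)])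
    obtain L where L: "compact L" "L \<subseteq> \<Omega>" "\<And>x. x \<notin> L \<Longrightarrow> ?p n x = 0"
      by (rule test_functionsE[OF p]) blast
    show "?p n \<in> test_functions (\<Omega> - K)"
    proof (rule test_functionsI[OF test_functions_smooth[OF p]])
      show "compact (L - V \<inter> W)" using L(1) \<eta>(4) g(2) by (intro compact_diff) auto
      show "L - V \<inter> W \<subseteq> \<Omega> - K" using L(2) \<eta>(5) g(3) by blast
      show "?p n x = 0" if "x \<notin> L - V \<inter> W" for x
      proof (cases "x \<in> L")
        case True
        then have "\<eta> x = 1" "g x = u x" using that \<eta>(6) g(4) by auto
        then show ?thesis by simp
      qed (rule L(3))
    qed
  next
    have e: "g x - u x - ?p n x = - ((1 - \<eta> x) * (u x - \<psi> n x))" for n x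
      by (simp add: algebra_simps)
    have "sobolev (\<Omega> - K) (\<lambda>x. g x - u x - ?p n x) = sobolev \<Omega> (\<lambda>x. (1 - \<eta> x) * (u x - \<psi> n x))" for n
    proof -
      let ?f = "\<lambda>x. (1 - \<eta> x) * (u x - \<psi> n x)"
      have neg: "grad (\<lambda>x. - ?f x) x = - grad ?f x" if "x \<in> \<Omega>" for x
        by (rule gradI[OF GDERIV_minus[OF GDERIV_grad[OF smooth_on_imp_differentiable[OF \<psi>(5) that]]]])
      have "sobolev (\<Omega> - K) (\<lambda>x. g x - u x - ?p n x) = sobolev (\<Omega> - K) (\<lambda>x. - ?f x)" by (simp only: e)
      also have "\<dots> = sobolev (\<Omega> - K) ?f"
        unfolding sobolev_def by (rule Bochner_Integration.integral_cong[OF refl]) (simp only: space_restrict_space, simp add: neg)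
      also have "\<dots> = sobolev \<Omega> ?f"
        unfolding sobolev_def
        by (rule integral_minus_null[OF \<Omega> K borel_measurable_integrable[OF sobolev_integrable[OF \<psi>(3,4)]]])
      finally show ?thesis .
    qed
    then show "(\<lambda>n. sobolev (\<Omega> - K) (\<lambda>x. g x - u x - ?p n x)) \<longlonglongrightarrow> 0" using \<psi>(2) by (simp only:)
  qed
  moreover have "AE x in lebesgue. x \<in> K \<longrightarrow> g x = u x"
    by (rule AE_I2) (use g(3,4) in blast)
  ultimately have "u_capacity \<Omega> K u \<le> (LINT x|lebesgue_on \<Omega>. (norm (wgrad \<Omega> g x))\<^sup>2)"
    unfolding u_capacity_def using gH by (intro cInf_lower capacity_set_bdd) blast
  also have "\<dots> = (LINT x|lebesgue_on \<Omega>. (norm (grad g x))\<^sup>2)"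
  proof (rule integral_cong_AE)
    show "AE x in lebesgue_on \<Omega>. (norm (wgrad \<Omega> g x))\<^sup>2 = (norm (grad g x))\<^sup>2"
      using smooth_H1(1)[OF \<Omega> sg gH1] by eventually_elim simp
    show "(\<lambda>x. (norm (grad g x))\<^sup>2) \<in> borel_measurable (lebesgue_on \<Omega>)"
      by (rule borel_measurable_integrable[OF L2_on_integrable[OF L2_on_test(2)[OF \<Omega> g(1)]]])
    have "L2_on \<Omega> (wgrad \<Omega> g)" using wgrad_weak[OF gH1] by (simp add: weak_grad_on_def)
    then show "(\<lambda>x. (norm (wgrad \<Omega> g x))\<^sup>2) \<in> borel_measurable (lebesgue_on \<Omega>)"
      by (rule borel_measurable_integrable[OF L2_on_integrable])
  qed
  finally show ?thesis .
qed

lemma energy_triangle: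
  fixes F G :: "'a::euclidean_space \<Rightarrow> 'b::euclidean_space"
  assumes "t > 0" "L2_on U F" "L2_on U G"
  shows "(LINT x|lebesgue_on U. (norm (F x + G x))\<^sup>2)
    \<le> (1 + t) * (LINT x|lebesgue_on U. (norm (F x))\<^sup>2) + (1 + 1 / t) * (LINT x|lebesgue_on U. (norm (G x))\<^sup>2)"
proof -
  have "(LINT x|lebesgue_on U. (norm (F x + G x))\<^sup>2)
     \<le> (LINT x|lebesgue_on U. (1 + t) * (norm (F x))\<^sup>2 + (1 + 1 / t) * (norm (G x))\<^sup>2)"
    by (intro integral_mono L2_on_integrable L2_on_add assms Bochner_Integration.integrable_add integrable_mult_right
        norm_sq_add_le)
  then show ?thesis
    by (simp add: Bochner_Integration.integral_add L2_on_integrable assms(2,3))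
qed

text \<open>An admissible f is the sum of f - u, approximated by test functions supported off K, and
  of u, approximated by functions equal to u near K. The sum of the two approximations is a test
  function to which the hypothesis on g applies, and its gradient tends to that of f.\<close>

lemma u_capacity_ge:
  fixes u :: "'a::euclidean_space \<Rightarrow> real"
  assumes \<Omega>: "open \<Omega>" and K: "closed K" "negligible K" and u: "smooth_on \<Omega> u" "u \<in> H10 \<Omega>"
    and \<eta>: "\<eta> \<in> test_functions \<Omega>" "\<And>x. 0 \<le> \<eta> x" "\<And>x. \<eta> x \<le> 1" "open V" "K \<subseteq> V" "\<And>x. x \<in> V \<Longrightarrow> \<eta> x = 1"
    and g: "\<And>g W. g \<in> test_functions \<Omega> \<Longrightarrow> open W \<Longrightarrow> K \<subseteq> W \<Longrightarrow> (\<And>x. x \<in> W \<Longrightarrow> g x = u x)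
      \<Longrightarrow> B \<le> (LINT x|lebesgue_on \<Omega>. (norm (grad g x))\<^sup>2)"
  shows "B \<le> u_capacity \<Omega> K u"
  unfolding u_capacity_def
proof (rule cInf_greatest)
  have O': "open (\<Omega> - K)" by (rule open_Diff[OF \<Omega> K(1)])
  have Os: "\<Omega> \<in> sets lebesgue" "\<Omega> - K \<in> sets lebesgue" using \<Omega> O' by simp_all
  have sub: "\<Omega> - K \<subseteq> \<Omega>" by blast
  have H: "u \<in> H1 \<Omega>" using u(2) by (simp add: H10_def)
  note Lu = smooth_H1(3,2)[OF \<Omega> u(1) H]
  have "(\<lambda>x. 0) \<in> test_functions (\<Omega> - K)" by (rule test_functionsI[of _ "{}"]) simp_all
  then have "(\<lambda>x. u x - u x) \<in> H10 (\<Omega> - K)" using test_H10[OF O', of "\<lambda>x. 0"] by simp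
  moreover have "AE x in lebesgue. x \<in> K \<longrightarrow> u x = u x" by simp
  ultimately show "{LINT x|lebesgue_on \<Omega>. (norm (wgrad \<Omega> f x))\<^sup>2 | f.
     f \<in> H10 \<Omega> \<and> (\<lambda>x. f x - u x) \<in> H10 (\<Omega> - K) \<and> (AE x in lebesgue. x \<in> K \<longrightarrow> f x = u x)} \<noteq> {}"
    using u(2) by blast
  fix E assume "E \<in> {LINT x|lebesgue_on \<Omega>. (norm (wgrad \<Omega> f x))\<^sup>2 | f.
     f \<in> H10 \<Omega> \<and> (\<lambda>x. f x - u x) \<in> H10 (\<Omega> - K) \<and> (AE x in lebesgue. x \<in> K \<longrightarrow> f x = u x)}"
  then obtain f where f: "f \<in> H10 \<Omega>" "(\<lambda>x. f x - u x) \<in> H10 (\<Omega> - K)"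
    and E: "E = (LINT x|lebesgue_on \<Omega>. (norm (wgrad \<Omega> f x))\<^sup>2)" by blast
  let ?G = "wgrad \<Omega> f"
  have fH: "f \<in> H1 \<Omega>" and fuH: "(\<lambda>x. f x - u x) \<in> H1 (\<Omega> - K)" using f by (simp_all add: H10_def)
  have wG: "weak_grad_on \<Omega> f ?G" by (rule wgrad_weak[OF fH])
  have LG: "L2_on \<Omega> ?G" using wG by (simp add: weak_grad_on_def)
  have Lf: "L2_on \<Omega> f" using fH by (simp add: H1_def)
  let ?w = "wgrad (\<Omega> - K) (\<lambda>x. f x - u x)"
  have ww: "weak_grad_on (\<Omega> - K) (\<lambda>x. f x - u x) ?w" by (rule wgrad_weak[OF fuH])
  have Lw: "L2_on (\<Omega> - K) ?w" using ww by (simp add: weak_grad_on_def)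
  \<comment> \<open>Every test function of \<open>\<Omega> - K\<close> is one of
    \<open>\<Omega>\<close>, so this weak gradient arises by restriction. Uniqueness then identifies
    it with \<open>?w\<close>, which transfers the convergence of \<open>grad (\<phi> n)\<close> to
    \<open>?G - grad u\<close>.\<close>
  have wgu: "weak_grad_on (\<Omega> - K) (\<lambda>x. f x - u x) (\<lambda>x. ?G x - grad u x)"
    unfolding weak_grad_on_def
  proof (intro conjI ballI)
    show L: "L2_on (\<Omega> - K) (\<lambda>x. ?G x - grad u x)" by (rule L2_on_subset[OF L2_on_diff[OF LG Lu(2)] sub Os(2,1)])
    fix p assume p: "p \<in> test_functions (\<Omega> - K)"
    have p': "p \<in> test_functions \<Omega>" by (rule test_functions_mono[OF sub p])
    obtain L where L: "compact L" "L \<subseteq> \<Omega> - K" "\<And>x. x \<notin> L \<Longrightarrow> p x = 0" "\<And>x. x \<notin> L \<Longrightarrow> grad p x = 0"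
      by (rule test_functionsE[OF p]) blast
    have s: "\<Omega> \<inter> space lebesgue \<in> sets lebesgue" "(\<Omega> - K) \<inter> space lebesgue \<in> sets lebesgue" using Os by simp_all
    have r: "(LINT x|lebesgue_on (\<Omega> - K). h x) = (LINT x|lebesgue_on \<Omega>. h x)" if "\<And>x. x \<notin> L \<Longrightarrow> h x = 0" for h :: "'a \<Rightarrow> 'a"
    proof -
      have "indicat_real (\<Omega> - K) x *\<^sub>R h x = indicat_real \<Omega> x *\<^sub>R h x" for x
        using that[of x] L(2) by (auto simp: indicator_def)
      then show ?thesis unfolding integral_restrict_space[OF s(1)] integral_restrict_space[OF s(2)] by (simp only:)
    qed
    have "(LINT x|lebesgue_on (\<Omega> - K). (f x - u x) *\<^sub>R grad p x) = (LINT x|lebesgue_on \<Omega>. f x *\<^sub>R grad p x - u x *\<^sub>R grad p x)"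
      by (subst r) (simp_all add: L scaleR_diff_left)
    also have "\<dots> = (LINT x|lebesgue_on \<Omega>. f x *\<^sub>R grad p x) - (LINT x|lebesgue_on \<Omega>. u x *\<^sub>R grad p x)"
      by (intro Bochner_Integration.integral_diff integrable_scaleR_L2 Lf Lu L2_on_test[OF \<Omega> p'])
    also have "(LINT x|lebesgue_on \<Omega>. f x *\<^sub>R grad p x) = - (LINT x|lebesgue_on \<Omega>. p x *\<^sub>R ?G x)"
      using bspec[OF conjunct2[OF wG[unfolded weak_grad_on_def]] p'] .
    also have "(LINT x|lebesgue_on \<Omega>. u x *\<^sub>R grad p x) = - (LINT x|lebesgue_on \<Omega>. p x *\<^sub>R grad u x)"
      by (rule integral_by_parts_test[OF \<Omega> u(1) p'])
    also have "- (LINT x|lebesgue_on \<Omega>. p x *\<^sub>R ?G x) - - (LINT x|lebesgue_on \<Omega>. p x *\<^sub>R grad u x)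
       = - (LINT x|lebesgue_on \<Omega>. p x *\<^sub>R ?G x - p x *\<^sub>R grad u x)"
      by (subst Bochner_Integration.integral_diff) (simp_all add: integrable_scaleR_L2 LG Lu L2_on_test[OF \<Omega> p'])
    also have "(LINT x|lebesgue_on \<Omega>. p x *\<^sub>R ?G x - p x *\<^sub>R grad u x) = (LINT x|lebesgue_on (\<Omega> - K). p x *\<^sub>R (?G x - grad u x))"
      by (subst r) (simp_all add: L scaleR_diff_right)
    finally show "(LINT x|lebesgue_on (\<Omega> - K). (f x - u x) *\<^sub>R grad p x) = - (LINT x|lebesgue_on (\<Omega> - K). p x *\<^sub>R (?G x - grad u x))" .
  qed
  have AEw: "AE x in lebesgue_on (\<Omega> - K). ?w x = ?G x - grad u x"
    by (rule weak_grad_unique[OF O' ww wgu])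
  obtain \<phi> where \<phi>: "\<And>n::nat. \<phi> n \<in> test_functions (\<Omega> - K)"
    "(\<lambda>n. LINT x|lebesgue_on (\<Omega> - K). (f x - u x - \<phi> n x)\<^sup>2 + (norm (?w x - grad (\<phi> n) x))\<^sup>2) \<longlonglongrightarrow> 0"
    using f(2) unfolding H10_def by blast
  have \<phi>': "\<phi> n \<in> test_functions \<Omega>" for n by (rule test_functions_mono[OF sub \<phi>(1)])
  obtain \<psi> where \<psi>: "\<And>n::nat. \<psi> n \<in> test_functions \<Omega>" "(\<lambda>n. sobolev \<Omega> (\<lambda>x. (1 - \<eta> x) * (u x - \<psi> n x))) \<longlonglongrightarrow> 0"
    "\<And>n. L2_on \<Omega> (\<lambda>x. (1 - \<eta> x) * (u x - \<psi> n x))" "\<And>n. L2_on \<Omega> (grad (\<lambda>x. (1 - \<eta> x) * (u x - \<psi> n x)))"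
    "\<And>n. smooth_on \<Omega> (\<lambda>x. (1 - \<eta> x) * (u x - \<psi> n x))"
    by (rule H10_cutoff_approx[OF \<Omega> u \<eta>(1-3)]) blast
  have sz: "smooth_on \<Omega> (\<lambda>x. 1 - \<eta> x)"
    by (rule smooth_on_diff[OF \<Omega> smooth_on_const smooth_on_subset[OF test_functions_smooth[OF \<eta>(1)] subset_UNIV]])
  define p where "p n x = \<phi> n x + u x * \<eta> x + (1 - \<eta> x) * \<psi> n x" for n x
  have p: "p n \<in> test_functions \<Omega>" for n
    unfolding p_def[abs_def]
    by (intro test_functions_add \<phi>' test_functions_mult[OF \<Omega> u(1) \<eta>(1)] test_functions_mult[OF \<Omega> sz \<psi>(1)])
  have Bp: "B \<le> (LINT x|lebesgue_on \<Omega>. (norm (grad (p n) x))\<^sup>2)" for n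
  proof -
    obtain L where L: "compact L" "L \<subseteq> \<Omega> - K" "\<And>x. x \<notin> L \<Longrightarrow> \<phi> n x = 0"
      by (rule test_functionsE[OF \<phi>(1)]) blast
    show ?thesis
    proof (rule g[OF p])
      show "open (V \<inter> - L)" using \<eta>(4) L(1) by (intro open_Int) (simp_all add: compact_imp_closed open_Compl)
      show "K \<subseteq> V \<inter> - L" using L(2) \<eta>(5) by blast
      show "p n x = u x" if "x \<in> V \<inter> - L" for x using that \<eta>(6)[of x] L(3)[of x] by (simp add: p_def)
    qed
  qed
  let ?d1 = "\<lambda>n x. ?G x - grad u x - grad (\<phi> n) x"
  let ?d2 = "\<lambda>n. grad (\<lambda>x. (1 - \<eta> x) * (u x - \<psi> n x))"
  have gp: "grad (p n) x = (?G x + (- ?d1 n x)) + (- ?d2 n x)" if x: "x \<in> \<Omega>" for n x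
  proof -
    have "p n = (\<lambda>x. (u x + \<phi> n x) - (1 - \<eta> x) * (u x - \<psi> n x))" by (auto simp: p_def fun_eq_iff algebra_simps)
    moreover have "grad (\<lambda>x. (u x + \<phi> n x) - (1 - \<eta> x) * (u x - \<psi> n x)) x = grad (\<lambda>x. u x + \<phi> n x) x - ?d2 n x"
      by (intro grad_diff differentiable_add smooth_on_imp_differentiable[OF u(1) x] test_functions_differentiable[OF \<phi>(1)]
          smooth_on_imp_differentiable[OF \<psi>(5) x])
    moreover have "grad (\<lambda>x. u x + \<phi> n x) x = grad u x + grad (\<phi> n) x"
      by (intro grad_add smooth_on_imp_differentiable[OF u(1) x] test_functions_differentiable[OF \<phi>(1)])
    ultimately show ?thesis by simp
  qed
  have Ld1: "L2_on \<Omega> (?d1 n)" for n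
    by (intro L2_on_diff LG Lu L2_on_test[OF \<Omega> \<phi>'])
  have neg: "L2_on \<Omega> (\<lambda>x. - h x)" if "L2_on \<Omega> h" for h :: "'a \<Rightarrow> 'a"
    using L2_on_scaleR_bounded[OF that, of "\<lambda>x. -1" 1] Os(1) by simp
  have d1: "(\<lambda>n. LINT x|lebesgue_on \<Omega>. (norm (?d1 n x))\<^sup>2) \<longlonglongrightarrow> 0"
  proof (rule tendsto_sandwich[OF always_eventually always_eventually tendsto_const \<phi>(2)]; intro allI)
    show "0 \<le> (LINT x|lebesgue_on \<Omega>. (norm (?d1 n x))\<^sup>2)" for n by (rule integral_nonneg_AE) simp
    fix n
    have L1: "L2_on (\<Omega> - K) (\<lambda>x. f x - u x - \<phi> n x)"
      by (rule L2_on_subset[OF _ sub Os(2,1)]) (intro L2_on_diff Lf Lu L2_on_test[OF \<Omega> \<phi>'])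
    have L2: "L2_on (\<Omega> - K) (\<lambda>x. ?w x - grad (\<phi> n) x)"
      by (intro L2_on_diff Lw L2_on_test[OF O' \<phi>(1)])
    have "(LINT x|lebesgue_on \<Omega>. (norm (?d1 n x))\<^sup>2) = (LINT x|lebesgue_on (\<Omega> - K). (norm (?d1 n x))\<^sup>2)"
      by (rule integral_minus_null[OF \<Omega> K borel_measurable_integrable[OF L2_on_integrable[OF Ld1]], symmetric])
    also have "\<dots> = (LINT x|lebesgue_on (\<Omega> - K). (norm (?w x - grad (\<phi> n) x))\<^sup>2)"
    proof (rule integral_cong_AE)
      show "(\<lambda>x. (norm (?d1 n x))\<^sup>2) \<in> borel_measurable (lebesgue_on (\<Omega> - K))"
        by (rule borel_measurable_integrable[OF L2_on_integrable[OF L2_on_subset[OF Ld1 sub Os(2,1)]]])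
      show "(\<lambda>x. (norm (?w x - grad (\<phi> n) x))\<^sup>2) \<in> borel_measurable (lebesgue_on (\<Omega> - K))"
        by (rule borel_measurable_integrable[OF L2_on_integrable[OF L2]])
      show "AE x in lebesgue_on (\<Omega> - K). (norm (?d1 n x))\<^sup>2 = (norm (?w x - grad (\<phi> n) x))\<^sup>2"
        using AEw by eventually_elim (simp only:)
    qed
    also have "\<dots> \<le> (LINT x|lebesgue_on (\<Omega> - K). (f x - u x - \<phi> n x)\<^sup>2 + (norm (?w x - grad (\<phi> n) x))\<^sup>2)"
    proof (rule integral_mono[OF L2_on_integrable[OF L2]])
      show "integrable (lebesgue_on (\<Omega> - K)) (\<lambda>x. (f x - u x - \<phi> n x)\<^sup>2 + (norm (?w x - grad (\<phi> n) x))\<^sup>2)"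
        using L2_on_integrable[OF L1] L2_on_integrable[OF L2] by simp
    qed simp
    finally show "(LINT x|lebesgue_on \<Omega>. (norm (?d1 n x))\<^sup>2)
      \<le> (LINT x|lebesgue_on (\<Omega> - K). (f x - u x - \<phi> n x)\<^sup>2 + (norm (?w x - grad (\<phi> n) x))\<^sup>2)" .
  qed
  have d2: "(\<lambda>n. LINT x|lebesgue_on \<Omega>. (norm (?d2 n x))\<^sup>2) \<longlonglongrightarrow> 0"
  proof (rule tendsto_sandwich[OF always_eventually always_eventually tendsto_const \<psi>(2)]; intro allI)
    show "0 \<le> (LINT x|lebesgue_on \<Omega>. (norm (?d2 n x))\<^sup>2)" for n by (rule integral_nonneg_AE) simp
    show "(LINT x|lebesgue_on \<Omega>. (norm (?d2 n x))\<^sup>2) \<le> sobolev \<Omega> (\<lambda>x. (1 - \<eta> x) * (u x - \<psi> n x))" for n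
      unfolding sobolev_def
      by (rule integral_mono[OF L2_on_integrable[OF \<psi>(4)] sobolev_integrable[OF \<psi>(3,4)]]) simp
  qed
  \<comment> \<open>Young's inequality is used once for each of the two error terms, whence two
    factors 1 + t. The index n tends to infinity first, then t tends to 0.\<close>
  have "B \<le> (1 + t) * ((1 + t) * E)" if t: "t > 0" for t
  proof (rule LIMSEQ_le_const)
    let ?e = "\<lambda>n. (1 + t) * ((1 + t) * E + (1 + 1 / t) * (LINT x|lebesgue_on \<Omega>. (norm (?d1 n x))\<^sup>2))
        + (1 + 1 / t) * (LINT x|lebesgue_on \<Omega>. (norm (?d2 n x))\<^sup>2)"
    have "?e \<longlonglongrightarrow> (1 + t) * ((1 + t) * E + (1 + 1 / t) * 0) + (1 + 1 / t) * 0"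
      by (intro tendsto_intros d1 d2)
    then show "?e \<longlonglongrightarrow> (1 + t) * ((1 + t) * E)" by simp
    have "B \<le> ?e n" for n
    proof -
      have "B \<le> (LINT x|lebesgue_on \<Omega>. (norm (grad (p n) x))\<^sup>2)" by (rule Bp)
      also have "\<dots> = (LINT x|lebesgue_on \<Omega>. (norm ((?G x + (- ?d1 n x)) + (- ?d2 n x)))\<^sup>2)"
        by (rule Bochner_Integration.integral_cong[OF refl]) (subst gp, simp_all)
      also have "\<dots> \<le> (1 + t) * (LINT x|lebesgue_on \<Omega>. (norm (?G x + (- ?d1 n x)))\<^sup>2)
          + (1 + 1 / t) * (LINT x|lebesgue_on \<Omega>. (norm (- ?d2 n x))\<^sup>2)"
        by (rule energy_triangle[OF t L2_on_add[OF LG neg[OF Ld1]] neg[OF \<psi>(4)]])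
      also have "(LINT x|lebesgue_on \<Omega>. (norm (?G x + (- ?d1 n x)))\<^sup>2)
          \<le> (1 + t) * (LINT x|lebesgue_on \<Omega>. (norm (?G x))\<^sup>2) + (1 + 1 / t) * (LINT x|lebesgue_on \<Omega>. (norm (- ?d1 n x))\<^sup>2)"
        by (rule energy_triangle[OF t LG neg[OF Ld1]])
      finally show ?thesis using t by (simp only: norm_minus_cancel E) simp
    qed
    then show "\<exists>N. \<forall>n\<ge>N. B \<le> ?e n" by blast
  qed
  then have *: "\<forall>\<^sub>F t in at_right 0. B \<le> (1 + t) * ((1 + t) * E)"
    by (simp add: eventually_at_right_less eventually_at_filter)
  have "((\<lambda>t. (1 + t) * ((1 + t) * E)) \<longlongrightarrow> (1 + 0) * ((1 + 0) * E)) (at_right 0)"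
    by (intro tendsto_intros)
  then have "B \<le> (1 + 0) * ((1 + 0) * E)"
    by (rule tendsto_lowerbound[OF _ *]) simp
  then show "B \<le> E" by simp
qed

subsection \<open>Elliptic coordinates\<close>

definition ell :: "real \<Rightarrow> real \<times> real \<Rightarrow> real \<times> real" where
  "ell e z = (e * cosh (fst z) * cos (snd z), e * sinh (fst z) * sin (snd z))"

text \<open>Open at \<xi> = 0 and at the ends of the \<eta>-interval, so that the parametrization is
  injective; the points it misses lie on the horizontal axis, a null set.\<close>

definition ell_strip :: "(real \<times> real) set" where
  "ell_strip = {0<..} \<times> {0<..<2 * pi}"

text \<open>The squared modulus of \<open>e * sinh (\<xi> + i \<eta>)\<close>, the complex
  derivative of the coordinate map; it is at once the Jacobian determinant and the squared conformal
  factor.\<close>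

definition ell_jac :: "real \<Rightarrow> real \<times> real \<Rightarrow> real" where
  "ell_jac e z = (e * sinh (fst z) * cos (snd z))\<^sup>2 + (e * cosh (fst z) * sin (snd z))\<^sup>2"

text \<open>The sum of the distances to the two foci of the segment, divided by \<open>2 * e\<close>; this is \<open>cosh \<xi>\<close>
  in elliptic coordinates.\<close>

definition foci_sum :: "real \<Rightarrow> real \<times> real \<Rightarrow> real" where
  "foci_sum e z = (sqrt ((fst z - e)\<^sup>2 + (snd z)\<^sup>2) + sqrt ((fst z + e)\<^sup>2 + (snd z)\<^sup>2)) / (2 * e)"

text \<open>The distances to the foci (e, 0) and (- e, 0) are e * (cosh \<xi> - cos \<eta>) and e *
  (cosh \<xi> + cos \<eta>), so \<eta> cancels in their sum.\<close>

lemma foci_sum_ell: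
  assumes "e > 0" shows "foci_sum e (ell e z) = cosh (fst z)"
proof -
  obtain x y where z: "z = (x, y)" by (cases z)
  have sq: "(sinh x)\<^sup>2 = (cosh x)\<^sup>2 - 1" "(sin y)\<^sup>2 = 1 - (cos y)\<^sup>2"
    using hyperbolic_pythagoras[of x] sin_squared_eq[of y] by simp_all
  have "(e * cosh x * cos y - e)\<^sup>2 + (e * sinh x * sin y)\<^sup>2
      = e\<^sup>2 * (((cosh x) * cos y - 1)\<^sup>2 + (sinh x)\<^sup>2 * (sin y)\<^sup>2)"
    by (simp add: power2_eq_square algebra_simps)
  also have "\<dots> = (e * (cosh x - cos y))\<^sup>2" unfolding sq by (simp add: power2_eq_square algebra_simps)
  finally have 1: "(e * cosh x * cos y - e)\<^sup>2 + (e * sinh x * sin y)\<^sup>2 = (e * (cosh x - cos y))\<^sup>2" .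
  have "(e * cosh x * cos y + e)\<^sup>2 + (e * sinh x * sin y)\<^sup>2
      = e\<^sup>2 * (((cosh x) * cos y + 1)\<^sup>2 + (sinh x)\<^sup>2 * (sin y)\<^sup>2)"
    by (simp add: power2_eq_square algebra_simps)
  also have "\<dots> = (e * (cosh x + cos y))\<^sup>2" unfolding sq by (simp add: power2_eq_square algebra_simps)
  finally have 2: "(e * cosh x * cos y + e)\<^sup>2 + (e * sinh x * sin y)\<^sup>2 = (e * (cosh x + cos y))\<^sup>2" .
  have "cosh x - cos y \<ge> 0" "cosh x + cos y \<ge> 0"
    using cosh_real_ge_1[of x] cos_le_one[of y] cos_ge_minus_one[of y] by linarith+
  then have 3: "sqrt ((e * (cosh x - cos y))\<^sup>2) = e * (cosh x - cos y)" "sqrt ((e * (cosh x + cos y))\<^sup>2) = e * (cosh x + cos y)"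
    using assms by (simp_all add: abs_mult)
  show ?thesis
    unfolding foci_sum_def ell_def z fst_conv snd_conv 1 2 3 using assms by (simp add: field_simps)
qed

text \<open>The complex cosine is onto, and with w = a + i b it has real part cos a cosh b and
  imaginary part - sin a sinh b: up to signs, these are elliptic coordinates.\<close>

lemma ell_surj:
  assumes "e > 0"
  obtains x y where "x \<ge> 0" "0 \<le> y" "y < 2 * pi" "z = ell e (x, y)"
proof -
  define w where "w = Arccos (Complex (fst z / e) (snd z / e))"
  have w: "cos w = Complex (fst z / e) (snd z / e)" unfolding w_def by simp
  let ?a = "Re w" and ?b = "Im w"
  have re: "fst z = e * cosh ?b * cos ?a"
    using arg_cong[OF w, of Re] assms by (simp add: Re_cos cosh_def field_simps)
  have im: "snd z = - (e * sinh ?b * sin ?a)"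
    using arg_cong[OF w, of Im] assms by (simp add: Im_cos sinh_def field_simps)
  define x where "x = \<bar>?b\<bar>"
  \<comment> \<open>Passing from b to its absolute value changes the sign of sinh b for b < 0; for b
    > 0 the minus sign of the imaginary part is absorbed by reflecting the angle.\<close>
  define a where "a = (if ?b > 0 then - ?a else ?a)"
  have z1: "z = ell e (x, a)"
    using re im by (simp add: prod_eq_iff ell_def x_def a_def abs_if)
  have 1: "(cos a)\<^sup>2 + (sin a)\<^sup>2 = 1" by simp
  obtain y where y: "0 \<le> y" "y < 2 * pi" "cos a = cos y" "sin a = sin y"
    by (rule sincos_total_2pi[OF 1])
  have "z = ell e (x, y)" unfolding z1 ell_def snd_conv fst_conv y ..
  then show ?thesis by (intro that[of x y] y) (simp_all add: x_def)
qed

text \<open>The sum of the distances to the foci determines \<xi>; as sinh \<xi> and cosh \<xi> are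
  then nonzero, the point determines cos \<eta> and sin \<eta>, hence \<eta> within one open
  period.\<close>

lemma ell_inj: 
  assumes "e > 0" shows "inj_on (ell e) ell_strip"
proof (rule inj_onI)
  fix z w assume z: "z \<in> ell_strip" and w: "w \<in> ell_strip" and eq: "ell e z = ell e w"
  have "cosh (fst z) = cosh (fst w)" using foci_sum_ell[OF assms] eq by metis
  moreover have pos: "fst z > 0" "fst w > 0" using z w by (auto simp: ell_strip_def)
  ultimately have "\<not> fst z < fst w" "\<not> fst w < fst z"
    using cosh_real_nonneg_less_iff[of "fst z" "fst w"] cosh_real_nonneg_less_iff[of "fst w" "fst z"] by linarith+
  then have f: "fst z = fst w" by simp
  have "sinh (fst z) \<noteq> 0" "cosh (fst z) \<noteq> 0" using pos(1) cosh_real_pos[of "fst z"] by simp_all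
  then have "cos (snd z) = cos (snd w)" "sin (snd z) = sin (snd w)"
    using eq f assms by (simp_all add: ell_def)
  then obtain n :: int where n: "snd z = snd w + 2 * pi * real_of_int n"
    using sin_cos_eq_iff[of "snd z" "snd w"] by (auto simp: mult.commute)
  have "0 < snd z" "snd z < 2 * pi" "0 < snd w" "snd w < 2 * pi" using z w by (auto simp: ell_strip_def)
  then have "2 * pi * real_of_int n < 2 * pi * 1" "2 * pi * (- 1) < 2 * pi * real_of_int n" using n by linarith+
  then have "real_of_int n < 1" "- 1 < real_of_int n" by (simp_all only: mult_less_cancel_left_pos pi_gt_zero zero_less_mult_iff zero_less_numeral simp_thms)
  then have "n = 0" by linarith
  then show "z = w" using n f by (simp add: prod_eq_iff)
qed

lemma ell_image:
  assumes "e > 0" "snd z \<noteq> 0" shows "z \<in> ell e ` ell_strip"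
proof -
  obtain x y where xy: "x \<ge> 0" "0 \<le> y" "y < 2 * pi" "z = ell e (x, y)" by (rule ell_surj[OF assms(1)])
  then have "x \<noteq> 0" "y \<noteq> 0" using assms(2) by (auto simp: ell_def)
  with xy show ?thesis by (intro image_eqI[of _ _ "(x, y)"]) (auto simp: ell_strip_def)
qed

section \<open>Change of variables from the plane to the strip\<close>

definition vec_to_pair :: "real ^ 2 \<Rightarrow> real \<times> real" where "vec_to_pair v = (v $ 1, v $ 2)"
definition pair_to_vec :: "real \<times> real \<Rightarrow> real ^ 2" where "pair_to_vec z = vector [fst z, snd z]"

lemma vec_pair_inverse [simp]: "vec_to_pair (pair_to_vec z) = z" "pair_to_vec (vec_to_pair v) = v"
  by (simp_all add: vec_to_pair_def pair_to_vec_def vec_eq_iff forall_2)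

lemma continuous_vec_to_pair: "continuous_on S vec_to_pair"
  unfolding vec_to_pair_def[abs_def] by (intro continuous_intros)

text \<open>The change-of-variables theorem is phrased with determinants of matrices, hence on
  \<open>real ^ 2\<close>. Comparing measures of boxes shows that passing between the two models of
  the plane preserves Lebesgue measure.\<close>

lemma lborel_vec_pair: "distr lborel borel vec_to_pair = lborel"
proof (rule lborel_eqI[symmetric])
  have m: "vec_to_pair \<in> borel_measurable borel"
    by (rule borel_measurable_continuous_onI[OF continuous_vec_to_pair])
  fix l u :: "real \<times> real" assume lu: "\<And>b. b \<in> Basis \<Longrightarrow> l \<bullet> b \<le> u \<bullet> b"
  obtain l1 l2 u1 u2 where lu_eq: "l = (l1, l2)" "u = (u1, u2)" by (cases l, cases u)
  have B: "Basis = {axis 1 1, axis 2 (1::real)} \<union> ({}::(real^2) set)"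
    by (auto simp: Basis_vec_def UNIV_2)
  have n: "axis 1 1 \<noteq> (axis 2 1 :: real ^ 2)" by (simp add: axis_eq_axis)
  have "emeasure (distr lborel borel vec_to_pair) (box l u) = emeasure lborel (vec_to_pair -` box l u)"
    using m by (subst emeasure_distr) auto
  also have "vec_to_pair -` box l u = box (pair_to_vec l) (pair_to_vec u)"
    by (auto simp: mem_box vec_to_pair_def pair_to_vec_def Basis_prod_def B inner_axis lu_eq)
  also have "emeasure lborel \<dots> = (\<Prod>b\<in>Basis. (pair_to_vec u - pair_to_vec l) \<bullet> b)"
    using lu[of "(1, 0)"] lu[of "(0, 1)"]
    by (intro emeasure_lborel_box) (auto simp: B pair_to_vec_def inner_axis Basis_prod_def lu_eq)
  also have "(\<Prod>b\<in>Basis. (pair_to_vec u - pair_to_vec l) \<bullet> b) = (\<Prod>b\<in>Basis. (u - l) \<bullet> b)"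
    using n by (simp add: B pair_to_vec_def inner_axis Basis_prod_def lu_eq)
  finally show "emeasure (distr lborel borel vec_to_pair) (box l u) = (\<Prod>b\<in>Basis. (u - l) \<bullet> b)" .
qed simp

lemma integrable_vec_pair:
  fixes h :: "real \<times> real \<Rightarrow> real"
  assumes "h \<in> borel_measurable borel"
  shows "integrable lborel (\<lambda>v. h (vec_to_pair v)) \<longleftrightarrow> integrable lborel h"
    "(LINT v|lborel. h (vec_to_pair v)) = (LINT z|lborel. h z)"
proof -
  have m: "vec_to_pair \<in> lborel \<rightarrow>\<^sub>M borel"
    using borel_measurable_continuous_onI[OF continuous_vec_to_pair] by simp
  show "integrable lborel (\<lambda>v. h (vec_to_pair v)) \<longleftrightarrow> integrable lborel h"
    using integrable_distr_eq[OF m assms] lborel_vec_pair by simp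
  show "(LINT v|lborel. h (vec_to_pair v)) = (LINT z|lborel. h z)"
    using integral_distr[OF m assms] lborel_vec_pair by simp
qed

lemma continuous_ell: "continuous_on S (ell e)"
  unfolding ell_def[abs_def] by (intro continuous_intros)

lemma continuous_ell_jac: "continuous_on S (ell_jac e)"
  unfolding ell_jac_def[abs_def] by (intro continuous_intros)

lemma open_ell_strip: "open ell_strip"
  unfolding ell_strip_def by (intro open_Times) auto

lemma has_derivative_ell:
  "(ell e has_derivative (\<lambda>h. (e * sinh (fst z) * cos (snd z) * fst h - e * cosh (fst z) * sin (snd z) * snd h,
      e * cosh (fst z) * sin (snd z) * fst h + e * sinh (fst z) * cos (snd z) * snd h))) (at z within S)"
proof -
  have c: "((\<lambda>z. cosh (fst z)) has_derivative (\<lambda>h. fst h * sinh (fst z))) (at z within S)"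
    and s: "((\<lambda>z. sinh (fst z)) has_derivative (\<lambda>h. fst h * cosh (fst z))) (at z within S)"
    by (rule DERIV_compose_FDERIV, auto intro!: derivative_eq_intros)+
  show ?thesis
    unfolding ell_def[abs_def]
    by (auto intro!: derivative_eq_intros has_derivative_Pair c s simp: algebra_simps fun_eq_iff)
qed

lemma linear_vec_to_pair: "bounded_linear vec_to_pair"
  unfolding vec_to_pair_def[abs_def] by (intro bounded_linear_Pair bounded_linear_vec_nth)

lemma linear_pair_to_vec: "bounded_linear pair_to_vec"
  by (intro linear_conv_bounded_linear[THEN iffD1] linearI) (simp_all add: pair_to_vec_def vec_eq_iff forall_2)


lemma elliptic_change_of_variables:
  fixes h :: "real \<times> real \<Rightarrow> real"
  assumes e: "e > 0" and hc: "continuous_on UNIV h" and hi: "integrable lborel h"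
  shows "integrable lborel (\<lambda>z. indicator ell_strip z * (ell_jac e z * h (ell e z)))"
    "(LINT z|lborel. indicator ell_strip z * (ell_jac e z * h (ell e z))) = (LINT z|lborel. h z)"
proof -
  \<comment> \<open>The function is given values in \<open>real ^ 1\<close> to fit the vector-valued
    change-of-variables theorem; the inner product with \<open>?u\<close> recovers the
    scalar.\<close>
  let ?u = "axis 1 1 :: real ^ 1"
  have uu: "?u \<bullet> ?u = 1" by (simp add: inner_axis_axis)
  define S where "S = vec_to_pair -` ell_strip"
  define g where "g v = pair_to_vec (ell e (vec_to_pair v))" for v
  define D where "D z h = (e * sinh (fst z) * cos (snd z) * fst h - e * cosh (fst z) * sin (snd z) * snd h,
      e * cosh (fst z) * sin (snd z) * fst h + e * sinh (fst z) * cos (snd z) * snd h)" for z h :: "real \<times> real"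
  define g' where "g' v h = pair_to_vec (D (vec_to_pair v) (vec_to_pair h))" for v h
  define f where "f v = h (vec_to_pair v) *\<^sub>R ?u" for v
  have "open S"
    unfolding S_def using open_ell_strip continuous_vec_to_pair[of UNIV] by (rule open_vimage)
  then have S: "S \<in> sets lebesgue" by simp
  have der: "(g has_derivative g' v) (at v within S)" for v
  proof -
    have "((\<lambda>v. ell e (vec_to_pair v)) has_derivative (\<lambda>h. D (vec_to_pair v) (vec_to_pair h))) (at v within S)"
      unfolding D_def
      by (rule has_derivative_compose[OF bounded_linear_imp_has_derivative[OF linear_vec_to_pair] has_derivative_ell])
    then show ?thesis
      unfolding g_def[abs_def] g'_def[abs_def]
      by (rule has_derivative_compose[OF _ bounded_linear_imp_has_derivative[OF linear_pair_to_vec]])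
  qed
  have inj: "inj_on g S"
  proof (rule inj_onI)
    fix v w assume vw: "v \<in> S" "w \<in> S" "g v = g w"
    have "ell e (vec_to_pair v) = ell e (vec_to_pair w)"
      using arg_cong[OF vw(3), of vec_to_pair] by (simp add: g_def)
    then have "vec_to_pair v = vec_to_pair w"
      using ell_inj[OF e] vw(1,2) by (auto simp: S_def dest: inj_onD)
    then have "pair_to_vec (vec_to_pair v) = pair_to_vec (vec_to_pair w)" by (rule arg_cong)
    then show "v = w" by simp
  qed
  have det: "\<bar>det (matrix (g' v))\<bar> = ell_jac e (vec_to_pair v)" for v
  proof -
    have "det (matrix (g' v)) = ell_jac e (vec_to_pair v)"
      by (simp add: det_2 matrix_def g'_def D_def pair_to_vec_def vec_to_pair_def axis_def ell_jac_def power2_eq_square)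
    moreover have "ell_jac e (vec_to_pair v) \<ge> 0" by (simp add: ell_jac_def)
    ultimately show ?thesis by simp
  qed
  have hb: "h \<in> borel_measurable borel" using hc by (rule borel_measurable_continuous_onI)
  have hv: "integrable lborel (\<lambda>v. h (vec_to_pair v))" "(LINT v|lborel. h (vec_to_pair v)) = (LINT z|lborel. h z)"
    using hi by (simp_all add: integrable_vec_pair[OF hb])
  have fl: "integrable lborel f" unfolding f_def[abs_def] using hv(1) by (rule integrable_scaleR_left)
  have fb: "f \<in> borel_measurable lborel" using fl by (rule borel_measurable_integrable)
  have fL: "integrable lebesgue f" using fl by (simp only: integrable_completion[OF fb])
  have neg: "negligible (- (g ` S))"
  proof (rule negligible_subset)
    show "negligible {v :: real ^ 2. v \<bullet> axis 2 1 = 0}"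
      by (rule negligible_standard_hyperplane) (auto simp: Basis_vec_def)
    show "- (g ` S) \<subseteq> {v. v \<bullet> axis 2 1 = 0}"
    proof (rule subsetI, rule ccontr)
      fix v assume v: "v \<in> - (g ` S)" "v \<notin> {v. v \<bullet> axis 2 1 = 0}"
      then have "snd (vec_to_pair v) \<noteq> 0" by (simp add: vec_to_pair_def inner_axis)
      then obtain z where z: "z \<in> ell_strip" "vec_to_pair v = ell e z" using ell_image[OF e] by blast
      have "v = g (pair_to_vec z)" using arg_cong[OF z(2), of pair_to_vec] by (simp add: g_def)
      moreover have "pair_to_vec z \<in> S" using z(1) by (simp add: S_def)
      ultimately show False using v(1) by blast
    qed
  qed
  have gS: "g ` S \<in> sets lebesgue"
    using sets.compl_sets[OF negligible_imp_sets[OF neg]] by (simp add: Compl_eq_Diff_UNIV[symmetric])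
  have fgS: "f absolutely_integrable_on (g ` S)"
    unfolding set_integrable_def by (rule integrable_mult_indicator[OF gS fL])
  have "integral (g ` S) f = integral UNIV f"
    by (rule integral_spike_set; rule negligible_subset[OF neg]) auto
  also have "\<dots> = (LINT v|lebesgue. f v)" by (rule integral_lebesgue[OF fL])
  also have "\<dots> = (LINT v|lborel. f v)" by (rule integral_completion[OF fb])
  also have "\<dots> = (LINT z|lborel. h z) *\<^sub>R ?u" unfolding f_def using hv by simp
  finally have fint: "integral (g ` S) f = (LINT z|lborel. h z) *\<^sub>R ?u" .
  let ?J = "\<lambda>v. \<bar>det (matrix (g' v))\<bar> *\<^sub>R f (g v)"
  have J: "?J absolutely_integrable_on S" "integral S ?J = (LINT z|lborel. h z) *\<^sub>R ?u"
    using has_absolute_integral_change_of_variables[OF S der inj, of f "(LINT z|lborel. h z) *\<^sub>R ?u"] fgS fint by blast+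
  define k where "k z = indicator ell_strip z * (ell_jac e z * h (ell e z))" for z
  have kJ: "(indicat_real S v *\<^sub>R ?J v) \<bullet> ?u = k (vec_to_pair v)" for v
    unfolding det f_def k_def g_def using uu by (simp add: S_def indicator_def)
  have "integrable lebesgue (\<lambda>v. indicat_real S v *\<^sub>R ?J v)" using J(1) unfolding set_integrable_def .
  then have kL: "integrable lebesgue (\<lambda>v. k (vec_to_pair v))"
    unfolding kJ[symmetric] by (rule integrable_inner_left)
  have "continuous_on UNIV (\<lambda>z. ell_jac e z * h (ell e z))"
    by (intro continuous_on_mult continuous_ell_jac continuous_on_compose2[OF hc continuous_ell]) simp
  then have "(\<lambda>z. ell_jac e z * h (ell e z)) \<in> borel_measurable borel" by (rule borel_measurable_continuous_onI)
  moreover have "ell_strip \<in> sets borel" using open_ell_strip by simp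
  ultimately have kb: "k \<in> borel_measurable borel"
    unfolding k_def[abs_def] by measurable
  have kvb: "(\<lambda>v. k (vec_to_pair v)) \<in> borel_measurable lborel"
    using measurable_compose[OF borel_measurable_continuous_onI[OF continuous_vec_to_pair] kb] by simp
  have kl: "integrable lborel (\<lambda>v. k (vec_to_pair v))" using kL by (simp only: integrable_completion[OF kvb])
  then show "integrable lborel (\<lambda>z. indicator ell_strip z * (ell_jac e z * h (ell e z)))"
    using integrable_vec_pair(1)[OF kb] by (simp only: k_def[abs_def])
  have "(LINT z|lborel. k z) = (LINT v|lebesgue. k (vec_to_pair v))"
    unfolding integrable_vec_pair(2)[OF kb, symmetric] by (rule integral_completion[OF kvb, symmetric])
  also have "\<dots> = (LINT v|lebesgue. indicat_real S v *\<^sub>R ?J v) \<bullet> ?u"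
    unfolding kJ[symmetric] by (rule integral_inner_left) (use J(1) in \<open>simp add: set_integrable_def\<close>)
  also have "(LINT v|lebesgue. indicat_real S v *\<^sub>R ?J v) = integral S ?J"
    using set_lebesgue_integral_eq_integral(2)[OF J(1)] by (simp add: set_lebesgue_integral_def)
  finally show "(LINT z|lborel. indicator ell_strip z * (ell_jac e z * h (ell e z))) = (LINT z|lborel. h z)"
    using uu by (simp add: k_def J(2))
qed

lemma AE_lborel_hyperplane: 
  fixes b :: "'a::euclidean_space"
  assumes "b \<in> Basis" shows "AE x in lborel. x \<bullet> b \<noteq> c"
proof -
  have "AE x in lebesgue. x \<notin> {x. x \<bullet> b = c}"
    using negligible_standard_hyperplane[OF assms, of c] by (intro AE_not_in) (simp add: negligible_iff_null_sets)
  then show ?thesis by (simp add: AE_completion_iff)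
qed

text \<open>Since the gradient vanishes for \<xi> > L, the half-infinite strip can be cut at L, and
  closing the rectangle adds only null lines. A compact rectangle is the form that Fubini and the
  divergence formula require.\<close>

lemma energy_elliptic:
  assumes e: "e > 0" and \<Omega>: "open \<Omega>" and g: "g \<in> test_functions \<Omega>" and L: "L \<ge> 0"
    and z: "\<And>x y. x > L \<Longrightarrow> grad g (ell e (x, y)) = 0"
  shows "(LINT x|lebesgue_on \<Omega>. (norm (grad g x))\<^sup>2)
    = integral (cbox (0, 0) (L, 2 * pi)) (\<lambda>z. ell_jac e z * (norm (grad g (ell e z)))\<^sup>2)"
proof -
  obtain K where K: "compact K" "K \<subseteq> \<Omega>" "\<And>x. x \<notin> K \<Longrightarrow> grad g x = 0"
    by (rule test_functionsE[OF g]) blast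
  let ?h = "\<lambda>x. (norm (grad g x))\<^sup>2"
  have cg: "continuous_on UNIV (grad g)" by (rule continuous_on_grad[OF test_functions_smooth[OF g]])
  then have ch: "continuous_on UNIV ?h" by (intro continuous_intros)
  note c\<Omega> = continuous_on_subset[OF ch subset_UNIV, of \<Omega>]
  have hz: "?h x = 0" if "x \<notin> K" for x using K(3)[OF that] by simp
  have hi: "integrable lborel ?h" by (rule compact_support_integrable[OF \<Omega> c\<Omega> K(1,2) hz])
  let ?k = "\<lambda>z. ell_jac e z * ?h (ell e z)"
  let ?B = "cbox (0, 0) (L, 2 * pi) :: (real \<times> real) set"
  have ck: "continuous_on UNIV ?k"
    by (intro continuous_on_mult continuous_ell_jac continuous_on_compose2[OF ch continuous_ell]) simp
  have ki: "set_integrable lborel ?B ?k"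
    unfolding set_integrable_def by (rule borel_integrable_compact[OF compact_cbox continuous_on_subset[OF ck subset_UNIV]])
  have "(LINT x|lebesgue_on \<Omega>. ?h x) = (LINT x|lborel. ?h x)"
    by (rule compact_support_integral_on[OF \<Omega> c\<Omega> K(1,2) hz])
  also have "\<dots> = (LINT z|lborel. indicator ell_strip z * ?k z)"
    by (rule elliptic_change_of_variables(2)[OF e ch hi, symmetric])
  also have "\<dots> = (LINT z:?B|lborel. ?k z)"
    unfolding set_lebesgue_integral_def
  proof (rule integral_cong_AE)
    show "(\<lambda>z. indicator ell_strip z * ?k z) \<in> borel_measurable lborel"
      by (rule borel_measurable_integrable[OF elliptic_change_of_variables(1)[OF e ch hi]])
    show "(\<lambda>z. indicat_real ?B z *\<^sub>R ?k z) \<in> borel_measurable lborel"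
      by (rule borel_measurable_integrable[OF ki[unfolded set_integrable_def]])
    have "AE z in lborel. z \<bullet> (1 :: real, 0 :: real) \<noteq> 0" "AE z in lborel. z \<bullet> (0 :: real, 1 :: real) \<noteq> 0"
      "AE z in lborel. z \<bullet> (0 :: real, 1 :: real) \<noteq> 2 * pi"
      by (rule AE_lborel_hyperplane, simp add: Basis_prod_def)+
    then show "AE z in lborel. indicator ell_strip z * ?k z = indicat_real ?B z *\<^sub>R ?k z"
    proof eventually_elim
      fix z :: "real \<times> real" assume a: "z \<bullet> (1, 0) \<noteq> 0" "z \<bullet> (0, 1) \<noteq> 0" "z \<bullet> (0, 1) \<noteq> 2 * pi"
      obtain x y where xy: "z = (x, y)" by (cases z)
      show "indicator ell_strip z * ?k z = indicat_real ?B z *\<^sub>R ?k z"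
      proof (cases "x > L")
        case True
        then show ?thesis using assms(5) xy by simp
      next
        case False
        then have "z \<in> ell_strip \<longleftrightarrow> z \<in> ?B" using a xy by (auto simp: ell_strip_def)
        then show ?thesis by (simp add: indicator_def)
      qed
    qed
  qed
  also have "\<dots> = integral ?B ?k" by (rule set_borel_integral_eq_integral(2)[OF ki])
  finally show ?thesis .
qed

subsection \<open>The lower bound\<close>

lemma has_integral_cos_int:
  "((\<lambda>t. cos (real_of_int m * t)) has_integral (if m = 0 then 2 * pi else 0)) {0..2 * pi}"
proof (cases "m = 0")
  case True
  then show ?thesis using has_integral_const_real[of "1::real" 0 "2 * pi"] by simp
next
  case False
  have "((\<lambda>t. cos (real_of_int m * t)) has_integral
      (sin (real_of_int m * (2 * pi)) / real_of_int m - sin (real_of_int m * 0) / real_of_int m)) {0..2 * pi}"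
    using False
    by (intro fundamental_theorem_of_calculus)
       (auto intro!: derivative_eq_intros simp: has_real_derivative_iff_has_vector_derivative[symmetric])
  moreover have "sin (real_of_int m * (2 * pi)) = 0"
    using sin_zero_iff_int2[of "real_of_int m * (2 * pi)"] by (auto intro!: exI[of _ "2 * m"])
  ultimately show ?thesis using False by simp
qed

lemma has_integral_cos_cos:
  "((\<lambda>t. cos (real i * t) * cos (real j * t)) has_integral (if i = j then if i = 0 then 2 * pi else pi else 0)) {0..2 * pi}"
proof -
  have "((\<lambda>t. (cos (real_of_int (int i - int j) * t) + cos (real_of_int (int i + int j) * t)) / 2) has_integral
     ((if int i - int j = 0 then 2 * pi else 0) + (if int i + int j = 0 then 2 * pi else 0)) / 2) {0..2 * pi}"
    by (intro has_integral_divide has_integral_add has_integral_cos_int)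
  moreover have "(cos (real_of_int (int i - int j) * t) + cos (real_of_int (int i + int j) * t)) / 2 = cos (real i * t) * cos (real j * t)" for t
    by (simp add: cos_times_cos left_diff_distrib distrib_right)
  moreover have "((if int i - int j = 0 then 2 * pi else 0) + (if int i + int j = 0 then 2 * pi else 0)) / 2
    = (if i = j then if i = 0 then 2 * pi else pi else 0)" by simp
  ultimately show ?thesis by simp
qed

definition cos_sum :: "nat \<Rightarrow> (nat \<Rightarrow> real) \<Rightarrow> real \<Rightarrow> real" where
  "cos_sum k a t = (\<Sum>j\<le>k. a j * cos (real j * t))"

text \<open>Orthogonality of the cosines on a period. The constant mode has squared norm 2 pi and
  the others pi, which is why it is split off.\<close>

lemma has_integral_cos_sum_mult:
  "((\<lambda>t. cos_sum k a t * cos_sum k b t) has_integral (2 * pi * (a 0 * b 0) + pi * (\<Sum>j=1..k. a j * b j))) {0..2 * pi}"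
proof -
  have "((\<lambda>t. \<Sum>i\<le>k. \<Sum>j\<le>k. (a i * b j) * (cos (real i * t) * cos (real j * t))) has_integral
     (\<Sum>i\<le>k. \<Sum>j\<le>k. (a i * b j) * (if i = j then if i = 0 then 2 * pi else pi else 0))) {0..2 * pi}"
    by (intro has_integral_sum has_integral_mult_right has_integral_cos_cos) auto
  moreover have "(\<Sum>i\<le>k. \<Sum>j\<le>k. (a i * b j) * (cos (real i * t) * cos (real j * t))) = cos_sum k a t * cos_sum k b t" for t
    unfolding cos_sum_def sum_product by (intro sum.cong refl) (simp add: mult_ac)
  moreover have "(\<Sum>i\<le>k. \<Sum>j\<le>k. (a i * b j) * (if i = j then if i = 0 then 2 * pi else pi else 0))
      = 2 * pi * (a 0 * b 0) + pi * (\<Sum>j=1..k. a j * b j)"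
  proof -
    have "(\<Sum>i\<le>k. \<Sum>j\<le>k. (a i * b j) * (if i = j then if i = 0 then 2 * pi else pi else 0))
       = (\<Sum>i\<le>k. (a i * b i) * (if i = 0 then 2 * pi else pi))"
      by (intro sum.cong refl) (simp add: if_distrib[of "\<lambda>x. _ * x"] cong: if_cong)
    also have "\<dots> = (\<Sum>i\<in>insert 0 {1..k}. (a i * b i) * (if i = 0 then 2 * pi else pi))"
      by (rule sum.cong) auto
    also have "\<dots> = 2 * pi * (a 0 * b 0) + (\<Sum>i=1..k. pi * (a i * b i))"
      by (subst sum.insert) (auto intro!: sum.cong)
    finally show ?thesis by (simp add: sum_distrib_left)
  qed
  ultimately show ?thesis by simp
qed

lemma cos_sum_deriv:
  "(cos_sum k a has_real_derivative - (\<Sum>j\<le>k. a j * (real j * sin (real j * t)))) (at t within S)"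
  unfolding cos_sum_def[abs_def]
  by (auto intro!: derivative_eq_intros sum.cong simp: sum_negf[symmetric])

section \<open>Green's formula on a rectangle\<close>

lemma integral_divergence_box:
  fixes A Ax B By :: "real \<Rightarrow> real \<Rightarrow> real"
  assumes L: "0 \<le> L" "0 \<le> M"
    and A: "\<And>x y. ((\<lambda>x. A x y) has_real_derivative Ax x y) (at x)" "continuous_on UNIV (\<lambda>(x, y). Ax x y)"
    and B: "\<And>x y. ((\<lambda>y. B x y) has_real_derivative By x y) (at y)" "continuous_on UNIV (\<lambda>(x, y). By x y)"
  shows "integral (cbox (0, 0) (L, M)) (\<lambda>(x, y). Ax x y + By x y)
    = integral {0..M} (\<lambda>y. A L y - A 0 y) + integral {0..L} (\<lambda>x. B x M - B x 0)"
proof -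
  have cA: "continuous_on (cbox (0, 0) (L, M)) (\<lambda>(x, y). Ax x y)" and cB: "continuous_on (cbox (0, 0) (L, M)) (\<lambda>(x, y). By x y)"
    by (rule continuous_on_subset[OF A(2) subset_UNIV], rule continuous_on_subset[OF B(2) subset_UNIV])
  have "(\<lambda>(x, y). Ax x y + By x y) = (\<lambda>z. (\<lambda>(x, y). Ax x y) z + (\<lambda>(x, y). By x y) z)" by auto
  then have "integral (cbox (0, 0) (L, M)) (\<lambda>(x, y). Ax x y + By x y)
    = integral (cbox (0, 0) (L, M)) (\<lambda>(x, y). Ax x y) + integral (cbox (0, 0) (L, M)) (\<lambda>(x, y). By x y)"
    using cA cB by (simp only: Henstock_Kurzweil_Integration.integral_add integrable_continuous)
  also have "integral (cbox (0, 0) (L, M)) (\<lambda>(x, y). Ax x y) = integral {0..L} (\<lambda>x. integral {0..M} (\<lambda>y. Ax x y))"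
    using integral_prod_continuous[OF cA] by simp
  also have "\<dots> = integral {0..M} (\<lambda>y. integral {0..L} (\<lambda>x. Ax x y))"
    using integral_swap_continuous[OF cA] by simp
  also have "(\<lambda>y. integral {0..L} (\<lambda>x. Ax x y)) = (\<lambda>y. A L y - A 0 y)"
  proof
    fix y
    have "((\<lambda>x. Ax x y) has_integral (A L y - A 0 y)) {0..L}"
      by (rule fundamental_theorem_of_calculus[OF L(1)])
         (auto intro!: has_field_derivative_at_within[OF A(1)] simp: has_real_derivative_iff_has_vector_derivative[symmetric])
    then show "integral {0..L} (\<lambda>x. Ax x y) = A L y - A 0 y" by (rule integral_unique)
  qed
  also have "integral (cbox (0, 0) (L, M)) (\<lambda>(x, y). By x y) = integral {0..L} (\<lambda>x. integral {0..M} (\<lambda>y. By x y))"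
    using integral_prod_continuous[OF cB] by simp
  also have "(\<lambda>x. integral {0..M} (\<lambda>y. By x y)) = (\<lambda>x. B x M - B x 0)"
  proof
    fix x
    have "((\<lambda>y. By x y) has_integral (B x M - B x 0)) {0..M}"
      by (rule fundamental_theorem_of_calculus[OF L(2)])
         (auto intro!: has_field_derivative_at_within[OF B(1)] simp: has_real_derivative_iff_has_vector_derivative[symmetric])
    then show "integral {0..M} (\<lambda>y. By x y) = B x M - B x 0" by (rule integral_unique)
  qed
  finally show ?thesis .
qed

text \<open>The energy of the harmonic function \<open>\<Sum>j\<le>k. p j x * cos (j * y)\<close>, by Green's formula.\<close>

lemma harmonic_energy:
  fixes p q :: "nat \<Rightarrow> real \<Rightarrow> real"
  assumes L: "L \<ge> 0" and pq: "\<And>j x. ((\<lambda>x. p j x) has_real_derivative q j x) (at x)"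
    and qq: "\<And>j x. ((\<lambda>x. q j x) has_real_derivative (real j)\<^sup>2 * p j x) (at x)"
  shows "integral (cbox (0, 0) (L, 2 * pi)) (\<lambda>z. (cos_sum k (\<lambda>j. q j (fst z)) (snd z))\<^sup>2
      + (- (\<Sum>j\<le>k. p j (fst z) * (real j * sin (real j * snd z))))\<^sup>2)
    = (2 * pi * (p 0 L * q 0 L) + pi * (\<Sum>j=1..k. p j L * q j L)) - (2 * pi * (p 0 0 * q 0 0) + pi * (\<Sum>j=1..k. p j 0 * q j 0))"
proof -
  define W where "W x y = cos_sum k (\<lambda>j. p j x) y" for x y
  define Wx where "Wx x y = cos_sum k (\<lambda>j. q j x) y" for x y
  define Wy where "Wy x y = - (\<Sum>j\<le>k. p j x * (real j * sin (real j * y)))" for x y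
  define Wxx where "Wxx x y = cos_sum k (\<lambda>j. (real j)\<^sup>2 * p j x) y" for x y
  let ?B = "cbox (0, 0) (L, 2 * pi) :: (real \<times> real) set"
  have dW: "((\<lambda>x. W x y) has_real_derivative Wx x y) (at x)" "((\<lambda>x. Wx x y) has_real_derivative Wxx x y) (at x)" for x y
    unfolding W_def Wx_def Wxx_def cos_sum_def by (intro DERIV_sum DERIV_cmult_right pq qq)+
  have dWy: "((\<lambda>y. W x y) has_real_derivative Wy x y) (at y)" for x y
    unfolding W_def Wy_def by (rule cos_sum_deriv)
  have dWyy: "((\<lambda>y. Wy x y) has_real_derivative - Wxx x y) (at y)" for x y
    unfolding Wy_def Wxx_def cos_sum_def
    by (auto intro!: derivative_eq_intros sum.cong simp: power2_eq_square)
  have c: "continuous_on UNIV (p j)" "continuous_on UNIV (q j)" for j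
    by (rule continuous_at_imp_continuous_on, use DERIV_isCont[OF pq] DERIV_isCont[OF qq] in blast)+
  have cp: "continuous_on UNIV (\<lambda>z::real \<times> real. p j (fst z))" "continuous_on UNIV (\<lambda>z::real \<times> real. q j (fst z))" for j
    by (rule continuous_on_compose2[OF c(1) continuous_on_fst[OF continuous_on_id]], simp)
       (rule continuous_on_compose2[OF c(2) continuous_on_fst[OF continuous_on_id]], simp)
  have cW: "continuous_on UNIV (\<lambda>z. W (fst z) (snd z))" "continuous_on UNIV (\<lambda>z. Wx (fst z) (snd z))"
     "continuous_on UNIV (\<lambda>z. Wy (fst z) (snd z))" "continuous_on UNIV (\<lambda>z. Wxx (fst z) (snd z))"
    unfolding W_def Wx_def Wy_def Wxx_def cos_sum_def by (intro continuous_intros cp)+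
  \<comment> \<open>\<open>Wxx * W\<close> is added to one summand and subtracted from the other.
    Because the y-derivative of Wy is - Wxx, the integrand becomes the divergence of W times its
    gradient.\<close>
  have "integral ?B (\<lambda>z. (Wx (fst z) (snd z))\<^sup>2 + (Wy (fst z) (snd z))\<^sup>2)
    = integral ?B (\<lambda>(x, y). (Wx x y * Wx x y + Wxx x y * W x y) + (Wy x y * Wy x y + - Wxx x y * W x y))"
    by (rule arg_cong[where f = "integral ?B"]) (auto simp: fun_eq_iff power2_eq_square)
  also have "\<dots> = integral {0..2 * pi} (\<lambda>y. W L y * Wx L y - W 0 y * Wx 0 y)
      + integral {0..L} (\<lambda>x. W x (2 * pi) * Wy x (2 * pi) - W x 0 * Wy x 0)"
    by (rule integral_divergence_box[OF L _ DERIV_mult[OF dW] _ DERIV_mult[OF dWy dWyy]])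
       (auto intro!: continuous_intros cW simp: case_prod_unfold)
  \<comment> \<open>The sides \<eta> = 0 and \<eta> = 2 pi contribute nothing: the sines in Wy
    vanish there.\<close>
  also have "(\<lambda>x. W x (2 * pi) * Wy x (2 * pi) - W x 0 * Wy x 0) = (\<lambda>x. 0)"
  proof -
    have "sin (real j * (2 * pi)) = 0" for j
      using sin_npi[of "2 * j"] by (simp add: mult_ac)
    then have "Wy x (2 * pi) = 0" "Wy x 0 = 0" for x by (simp_all add: Wy_def)
    then show ?thesis by simp
  qed
  also have "integral {0..2 * pi} (\<lambda>y. W L y * Wx L y - W 0 y * Wx 0 y)
    = (2 * pi * (p 0 L * q 0 L) + pi * (\<Sum>j=1..k. p j L * q j L)) - (2 * pi * (p 0 0 * q 0 0) + pi * (\<Sum>j=1..k. p j 0 * q j 0))"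
    unfolding W_def Wx_def by (intro integral_unique has_integral_diff has_integral_cos_sum_mult)
  finally show ?thesis by (simp add: Wx_def Wy_def)
qed

section \<open>Conformal invariance of the Dirichlet integrand\<close>

definition ell_dx :: "real \<Rightarrow> real \<times> real \<Rightarrow> real \<times> real" where
  "ell_dx e z = (e * sinh (fst z) * cos (snd z), e * cosh (fst z) * sin (snd z))"
definition ell_dy :: "real \<Rightarrow> real \<times> real \<Rightarrow> real \<times> real" where
  "ell_dy e z = (- (e * cosh (fst z) * sin (snd z)), e * sinh (fst z) * cos (snd z))"

lemma ell_partial:
  assumes "f differentiable (at (ell e (x, y)))"
  shows "((\<lambda>x. f (ell e (x, y))) has_real_derivative grad f (ell e (x, y)) \<bullet> ell_dx e (x, y)) (at x)"
    "((\<lambda>y. f (ell e (x, y))) has_real_derivative grad f (ell e (x, y)) \<bullet> ell_dy e (x, y)) (at y)"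
proof -
  note d = has_derivative_grad[OF assms]
  have "((\<lambda>x. ell e (x, y)) has_derivative (\<lambda>h. h *\<^sub>R ell_dx e (x, y))) (at x)"
    unfolding ell_def[abs_def] ell_dx_def fst_conv snd_conv
    by (auto intro!: derivative_eq_intros has_derivative_Pair simp: fun_eq_iff)
  from has_derivative_compose[OF this d]
  show "((\<lambda>x. f (ell e (x, y))) has_real_derivative grad f (ell e (x, y)) \<bullet> ell_dx e (x, y)) (at x)"
    unfolding has_field_derivative_def by (simp add: inner_commute mult_commute_abs)
  have "((\<lambda>y. ell e (x, y)) has_derivative (\<lambda>h. h *\<^sub>R ell_dy e (x, y))) (at y)"
    unfolding ell_def[abs_def] ell_dy_def fst_conv snd_conv
    by (auto intro!: derivative_eq_intros has_derivative_Pair simp: fun_eq_iff)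
  from has_derivative_compose[OF this d]
  show "((\<lambda>y. f (ell e (x, y))) has_real_derivative grad f (ell e (x, y)) \<bullet> ell_dy e (x, y)) (at y)"
    unfolding has_field_derivative_def by (simp add: inner_commute mult_commute_abs)
qed

text \<open>The two coordinate vectors are orthogonal with common squared length
  \<open>ell_jac e z\<close>; the second is the first turned by a right angle. So the Jacobian
  exactly compensates the change in the squared gradient.\<close>

lemma ell_jac_norm: "ell_jac e z * (norm v)\<^sup>2 = (v \<bullet> ell_dx e z)\<^sup>2 + (v \<bullet> ell_dy e z)\<^sup>2"
proof -
  obtain p q where v: "v = (p, q)" by (cases v)
  have "(norm v)\<^sup>2 = p\<^sup>2 + q\<^sup>2" by (simp add: v norm_Pair)
  then show ?thesis
    by (simp add: v ell_jac_def ell_dx_def ell_dy_def power2_eq_square algebra_simps)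
qed

lemma continuous_ell_dx: "continuous_on S (ell_dx e)" and continuous_ell_dy: "continuous_on S (ell_dy e)"
  unfolding ell_dx_def[abs_def] ell_dy_def[abs_def] by (intro continuous_intros)+

text \<open>Pointwise, the squared gradient of F is at least twice its product with any field minus
  the squared length of that field. The field is the gradient of a harmonic W; Green's formula then
  turns the product into the boundary values of g on the segment paired with the normal derivative
  of W. The parameters s and l choose W and can be adapted to the boundary values.\<close>

lemma energy_lower:
  fixes e L s :: real and l :: "nat \<Rightarrow> real"
  assumes e: "e > 0" and \<Omega>: "open \<Omega>" and g: "g \<in> test_functions \<Omega>" and L: "L \<ge> 0"
    and z: "\<And>x y. x > L \<Longrightarrow> grad g (ell e (x, y)) = 0" and z': "\<And>y. g (ell e (L, y)) = 0"
  shows "2 * integral {0..2 * pi} (\<lambda>t. g (e * cos t, 0) * cos_sum k (\<lambda>j. if j = 0 then s else real j * l j) t)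
     - (2 * pi * s\<^sup>2 * L + pi * (\<Sum>j=1..k. real j * (l j)\<^sup>2)) \<le> (LINT x|lebesgue_on \<Omega>. (norm (grad g x))\<^sup>2)"
proof -
  \<comment> \<open>The harmonic modes: decaying exponentials for j \<ge> 1, and for j = 0 a linear
    function reaching 0 at height L. The slope s is a parameter because the best value depends on
    L.\<close>
  define p where "p j x = (if j = 0 then s * (L - x) else l j * exp (- (real j * x)))" for j x
  define q where "q j x = (if j = 0 then - s else - (real j * l j * exp (- (real j * x))))" for j x
  define Wx where "Wx x y = cos_sum k (\<lambda>j. q j x) y" for x y
  define Wy where "Wy x y = - (\<Sum>j\<le>k. p j x * (real j * sin (real j * y)))" for x y
  define Wxx where "Wxx x y = cos_sum k (\<lambda>j. (real j)\<^sup>2 * p j x) y" for x y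
  define F where "F x y = g (ell e (x, y))" for x y
  define Fx where "Fx x y = grad g (ell e (x, y)) \<bullet> ell_dx e (x, y)" for x y
  define Fy where "Fy x y = grad g (ell e (x, y)) \<bullet> ell_dy e (x, y)" for x y
  let ?B = "cbox (0, 0) (L, 2 * pi) :: (real \<times> real) set"
  have pq: "((\<lambda>x. p j x) has_real_derivative q j x) (at x)" and qq: "((\<lambda>x. q j x) has_real_derivative (real j)\<^sup>2 * p j x) (at x)" for j x
    unfolding p_def q_def by (cases "j = 0"; auto intro!: derivative_eq_intros simp: power2_eq_square)+
  have dW: "((\<lambda>x. Wx x y) has_real_derivative Wxx x y) (at x)" for x y
    unfolding Wx_def Wxx_def cos_sum_def by (intro DERIV_sum DERIV_cmult_right qq)
  have dWyy: "((\<lambda>y. Wy x y) has_real_derivative - Wxx x y) (at y)" for x y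
    unfolding Wy_def Wxx_def cos_sum_def
    by (auto intro!: derivative_eq_intros sum.cong simp: power2_eq_square)
  have gd: "g differentiable (at x)" for x by (rule test_functions_differentiable[OF g])
  have dF: "((\<lambda>x. F x y) has_real_derivative Fx x y) (at x)" "((\<lambda>y. F x y) has_real_derivative Fy x y) (at y)" for x y
    unfolding F_def Fx_def Fy_def by (intro ell_partial gd)+
  have cp: "continuous_on UNIV (\<lambda>z. p j (fst z))" "continuous_on UNIV (\<lambda>z. q j (fst z))" for j
    unfolding p_def q_def by (cases "j = 0"; auto intro!: continuous_intros)+
  have cW: "continuous_on UNIV (\<lambda>z. Wx (fst z) (snd z))"
     "continuous_on UNIV (\<lambda>z. Wy (fst z) (snd z))" "continuous_on UNIV (\<lambda>z. Wxx (fst z) (snd z))"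
    unfolding Wx_def Wy_def Wxx_def cos_sum_def by (intro continuous_intros cp)+
  have ce: "continuous_on UNIV (\<lambda>z. ell e (fst z, snd z))" "continuous_on UNIV (\<lambda>z. ell_dx e (fst z, snd z))"
      "continuous_on UNIV (\<lambda>z. ell_dy e (fst z, snd z))"
    using continuous_ell[of UNIV e] continuous_ell_dx[of UNIV e] continuous_ell_dy[of UNIV e] by simp_all
  have cF: "continuous_on UNIV (\<lambda>z. F (fst z) (snd z))" "continuous_on UNIV (\<lambda>z. Fx (fst z) (snd z))"
     "continuous_on UNIV (\<lambda>z. Fy (fst z) (snd z))"
    unfolding F_def Fx_def Fy_def
    by (intro continuous_on_inner ce continuous_on_compose2[OF smooth_on_imp_continuous[OF test_functions_smooth[OF g]] ce(1)]
      continuous_on_compose2[OF continuous_on_grad[OF test_functions_smooth[OF g]] ce(1)]; simp)+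
  have int: "f integrable_on ?B" if "continuous_on UNIV f" for f :: "real \<times> real \<Rightarrow> real"
    by (rule integrable_continuous[OF continuous_on_subset[OF that subset_UNIV]])
  have 1: "integral ?B (\<lambda>z. Fx (fst z) (snd z) * Wx (fst z) (snd z) + Fy (fst z) (snd z) * Wy (fst z) (snd z))
     = integral {0..2 * pi} (\<lambda>t. g (e * cos t, 0) * cos_sum k (\<lambda>j. if j = 0 then s else real j * l j) t)"
  proof -
    \<comment> \<open>The same trick with the roles split: the added and subtracted term is
      \<open>Wxx * F\<close>, so the field is F times the gradient of W. At \<xi> = L the function F
      vanishes, and on the sides Wy does.\<close>
    have "integral ?B (\<lambda>z. Fx (fst z) (snd z) * Wx (fst z) (snd z) + Fy (fst z) (snd z) * Wy (fst z) (snd z))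
      = integral ?B (\<lambda>(x, y). (Fx x y * Wx x y + Wxx x y * F x y) + (Fy x y * Wy x y + - Wxx x y * F x y))"
      by (rule arg_cong[where f = "integral ?B"]) (auto simp: fun_eq_iff)
    also have "\<dots> = integral {0..2 * pi} (\<lambda>y. F L y * Wx L y - F 0 y * Wx 0 y)
        + integral {0..L} (\<lambda>x. F x (2 * pi) * Wy x (2 * pi) - F x 0 * Wy x 0)"
      by (rule integral_divergence_box[OF L _ DERIV_mult[OF dF(1) dW] _ DERIV_mult[OF dF(2) dWyy]])
         (auto intro!: continuous_intros cF cW simp: case_prod_unfold)
    also have "(\<lambda>x. F x (2 * pi) * Wy x (2 * pi) - F x 0 * Wy x 0) = (\<lambda>x. 0)"
    proof -
      have "sin (real j * (2 * pi)) = 0" for j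
        using sin_npi[of "2 * j"] by (simp add: mult_ac)
      then have "Wy x (2 * pi) = 0" "Wy x 0 = 0" for x by (simp_all add: Wy_def)
      then show ?thesis by simp
    qed
    also have "(\<lambda>y. F L y * Wx L y - F 0 y * Wx 0 y) = (\<lambda>t. g (e * cos t, 0) * cos_sum k (\<lambda>j. if j = 0 then s else real j * l j) t)"
    proof
      fix t
      have "Wx 0 t = - cos_sum k (\<lambda>j. if j = 0 then s else real j * l j) t"
        unfolding Wx_def cos_sum_def sum_negf[symmetric] by (intro sum.cong refl) (simp add: q_def)
      then show "F L t * Wx L t - F 0 t * Wx 0 t = g (e * cos t, 0) * cos_sum k (\<lambda>j. if j = 0 then s else real j * l j) t"
        using z' by (simp add: F_def ell_def)
    qed
    finally show ?thesis by simp
  qed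
  have 2: "integral ?B (\<lambda>z. (Wx (fst z) (snd z))\<^sup>2 + (Wy (fst z) (snd z))\<^sup>2)
     \<le> 2 * pi * s\<^sup>2 * L + pi * (\<Sum>j=1..k. real j * (l j)\<^sup>2)"
  proof -
    have "integral ?B (\<lambda>z. (Wx (fst z) (snd z))\<^sup>2 + (Wy (fst z) (snd z))\<^sup>2)
      = (2 * pi * (p 0 L * q 0 L) + pi * (\<Sum>j=1..k. p j L * q j L)) - (2 * pi * (p 0 0 * q 0 0) + pi * (\<Sum>j=1..k. p j 0 * q j 0))"
      unfolding Wx_def Wy_def by (rule harmonic_energy[OF L pq qq])
    \<comment> \<open>Cutting the strip at L only lowers the energy of the decaying modes, so their
      energy on the infinite strip may be used as a bound.\<close>
    also have "(\<Sum>j=1..k. p j L * q j L) \<le> 0"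
    proof (rule sum_nonpos)
      fix j assume "j \<in> {1..k}"
      then have "p j L * q j L = - (real j * (l j * exp (- (real j * L)))\<^sup>2)"
        by (simp add: p_def q_def power2_eq_square)
      then show "p j L * q j L \<le> 0" by simp
    qed
    also have "(\<Sum>j=1..k. p j 0 * q j 0) = - (\<Sum>j=1..k. real j * (l j)\<^sup>2)"
      unfolding sum_negf[symmetric] by (intro sum.cong refl) (simp add: p_def q_def power2_eq_square)
    finally show ?thesis by (simp add: p_def q_def power2_eq_square algebra_simps)
  qed
  have "2 * integral ?B (\<lambda>z. Fx (fst z) (snd z) * Wx (fst z) (snd z) + Fy (fst z) (snd z) * Wy (fst z) (snd z))
     - integral ?B (\<lambda>z. (Wx (fst z) (snd z))\<^sup>2 + (Wy (fst z) (snd z))\<^sup>2)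
     = integral ?B (\<lambda>z. 2 * (Fx (fst z) (snd z) * Wx (fst z) (snd z) + Fy (fst z) (snd z) * Wy (fst z) (snd z))
        - ((Wx (fst z) (snd z))\<^sup>2 + (Wy (fst z) (snd z))\<^sup>2))"
  proof -
    have i1: "(\<lambda>z. 2 * (Fx (fst z) (snd z) * Wx (fst z) (snd z) + Fy (fst z) (snd z) * Wy (fst z) (snd z))) integrable_on ?B"
      and i2: "(\<lambda>z. (Wx (fst z) (snd z))\<^sup>2 + (Wy (fst z) (snd z))\<^sup>2) integrable_on ?B"
      by (rule int, intro continuous_intros cF cW)+
    show ?thesis
      by (simp only: Henstock_Kurzweil_Integration.integral_diff[OF i1 i2] Henstock_Kurzweil_Integration.integral_mult_right)
  qed
  also have "\<dots> \<le> integral ?B (\<lambda>z. ell_jac e z * (norm (grad g (ell e z)))\<^sup>2)"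
  proof (rule integral_le)
    show "(\<lambda>z. ell_jac e z * (norm (grad g (ell e z)))\<^sup>2) integrable_on ?B"
      by (rule int) (intro continuous_intros continuous_ell_jac continuous_on_compose2[OF continuous_on_grad[OF test_functions_smooth[OF g]] continuous_ell] subset_UNIV)
    show "(\<lambda>z. 2 * (Fx (fst z) (snd z) * Wx (fst z) (snd z) + Fy (fst z) (snd z) * Wy (fst z) (snd z))
        - ((Wx (fst z) (snd z))\<^sup>2 + (Wy (fst z) (snd z))\<^sup>2)) integrable_on ?B"
      by (rule int) (intro continuous_intros cF cW)
    fix z :: "real \<times> real"
    have "0 \<le> (Fx (fst z) (snd z) - Wx (fst z) (snd z))\<^sup>2 + (Fy (fst z) (snd z) - Wy (fst z) (snd z))\<^sup>2" by simp
    also have "\<dots> = (Fx (fst z) (snd z))\<^sup>2 + (Fy (fst z) (snd z))\<^sup>2 - (2 * (Fx (fst z) (snd z) * Wx (fst z) (snd z) + Fy (fst z) (snd z) * Wy (fst z) (snd z))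
        - ((Wx (fst z) (snd z))\<^sup>2 + (Wy (fst z) (snd z))\<^sup>2))" by (simp add: power2_eq_square algebra_simps)
    finally show "2 * (Fx (fst z) (snd z) * Wx (fst z) (snd z) + Fy (fst z) (snd z) * Wy (fst z) (snd z))
        - ((Wx (fst z) (snd z))\<^sup>2 + (Wy (fst z) (snd z))\<^sup>2) \<le> ell_jac e z * (norm (grad g (ell e z)))\<^sup>2"
      unfolding ell_jac_norm by (simp add: Fx_def Fy_def)
  qed
  also have "\<dots> = (LINT x|lebesgue_on \<Omega>. (norm (grad g x))\<^sup>2)"
    by (rule energy_elliptic[OF e \<Omega> g L z, symmetric])
  finally show ?thesis using 1 2 by linarith
qed

subsection \<open>The upper bound\<close>

lemma smooth_on_arcosh: "smooth_on {1<..} (arcosh :: real \<Rightarrow> real)"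
proof -
  have sq: "smooth_on {1<..} (\<lambda>x::real. x\<^sup>2 - 1)"
    by (intro smooth_on_diff smooth_on_power) simp_all
  have 1: "smooth_on {1<..} (\<lambda>x::real. sqrt (x\<^sup>2 - 1))"
    by (rule smooth_on_compose_real[OF smooth_on_sqrt _ _ sq]) (simp_all add: power2_eq_square less_1_mult)
  have 2: "smooth_on {1<..} (\<lambda>x::real. x + sqrt (x\<^sup>2 - 1))"
    by (rule smooth_on_add[OF _ smooth_on_ident 1]) simp
  have "smooth_on {1<..} (\<lambda>x::real. ln (x + sqrt (x\<^sup>2 - 1)))"
  proof (rule smooth_on_compose_real[OF smooth_on_ln _ _ 2])
    fix x :: real assume "x \<in> {1<..}"
    then have "1 < x\<^sup>2" by (simp add: power2_eq_square less_1_mult)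
    then have "0 \<le> sqrt (x\<^sup>2 - 1)" by simp
    with \<open>x \<in> {1<..}\<close> show "x + sqrt (x\<^sup>2 - 1) \<in> {0<..}" unfolding greaterThan_iff by linarith
  qed simp_all
  then show ?thesis
    by (subst smooth_on_cong[where g = "\<lambda>x. ln (x + sqrt (x\<^sup>2 - 1))"]) (simp_all add: arcosh_real_def)
qed

lemma foci_sum_ge_1: assumes "e > 0" shows "foci_sum e z \<ge> 1"
proof -
  obtain x y where "z = ell e (x, y)" by (rule ell_surj[OF assms, of z])
  then show ?thesis using foci_sum_ell[OF assms, of "(x, y)"] cosh_real_ge_1[of x] by simp
qed

lemma foci_sum_gt_1: assumes "e > 0" "z \<notin> segm e" shows "foci_sum e z > 1"
proof -
  obtain x y where xy: "x \<ge> 0" "z = ell e (x, y)" by (rule ell_surj[OF assms(1), of z])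
  have "x \<noteq> 0"
  proof
    assume "x = 0"
    then have "z = (e * cos y, 0)" using xy by (simp add: ell_def)
    moreover have "\<bar>e * cos y\<bar> \<le> e" using assms(1) by (simp add: abs_mult mult_le_cancel_left1)
    ultimately show False using assms(2) by (simp add: segm_def abs_le_iff)
  qed
  then have "cosh 0 < cosh x" using xy(1) by (subst cosh_real_nonneg_less_iff) simp_all
  then show ?thesis using xy foci_sum_ell[OF assms(1), of "(x, y)"] by simp
qed

lemma foci_sum_segm: assumes "e > 0" "z \<in> segm e" shows "foci_sum e z = 1"
proof -
  have "\<bar>fst z - e\<bar> = e - fst z" "\<bar>fst z + e\<bar> = fst z + e" "snd z = 0"
    using assms(2) by (auto simp: segm_def)
  then show ?thesis using assms(1) by (simp add: foci_sum_def)
qed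

lemma continuous_foci_sum: "e \<noteq> 0 \<Longrightarrow> continuous_on S (foci_sum e)"
  unfolding foci_sum_def[abs_def] by (intro continuous_intros) simp

lemma closed_segm: "closed (segm e)" and negligible_segm: "negligible (segm e)"
proof -
  show "closed (segm e)" unfolding segm_def by (intro closed_Times) auto
  have "segm e \<subseteq> {z. z \<bullet> (0, 1) = 0}" by (auto simp: segm_def)
  moreover have "negligible {z :: real \<times> real. z \<bullet> (0, 1) = 0}"
    by (rule negligible_standard_hyperplane) (simp add: Basis_prod_def)
  ultimately show "negligible (segm e)" by (rule negligible_subset[rotated])
qed

lemma open_compl_segm: "open (- segm e)"
  by (rule open_Compl[OF closed_segm])

lemma smooth_foci_sum:
  assumes e: "e > 0" shows "smooth_on (- segm e) (foci_sum e)"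
proof -
  have 1: "smooth_on (- segm e) (\<lambda>z. (fst z - c)\<^sup>2 + (snd z)\<^sup>2)" for c
    by (intro smooth_on_add smooth_on_power smooth_on_diff open_compl_segm) simp_all
  have 2: "smooth_on (- segm e) (\<lambda>z. sqrt ((fst z - c)\<^sup>2 + (snd z)\<^sup>2))" if "\<bar>c\<bar> = e" for c
  proof (rule smooth_on_compose_real[OF smooth_on_sqrt _ open_compl_segm 1])
    fix z assume z: "z \<in> - segm e"
    have "(fst z - c)\<^sup>2 + (snd z)\<^sup>2 \<noteq> 0"
    proof
      assume "(fst z - c)\<^sup>2 + (snd z)\<^sup>2 = 0"
      then have "fst z = c" "snd z = 0" by (simp_all add: sum_power2_eq_zero_iff)
      then have "z \<in> segm e" using that by (cases z) (auto simp: segm_def)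
      then show False using z by simp
    qed
    moreover have "0 \<le> (fst z - c)\<^sup>2 + (snd z)\<^sup>2" by simp
    ultimately show "(fst z - c)\<^sup>2 + (snd z)\<^sup>2 \<in> {0<..}" unfolding greaterThan_iff by linarith
  qed simp
  have "smooth_on (- segm e) (\<lambda>z. (sqrt ((fst z - e)\<^sup>2 + (snd z)\<^sup>2) + sqrt ((fst z - - e)\<^sup>2 + (snd z)\<^sup>2)) * (1 / (2 * e)))"
    using e by (intro smooth_on_mult smooth_on_add 2 open_compl_segm smooth_on_const) simp_all
  then show ?thesis unfolding foci_sum_def[abs_def] by simp
qed

lemma norm_ell_le:
  assumes "e > 0" shows "norm (ell e (x, y)) \<le> e * cosh x"
proof -
  have "(norm (ell e (x, y)))\<^sup>2 = (e * cosh x * cos y)\<^sup>2 + (e * sinh x * sin y)\<^sup>2"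
    by (simp add: ell_def norm_Pair)
  also have "\<dots> = e\<^sup>2 * ((cosh x)\<^sup>2 * (cos y)\<^sup>2 + (sinh x)\<^sup>2 * (sin y)\<^sup>2)"
    by (simp add: power2_eq_square algebra_simps)
  also have "\<dots> \<le> e\<^sup>2 * ((cosh x)\<^sup>2 * (cos y)\<^sup>2 + (cosh x)\<^sup>2 * (sin y)\<^sup>2)"
    using hyperbolic_pythagoras[of x] by (intro mult_left_mono add_left_mono mult_right_mono) simp_all
  also have "\<dots> = (e * cosh x)\<^sup>2" by (simp add: distrib_left[symmetric] power_mult_distrib)
  finally show ?thesis using assms by (intro power2_le_imp_le[of "norm (ell e (x, y))"]) simp_all
qed

lemma foci_sum_le_imp_norm:
  assumes "e > 0" "foci_sum e z \<le> cosh x" shows "norm z \<le> e * cosh x"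
proof -
  obtain x' y' where xy: "z = ell e (x', y')" by (rule ell_surj[OF assms(1), of z])
  have "norm z \<le> e * cosh x'" unfolding xy by (rule norm_ell_le[OF assms(1)])
  also have "cosh x' \<le> cosh x" using assms(2) foci_sum_ell[OF assms(1), of "(x', y')"] xy by simp
  finally show ?thesis using assms(1) by simp
qed

lemma compact_foci_le:
  assumes "e > 0" shows "compact {z. foci_sum e z \<le> cosh x}"
proof -
  have "closed {z. foci_sum e z \<le> cosh x}"
    using assms by (intro closed_Collect_le continuous_foci_sum continuous_on_const) simp
  moreover have "bounded {z. foci_sum e z \<le> cosh x}"
    using foci_sum_le_imp_norm[OF assms] by (auto simp: bounded_iff)
  ultimately show ?thesis by (simp add: compact_eq_bounded_closed)
qed

text \<open>The coordinate \<xi> as an explicit function on the plane: its smoothness off the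
  segment comes from composition, and its sublevel sets are filled confocal ellipses.\<close>

definition ell_fst :: "real \<Rightarrow> real \<times> real \<Rightarrow> real" where "ell_fst e z = arcosh (foci_sum e z)"

lemma ell_fst_ell: "e > 0 \<Longrightarrow> x \<ge> 0 \<Longrightarrow> ell_fst e (ell e (x, y)) = x"
  unfolding ell_fst_def by (simp add: foci_sum_ell arcosh_cosh_real)

lemma smooth_ell_fst: assumes e: "e > 0" shows "smooth_on (- segm e) (ell_fst e)"
  unfolding ell_fst_def[abs_def]
  by (rule smooth_on_compose_real[OF smooth_on_arcosh _ open_compl_segm smooth_foci_sum[OF e]]) 
     (use foci_sum_gt_1[OF e] in auto)

lemma cosh_ell_fst: "e > 0 \<Longrightarrow> cosh (ell_fst e z) = foci_sum e z"
  unfolding ell_fst_def using foci_sum_ge_1 by (simp add: cosh_arcosh_real)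

lemma ell_fst_nonneg: "e > 0 \<Longrightarrow> ell_fst e z \<ge> 0"
  unfolding ell_fst_def using foci_sum_ge_1 by (simp add: arcosh_nonneg_real)

lemma ell_fst_le_iff: "e > 0 \<Longrightarrow> x \<ge> 0 \<Longrightarrow> ell_fst e z \<le> x \<longleftrightarrow> foci_sum e z \<le> cosh x"
  using cosh_real_nonneg_le_iff[of "ell_fst e z" x] by (simp add: ell_fst_nonneg cosh_ell_fst)

lemma ell_fst_less_iff: "e > 0 \<Longrightarrow> x \<ge> 0 \<Longrightarrow> ell_fst e z < x \<longleftrightarrow> foci_sum e z < cosh x"
  using cosh_real_nonneg_less_iff[of "ell_fst e z" x] by (simp add: ell_fst_nonneg cosh_ell_fst)

lemma open_ell_fst_less: assumes "e > 0" "x \<ge> 0" shows "open {z. ell_fst e z < x}" "open {z. x < ell_fst e z}"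
proof -
  have "{z. ell_fst e z < x} = {z. foci_sum e z < cosh x}" using ell_fst_less_iff[OF assms] by blast
  moreover have "{z. x < ell_fst e z} = {z. cosh x < foci_sum e z}"
    using ell_fst_le_iff[OF assms] by (auto simp: not_le[symmetric])
  ultimately show "open {z. ell_fst e z < x}" "open {z. x < ell_fst e z}"
    using assms by (auto intro!: open_Collect_less continuous_foci_sum)
qed

lemma segm_ell_fst: "e > 0 \<Longrightarrow> z \<in> segm e \<Longrightarrow> ell_fst e z = 0"
  unfolding ell_fst_def by (simp add: foci_sum_segm)

section \<open>Cutting off in \<xi> and gluing to u near the segment\<close>

definition ell_cut :: "real \<Rightarrow> real \<Rightarrow> real \<times> real \<Rightarrow> real" where
  "ell_cut e d z = smooth_step (2 - ell_fst e z / d)"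

lemma ell_cut_1: "d > 0 \<Longrightarrow> ell_fst e z < d \<Longrightarrow> ell_cut e d z = 1"
  unfolding ell_cut_def by (rule smooth_step_1) (simp add: divide_simps)

lemma ell_cut_0: "d > 0 \<Longrightarrow> ell_fst e z \<ge> 2 * d \<Longrightarrow> ell_cut e d z = 0"
  unfolding ell_cut_def by (rule smooth_step_0) (simp add: divide_simps)

text \<open>\<xi> is not smooth on the segment, but the cutoff is the constant 1 on the
  neighbourhood \<xi> < d of it, and elsewhere it is a composition of smooth functions.\<close>

lemma smooth_ell_cut:
  assumes e: "e > 0" and d: "d > 0" shows "smooth_on UNIV (ell_cut e d)"
proof -
  have "smooth_on (- segm e) (\<lambda>z. 2 - ell_fst e z * (1 / d))"
    by (intro smooth_on_diff smooth_on_mult open_compl_segm smooth_on_const smooth_ell_fst[OF e])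
  from smooth_on_compose_real[OF smooth_on_step open_UNIV open_compl_segm this]
  have 1: "smooth_on (- segm e) (ell_cut e d)" by (simp add: ell_cut_def[abs_def])
  have o: "open {z. ell_fst e z < d}" using open_ell_fst_less(1)[OF e] d by simp
  have 2: "smooth_on {z. ell_fst e z < d} (ell_cut e d)"
    by (subst smooth_on_cong[OF o, where g = "\<lambda>z. 1"]) (simp_all add: ell_cut_1[OF d])
  have "{z. ell_fst e z < d} \<union> - segm e = UNIV" using segm_ell_fst[OF e] d by auto
  then show ?thesis using smooth_on_Un[OF o open_compl_segm 2 1] by simp
qed

lemma ell_cut_test:
  assumes e: "e > 0" and d: "d > 0" and \<Omega>: "cball 0 (e * cosh (2 * d)) \<subseteq> \<Omega>"
  shows "ell_cut e d \<in> test_functions \<Omega>"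
proof (rule test_functionsI[OF smooth_ell_cut[OF e d] compact_foci_le[OF e, of "2 * d"]])
  show "{z. foci_sum e z \<le> cosh (2 * d)} \<subseteq> \<Omega>"
    using foci_sum_le_imp_norm[OF e] \<Omega> by (force simp: mem_cball)
  show "ell_cut e d z = 0" if "z \<notin> {z. foci_sum e z \<le> cosh (2 * d)}" for z
    using that ell_fst_le_iff[OF e, of "2 * d" z] d by (intro ell_cut_0) auto
qed


text \<open>The competitor equals \<open>u\<close> on the thin ellipse \<open>\<xi> \<le> d\<close> and \<open>v\<close> outside \<open>\<xi> \<le> 2 * d\<close>. As \<open>u\<close> and \<open>v\<close> agree
  on the segment, \<open>u - v = O(d)\<close> in the transition zone, which therefore carries energy \<open>O(d)\<close>.\<close>

lemma u_capacity_le_strip: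
  fixes V Vx Vy :: "real \<Rightarrow> real \<Rightarrow> real"
  assumes \<Omega>: "open \<Omega>" and u: "smooth_on \<Omega> u" "u \<in> H10 \<Omega>" and e: "e > 0" and L: "L > 0"
    and sub: "cball 0 (e * cosh L) \<subseteq> \<Omega>"
    and v: "smooth_on (- segm e) v" "\<And>z. ell_fst e z \<ge> L \<Longrightarrow> v z = 0"
    and V: "\<And>x y. x > 0 \<Longrightarrow> v (ell e (x, y)) = V x y" "\<And>y. V 0 y = u (e * cos y, 0)"
    and dV: "\<And>x y. ((\<lambda>x. V x y) has_real_derivative Vx x y) (at x)" "\<And>x y. ((\<lambda>y. V x y) has_real_derivative Vy x y) (at y)"
    and cV: "continuous_on UNIV (\<lambda>z. Vx (fst z) (snd z))" "continuous_on UNIV (\<lambda>z. Vy (fst z) (snd z))"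
  shows "u_capacity \<Omega> (segm e) u \<le> integral (cbox (0, 0) (L, 2 * pi)) (\<lambda>z. (Vx (fst z) (snd z))\<^sup>2 + (Vy (fst z) (snd z))\<^sup>2)"
proof -
  let ?B = "cbox (0, 0) (L, 2 * pi) :: (real \<times> real) set"
  let ?I = "integral ?B (\<lambda>z. (Vx (fst z) (snd z))\<^sup>2 + (Vy (fst z) (snd z))\<^sup>2)"
  define U where "U x y = u (ell e (x, y))" for x y
  define Ux where "Ux x y = grad u (ell e (x, y)) \<bullet> ell_dx e (x, y)" for x y
  define Uy where "Uy x y = grad u (ell e (x, y)) \<bullet> ell_dy e (x, y)" for x y
  have in\<Omega>: "ell e (x, y) \<in> \<Omega>" if "0 \<le> x" "x \<le> L" for x y
  proof -
    have "norm (ell e (x, y)) \<le> e * cosh x" by (rule norm_ell_le[OF e])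
    also have "\<dots> \<le> e * cosh L" using e that by (simp add: cosh_real_nonneg_le_iff)
    finally show ?thesis using sub by auto
  qed
  have dU: "((\<lambda>x. U x y) has_real_derivative Ux x y) (at x)" "((\<lambda>y. U x y) has_real_derivative Uy x y) (at y)"
    if "0 \<le> x" "x \<le> L" for x y
    unfolding U_def Ux_def Uy_def by (intro ell_partial smooth_on_imp_differentiable[OF u(1)] in\<Omega> that)+
  obtain T where T: "\<And>t. t \<in> {0..2} \<Longrightarrow> \<bar>deriv smooth_step t\<bar> \<le> T" "T \<ge> 0"
  proof -
    have "continuous_on UNIV (\<lambda>t. frechet_derivative smooth_step (at t) 1)"
      by (rule smooth_on_imp_continuous[OF smooth_on_frechet[OF smooth_on_step]]) simp
    moreover have "frechet_derivative smooth_step (at t) 1 = deriv smooth_step t" for t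
    proof -
      have "smooth_step differentiable (at t)" by (rule smooth_on_imp_differentiable[OF smooth_on_step]) simp
      then obtain D where D: "(smooth_step has_real_derivative D) (at t)" using real_differentiable_def by blast
      show ?thesis
        using frechet_derivative_at'[OF D[unfolded has_field_derivative_def]] DERIV_imp_deriv[OF D] by simp
    qed
    ultimately have "continuous_on UNIV (deriv smooth_step)" by simp
    then have "continuous_on {0..2} (deriv smooth_step)" by (rule continuous_on_subset) simp
    then have "bounded (deriv smooth_step ` {0..2})"
      by (intro compact_imp_bounded compact_continuous_image) simp_all
    then obtain T where "T > 0" "\<forall>t\<in>{0..2}. \<bar>deriv smooth_step t\<bar> \<le> T" by (auto simp: bounded_pos)
    then show ?thesis by (intro that[of T]) auto
  qed
  have step: "(smooth_step has_real_derivative deriv smooth_step t) (at t)" for t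
  proof -
    have "smooth_step differentiable (at t)" by (rule smooth_on_imp_differentiable[OF smooth_on_step]) simp
    then show ?thesis using real_differentiable_def DERIV_imp_deriv by metis
  qed
  obtain M where M: "M \<ge> 0" "\<And>x y. 0 \<le> x \<Longrightarrow> x \<le> L \<Longrightarrow> 0 \<le> y \<Longrightarrow> y \<le> 2 * pi \<Longrightarrow>
      \<bar>Ux x y\<bar> \<le> M \<and> \<bar>Uy x y\<bar> \<le> M \<and> \<bar>Vx x y\<bar> \<le> M \<and> \<bar>Vy x y\<bar> \<le> M"
  proof -
    have bnd: "\<exists>M. \<forall>z\<in>?B. \<bar>f z\<bar> \<le> M" if "continuous_on ?B f" for f :: "real \<times> real \<Rightarrow> real"
      using compact_imp_bounded[OF compact_continuous_image[OF that compact_cbox]] by (auto simp: bounded_iff)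
    have ce: "ell e ` ?B \<subseteq> \<Omega>" using in\<Omega> by auto
    have cg: "continuous_on ?B (\<lambda>z. grad u (ell e z))"
      by (rule continuous_on_compose2[OF continuous_on_grad[OF u(1)] continuous_ell ce])
    have c1: "continuous_on ?B (\<lambda>z. grad u (ell e z) \<bullet> ell_dx e z)" "continuous_on ?B (\<lambda>z. grad u (ell e z) \<bullet> ell_dy e z)"
      by (intro continuous_on_inner cg continuous_ell_dx continuous_ell_dy)+
    obtain M1 where M1: "\<forall>z\<in>?B. \<bar>grad u (ell e z) \<bullet> ell_dx e z\<bar> \<le> M1" using bnd[OF c1(1)] by blast
    obtain M2 where M2: "\<forall>z\<in>?B. \<bar>grad u (ell e z) \<bullet> ell_dy e z\<bar> \<le> M2" using bnd[OF c1(2)] by blast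
    obtain M3 where M3: "\<forall>z\<in>?B. \<bar>Vx (fst z) (snd z)\<bar> \<le> M3" using bnd[OF continuous_on_subset[OF cV(1) subset_UNIV]] by blast
    obtain M4 where M4: "\<forall>z\<in>?B. \<bar>Vy (fst z) (snd z)\<bar> \<le> M4" using bnd[OF continuous_on_subset[OF cV(2) subset_UNIV]] by blast
    let ?M = "\<bar>M1\<bar> + \<bar>M2\<bar> + \<bar>M3\<bar> + \<bar>M4\<bar>"
    have "\<bar>Ux x y\<bar> \<le> ?M \<and> \<bar>Uy x y\<bar> \<le> ?M \<and> \<bar>Vx x y\<bar> \<le> ?M \<and> \<bar>Vy x y\<bar> \<le> ?M"
      if "0 \<le> x" "x \<le> L" "0 \<le> y" "y \<le> 2 * pi" for x y
    proof -
      have "(x, y) \<in> ?B" using that by auto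
      then have "\<bar>Ux x y\<bar> \<le> M1" "\<bar>Uy x y\<bar> \<le> M2" "\<bar>Vx x y\<bar> \<le> M3" "\<bar>Vy x y\<bar> \<le> M4"
        using M1 M2 M3 M4 unfolding Ux_def Uy_def by (metis fst_conv snd_conv)+
      then show ?thesis by linarith
    qed
    then show ?thesis by (intro that[of ?M]) auto
  qed
  \<comment> \<open>U and V agree at \<xi> = 0. Their \<xi>-derivatives are bounded up to the
    segment, because the coordinate map is smooth there even though its inverse is not; the mean
    value theorem gives the linear bound.\<close>
  have UV: "\<bar>U x y - V x y\<bar> \<le> 2 * M * x" if "0 < x" "x \<le> L" "0 \<le> y" "y \<le> 2 * pi" for x y
  proof -
    have "\<exists>z. 0 < z \<and> z < x \<and> (U x y - V x y) - (U 0 y - V 0 y) = (x - 0) * (Ux z y - Vx z y)"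
      using that by (intro MVT2 DERIV_diff dU dV) auto
    then obtain z where z: "0 < z" "z < x" "(U x y - V x y) - (U 0 y - V 0 y) = (x - 0) * (Ux z y - Vx z y)" by blast
    have "U 0 y = V 0 y" using V(2) by (simp add: U_def ell_def)
    then have "\<bar>U x y - V x y\<bar> = x * \<bar>Ux z y - Vx z y\<bar>" using z that by (simp add: abs_mult)
    also have "\<bar>Ux z y - Vx z y\<bar> \<le> 2 * M" using M(2)[of z y] z that by (simp add: abs_le_iff)
    finally show ?thesis using that by (simp add: mult.commute mult_left_mono)
  qed
  \<comment> \<open>In the layer the slope of the cutoff is at most T / d and the difference of U
    and V at most 2 M * 2 d, which gives 4 T M. The weighted mean of the derivatives of U and V
    contributes at most 2 M.\<close>
  define C where "C = 4 * T * M + 2 * M"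
  have C: "0 \<le> C" unfolding C_def using T(2) M(1) by simp
  have main: "u_capacity \<Omega> (segm e) u \<le> ?I + 2 * C\<^sup>2 * (2 * d * (2 * pi))" if d: "0 < d" "2 * d < L" for d
  proof -
    let ?t = "ell_cut e d"
    define g where "g z = u z * ?t z + (1 - ?t z) * v z" for z
    let ?W = "{z. ell_fst e z < d}"
    have oW: "open ?W" and KW: "segm e \<subseteq> ?W"
      using open_ell_fst_less(1)[OF e, of d] segm_ell_fst[OF e] d by auto
    have tt: "?t \<in> test_functions \<Omega>"
    proof (rule ell_cut_test[OF e d(1)])
      have "e * cosh (2 * d) \<le> e * cosh L" using e d by (simp add: cosh_real_nonneg_le_iff)
      then show "cball 0 (e * cosh (2 * d)) \<subseteq> \<Omega>" using sub subset_cball[of "e * cosh (2 * d)" "e * cosh L" "0 :: real \<times> real"] by blast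
    qed
    have t1: "?t z = 1" if "z \<in> ?W" for z using ell_cut_1[OF d(1)] that by simp
    have s1: "smooth_on UNIV (\<lambda>z. (1 - ?t z) * v z)"
    proof -
      have 1: "smooth_on (- segm e) (\<lambda>z. (1 - ?t z) * v z)"
        by (rule smooth_on_mult[OF open_compl_segm smooth_on_diff[OF open_compl_segm smooth_on_const smooth_on_subset[OF smooth_ell_cut[OF e d(1)] subset_UNIV]] v(1)])
      have 2: "smooth_on ?W (\<lambda>z. (1 - ?t z) * v z)"
        by (subst smooth_on_cong[OF oW, where g = "\<lambda>z. 0"]) (simp_all add: t1)
      have "?W \<union> - segm e = UNIV" using KW by blast
      then show ?thesis using smooth_on_Un[OF oW open_compl_segm 2 1] by simp
    qed
    have tv: "(\<lambda>z. (1 - ?t z) * v z) \<in> test_functions \<Omega>"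
    proof (rule test_functionsI[OF s1 compact_foci_le[OF e, of L]])
      show "{z. foci_sum e z \<le> cosh L} \<subseteq> \<Omega>"
        using foci_sum_le_imp_norm[OF e] sub by (force simp: mem_cball)
      show "(1 - ?t z) * v z = 0" if "z \<notin> {z. foci_sum e z \<le> cosh L}" for z
        using that ell_fst_le_iff[OF e, of L z] L v(2)[of z] by simp
    qed
    have gt: "g \<in> test_functions \<Omega>"
      unfolding g_def[abs_def] by (rule test_functions_add[OF test_functions_mult[OF \<Omega> u(1) tt] tv])
    have gW: "g z = u z" if "z \<in> ?W" for z using t1[OF that] by (simp add: g_def)
    have gd: "g differentiable (at z)" for z by (rule test_functions_differentiable[OF gt])
    have "u_capacity \<Omega> (segm e) u \<le> (LINT x|lebesgue_on \<Omega>. (norm (grad g x))\<^sup>2)"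
      by (rule u_capacity_le[OF \<Omega> closed_segm negligible_segm u tt _ _ oW KW t1 gt oW KW gW])
         (simp_all add: ell_cut_def smooth_step_nonneg smooth_step_le_1)
    also have "\<dots> = integral ?B (\<lambda>z. ell_jac e z * (norm (grad g (ell e z)))\<^sup>2)"
    proof (rule energy_elliptic[OF e \<Omega> gt])
      fix x y assume x: "x > L"
      have "grad g (ell e (x, y)) = grad (\<lambda>z. 0) (ell e (x, y))"
      proof (rule grad_eq_on_open)
        show "open {z. L < ell_fst e z}" using open_ell_fst_less(2)[OF e] L by simp
        show "ell e (x, y) \<in> {z. L < ell_fst e z}" using x L ell_fst_ell[OF e] by simp
        fix z assume "z \<in> {z. L < ell_fst e z}"
        then have "v z = 0" "?t z = 0" using v(2) ell_cut_0[OF d(1)] d(2) by auto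
        then show "g z = 0" by (simp add: g_def)
      qed
      then show "grad g (ell e (x, y)) = 0" by simp
    qed (use L in simp)
    \<comment> \<open>Beyond \<xi> = 2 d the glued function is V itself. On the thin part both
      partial derivatives are at most C in modulus, which costs \<open>2 * C\<^sup>2\<close> over a
      rectangle of width 2 d.\<close>
    also have "\<dots> \<le> integral ?B (\<lambda>z. ((Vx (fst z) (snd z))\<^sup>2 + (Vy (fst z) (snd z))\<^sup>2)
         + (if z \<in> cbox (0, 0) (2 * d, 2 * pi) then 2 * C\<^sup>2 else 0))"
    proof (rule integral_le)
      show "(\<lambda>z. ell_jac e z * (norm (grad g (ell e z)))\<^sup>2) integrable_on ?B"
        by (intro integrable_continuous continuous_intros continuous_ell_jac continuous_on_compose2[OF continuous_on_grad[OF test_functions_smooth[OF gt]] continuous_ell] subset_UNIV)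
      show "(\<lambda>z. ((Vx (fst z) (snd z))\<^sup>2 + (Vy (fst z) (snd z))\<^sup>2)
         + (if z \<in> cbox (0, 0) (2 * d, 2 * pi) then 2 * C\<^sup>2 else 0)) integrable_on ?B"
      proof (rule integrable_add)
        show "(\<lambda>z. (Vx (fst z) (snd z))\<^sup>2 + (Vy (fst z) (snd z))\<^sup>2) integrable_on ?B"
          by (intro integrable_continuous continuous_intros continuous_on_subset[OF cV(1)] continuous_on_subset[OF cV(2)] subset_UNIV)
        have "cbox (0, 0) (2 * d, 2 * pi) \<subseteq> ?B" using d by (auto simp: cbox_Pair_eq)
        then show "(\<lambda>z. if z \<in> cbox (0, 0) (2 * d, 2 * pi) then 2 * C\<^sup>2 else 0) integrable_on ?B"
          by (simp add: integrable_restrict_Int Int_absorb1 Int_absorb2 integrable_const)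
      qed
      fix z assume zB: "z \<in> ?B"
      obtain x y where z: "z = (x, y)" by (cases z)
      have xy: "0 \<le> x" "x \<le> L" "0 \<le> y" "y \<le> 2 * pi" using zB by (auto simp: z)
      let ?Gx = "grad g (ell e (x, y)) \<bullet> ell_dx e (x, y)" and ?Gy = "grad g (ell e (x, y)) \<bullet> ell_dy e (x, y)"
      have Gx: "((\<lambda>x. g (ell e (x, y))) has_real_derivative ?Gx) (at x)"
        and Gy: "((\<lambda>y. g (ell e (x, y))) has_real_derivative ?Gy) (at y)" by (intro ell_partial gd)+
      have gV: "g (ell e (x, y)) = U x y * smooth_step (2 - x / d) + (1 - smooth_step (2 - x / d)) * V x y" if "x > 0" for x y
        using that V(1) ell_fst_ell[OF e, of x y] by (simp add: g_def ell_cut_def U_def)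
      have "?Gx\<^sup>2 + ?Gy\<^sup>2 \<le> (Vx x y)\<^sup>2 + (Vy x y)\<^sup>2 + (if x \<le> 2 * d then 2 * C\<^sup>2 else 0)"
      proof (cases "x \<le> 2 * d")
        case False
        have gV': "g (ell e (x, y)) = V x y" if "x > 2 * d" for x y
          using gV[of x y] smooth_step_0[of "2 - x / d"] that d(1) by (simp add: divide_simps)
        have "((\<lambda>x. V x y) has_real_derivative ?Gx) (at x)"
          by (rule has_field_derivative_transform_within_open[OF Gx, of "{2 * d<..}"]) (use False gV' in auto)
        then have 1: "?Gx = Vx x y" using dV(1) DERIV_unique by blast
        have "(\<lambda>y. g (ell e (x, y))) = (\<lambda>y. V x y)" using gV' False by auto
        then have "?Gy = Vy x y" using Gy dV(2) DERIV_unique by metis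
        with 1 False show ?thesis by simp
      next
        case True
        have MM: "\<bar>Ux x y\<bar> \<le> M" "\<bar>Uy x y\<bar> \<le> M" "\<bar>Vx x y\<bar> \<le> M" "\<bar>Vy x y\<bar> \<le> M" using M(2)[OF xy] by auto
        have "\<bar>?Gx\<bar> \<le> C \<and> \<bar>?Gy\<bar> \<le> C"
        \<comment> \<open>The formula through U and V holds only off the segment; on the segment g
          equals u in a whole neighbourhood.\<close>
        proof (cases "x = 0")
          case x0: True
          have "grad g (ell e (x, y)) = grad u (ell e (x, y))"
            by (rule grad_eq_on_open[OF oW _ gW]) (use x0 ell_fst_ell[OF e, of 0 y] d in auto)
          then have "?Gx = Ux x y" "?Gy = Uy x y" by (simp_all add: Ux_def Uy_def)
          moreover have "M \<le> C" using T(2) M(1) by (simp add: C_def)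
          ultimately show ?thesis using MM by simp
        next
          case False
          then have x: "x > 0" using xy by simp
          let ?s = "smooth_step (2 - x / d)" and ?s' = "deriv smooth_step (2 - x / d)"
          have ds: "((\<lambda>x. smooth_step (2 - x / d)) has_real_derivative - ?s' / d) (at x)"
          proof -
            have "((\<lambda>x. 2 - x / d) has_real_derivative - 1 / d) (at x)"
              using d by (auto intro!: derivative_eq_intros)
            from DERIV_chain2[OF step this] show ?thesis by simp
          qed
          have "((\<lambda>x. U x y * smooth_step (2 - x / d) + (1 - smooth_step (2 - x / d)) * V x y) has_real_derivative ?Gx) (at x)"
            by (rule has_field_derivative_transform_within_open[OF Gx, of "{0<..}"]) (use x gV in auto)
          moreover have "((\<lambda>x. U x y * smooth_step (2 - x / d) + (1 - smooth_step (2 - x / d)) * V x y) has_real_derivative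
              (Ux x y * ?s + (- ?s' / d) * U x y) + ((0 - (- ?s' / d)) * V x y + Vx x y * (1 - ?s))) (at x)"
            by (intro DERIV_add DERIV_mult DERIV_diff DERIV_const ds dU dV xy)
          ultimately have "?Gx = (Ux x y * ?s + (- ?s' / d) * U x y) + ((0 - (- ?s' / d)) * V x y + Vx x y * (1 - ?s))"
            by (rule DERIV_unique)
          also have "\<dots> = Ux x y * ?s + Vx x y * (1 - ?s) + - (?s' / d * (U x y - V x y))" by (simp add: algebra_simps diff_divide_distrib)
          finally have G1: "?Gx = Ux x y * ?s + Vx x y * (1 - ?s) + - (?s' / d * (U x y - V x y))" .
          have s01: "0 \<le> ?s" "?s \<le> 1" by (rule smooth_step_nonneg, rule smooth_step_le_1)
          have small: "\<bar>a * ?s\<bar> \<le> M" "\<bar>a * (1 - ?s)\<bar> \<le> M" if "\<bar>a\<bar> \<le> M" for a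
          proof -
            have "\<bar>a\<bar> * \<bar>?s\<bar> \<le> M * 1" "\<bar>a\<bar> * \<bar>1 - ?s\<bar> \<le> M * 1" using that s01 M(1) by (intro mult_mono; simp)+
            then show "\<bar>a * ?s\<bar> \<le> M" "\<bar>a * (1 - ?s)\<bar> \<le> M" by (simp_all add: abs_mult)
          qed
          have "\<bar>?s'\<bar> \<le> T" using True x d by (intro T(1)) (auto simp: divide_simps)
          then have "\<bar>?s' / d\<bar> * \<bar>U x y - V x y\<bar> \<le> (T / d) * (2 * M * (2 * d))"
          proof (intro mult_mono)
            have "2 * M * x \<le> 2 * M * (2 * d)" using True M(1) by (intro mult_left_mono) auto
            then show "\<bar>U x y - V x y\<bar> \<le> 2 * M * (2 * d)" using UV[OF x xy(2-4)] by linarith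
          qed (use d T(2) in \<open>auto simp: divide_right_mono\<close>)
          also have "\<dots> = 4 * T * M" using d by simp
          finally have "\<bar>- (?s' / d * (U x y - V x y))\<bar> \<le> 4 * T * M" by (simp add: abs_mult)
          then have A: "\<bar>?Gx\<bar> \<le> C" unfolding G1 C_def using small(1)[OF MM(1)] small(2)[OF MM(3)] by linarith
          have "(\<lambda>y. g (ell e (x, y))) = (\<lambda>y. U x y * ?s + (1 - ?s) * V x y)" using gV[OF x] by auto
          with Gy have "((\<lambda>y. U x y * ?s + (1 - ?s) * V x y) has_real_derivative ?Gy) (at y)" by simp
          moreover have "((\<lambda>y. U x y * ?s + (1 - ?s) * V x y) has_real_derivative (Uy x y * ?s + Vy x y * (1 - ?s))) (at y)"
            using dU(2)[OF xy(1,2), of y] dV(2)[of x y] by (auto intro!: derivative_eq_intros)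
          ultimately have G2: "?Gy = Uy x y * ?s + Vy x y * (1 - ?s)" by (rule DERIV_unique)
          have "0 \<le> 4 * T * M" using T(2) M(1) by simp
          then have "\<bar>?Gy\<bar> \<le> C" unfolding G2 C_def using small(1)[OF MM(2)] small(2)[OF MM(4)] by linarith
          with A show ?thesis by simp
        qed
        then have "?Gx\<^sup>2 \<le> C\<^sup>2" "?Gy\<^sup>2 \<le> C\<^sup>2" using abs_le_square_iff[of _ C] C by auto
        moreover have "0 \<le> (Vx x y)\<^sup>2" "0 \<le> (Vy x y)\<^sup>2" by simp_all
        ultimately have "?Gx\<^sup>2 + ?Gy\<^sup>2 \<le> (Vx x y)\<^sup>2 + (Vy x y)\<^sup>2 + 2 * C\<^sup>2" by linarith
        then show ?thesis using True by simp
      qed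
      moreover have "z \<in> cbox (0, 0) (2 * d, 2 * pi) \<longleftrightarrow> x \<le> 2 * d" using xy by (auto simp: z)
      ultimately show "ell_jac e z * (norm (grad g (ell e z)))\<^sup>2 \<le> ((Vx (fst z) (snd z))\<^sup>2 + (Vy (fst z) (snd z))\<^sup>2)
         + (if z \<in> cbox (0, 0) (2 * d, 2 * pi) then 2 * C\<^sup>2 else 0)"
        unfolding ell_jac_norm z by simp
    qed
    also have "\<dots> = ?I + 2 * C\<^sup>2 * (2 * d * (2 * pi))"
    proof -
      have s: "cbox (0, 0) (2 * d, 2 * pi) \<subseteq> ?B" using d by (auto simp: cbox_Pair_eq)
      have i1: "(\<lambda>z. (Vx (fst z) (snd z))\<^sup>2 + (Vy (fst z) (snd z))\<^sup>2) integrable_on ?B"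
        by (intro integrable_continuous continuous_intros continuous_on_subset[OF cV(1)] continuous_on_subset[OF cV(2)] subset_UNIV)
      have i2: "(\<lambda>z. if z \<in> cbox (0, 0) (2 * d, 2 * pi) then 2 * C\<^sup>2 else 0) integrable_on ?B"
        using s by (simp add: integrable_restrict_Int Int_absorb1 Int_absorb2 integrable_const)
      have "integral ?B (\<lambda>z. if z \<in> cbox (0, 0) (2 * d, 2 * pi) then 2 * C\<^sup>2 else 0) = integral (cbox (0, 0) (2 * d, 2 * pi)) (\<lambda>z :: real \<times> real. 2 * C\<^sup>2)"
        using s by (simp add: integral_restrict_Int Int_absorb1 Int_absorb2)
      also have "\<dots> = 2 * C\<^sup>2 * (2 * d * (2 * pi))"
        using d by (simp add: content_Pair)
      finally show ?thesis using Henstock_Kurzweil_Integration.integral_add[OF i1 i2] by simp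
    qed
    finally show ?thesis .
  qed
  \<comment> \<open>The segment stays fixed while the gluing layer shrinks, and C does not depend on
    d.\<close>
  have "\<forall>\<^sub>F d in at_right 0. u_capacity \<Omega> (segm e) u \<le> ?I + 2 * C\<^sup>2 * (2 * d * (2 * pi))"
  proof (rule eventually_mono[OF eventually_at_right_real[of 0 "L / 2"]])
    show "0 < L / 2" using L by simp
    show "u_capacity \<Omega> (segm e) u \<le> ?I + 2 * C\<^sup>2 * (2 * d * (2 * pi))" if "d \<in> {0<..<L / 2}" for d
      by (rule main) (use that in auto)
  qed
  moreover have "((\<lambda>d. ?I + 2 * C\<^sup>2 * (2 * d * (2 * pi))) \<longlongrightarrow> ?I + 2 * C\<^sup>2 * (2 * 0 * (2 * pi))) (at_right 0)"
    by (intro tendsto_intros)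
  ultimately have "u_capacity \<Omega> (segm e) u \<le> ?I + 2 * C\<^sup>2 * (2 * 0 * (2 * pi))"
    by (intro tendsto_lowerbound[of _ _ "at_right (0::real)"]) simp_all
  then show ?thesis by simp
qed

section \<open>Functions from which the competitor is built\<close>

lemma smooth_on_real_deriv:
  fixes r :: "real \<Rightarrow> real"
  assumes "open T" "smooth_on T r"
  shows "x \<in> T \<Longrightarrow> (r has_real_derivative deriv r x) (at x)" "smooth_on T (deriv r)"
proof -
  show d: "(r has_real_derivative deriv r x) (at x)" if "x \<in> T" for x
    using smooth_on_imp_differentiable[OF assms(2) that] real_differentiable_def DERIV_imp_deriv by metis
  have "frechet_derivative r (at x) 1 = deriv r x" if "x \<in> T" for x
    using frechet_derivative_at'[OF d[OF that, unfolded has_field_derivative_def]] by simp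
  moreover have "smooth_on T (\<lambda>x. frechet_derivative r (at x) 1)" by (rule smooth_on_frechet[OF assms(2)]) simp
  ultimately show "smooth_on T (deriv r)"
    using smooth_on_cong[OF assms(1), of "\<lambda>x. frechet_derivative r (at x) 1" "deriv r"] by simp
qed

text \<open>Chebyshev polynomials of the first kind. The angle \<eta> is multivalued on the plane,
  whereas cos \<eta> is a smooth function off the segment; writing cos (j \<eta>) as a polynomial in
  cos \<eta> makes every mode smooth there.\<close>

fun cheb :: "nat \<Rightarrow> real \<Rightarrow> real" where
  "cheb 0 x = 1"
| "cheb (Suc 0) x = x"
| "cheb (Suc (Suc n)) x = 2 * x * cheb (Suc n) x - cheb n x"

lemma cheb_cos: "cheb n (cos y) = cos (real n * y)"
proof (induction n "cos y" rule: cheb.induct)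
  case (3 n)
  have "cos (real (Suc n) * y + y) + cos (real (Suc n) * y - y) = 2 * cos y * cos (real (Suc n) * y)"
    by (simp only: cos_add cos_diff) simp
  moreover have "real (Suc n) * y + y = real (Suc (Suc n)) * y" "real (Suc n) * y - y = real n * y"
    by (simp_all add: algebra_simps)
  ultimately show ?case using 3 by simp
qed simp_all

lemma smooth_on_cheb:
  assumes "open S" "smooth_on S f" shows "smooth_on S (\<lambda>x. cheb n (f x))"
proof (induction n rule: cheb.induct[of "\<lambda>n _. smooth_on S (\<lambda>x. cheb n (f x))" n undefined for n, case_names 0 1 step])
  case (step n)
  have "smooth_on S (\<lambda>x. 2 * f x * cheb (Suc n) (f x) - cheb n (f x))"
    by (intro smooth_on_diff smooth_on_mult smooth_on_const assms step)
  then show ?case by simp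
qed (use assms in simp_all)

text \<open>The factor exp d normalizes the value at 0 to 1. It is also the factor by which the
  slope may exceed that of the linear cutoff, so small d recovers the optimal slope 1 / L.\<close>

definition cutoff_fun :: "real \<Rightarrow> real \<Rightarrow> real \<Rightarrow> real" where
  "cutoff_fun d L x = exp d * ((1 - x / L) * flat 0 ((1 - x / L) / d))"

text \<open>A smooth substitute for the piecewise linear cutoff: \<open>t * exp (- d / t)\<close> has derivative
  \<open>(1 + d / t) * exp (- d / t)\<close>, which lies between 0 and 1.\<close>

lemma cutoff_fun:
  assumes d: "d > 0" and L: "L > 0"
  shows "smooth_on UNIV (cutoff_fun d L)" "cutoff_fun d L 0 = 1" "x \<ge> L \<Longrightarrow> cutoff_fun d L x = 0"
    "x \<ge> 0 \<Longrightarrow> \<bar>cutoff_fun d L x\<bar> \<le> 1" "\<bar>deriv (cutoff_fun d L) x\<bar> \<le> exp d / L"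
proof -
  let ?t = "\<lambda>x. 1 - x / L"
  have t: "smooth_on UNIV ?t"
    unfolding divide_inverse by (intro smooth_on_diff smooth_on_mult open_UNIV smooth_on_const smooth_on_ident)
  have f: "smooth_on UNIV (\<lambda>x. flat 0 (?t x / d))"
  proof (rule smooth_on_compose_real[OF smooth_on_flat open_UNIV open_UNIV])
    show "smooth_on UNIV (\<lambda>x. ?t x / d)"
      unfolding divide_inverse[of "?t _"] by (intro smooth_on_mult open_UNIV smooth_on_const t)
  qed simp
  show "smooth_on UNIV (cutoff_fun d L)"
    unfolding cutoff_fun_def[abs_def] by (intro smooth_on_mult open_UNIV smooth_on_const t f)
  show "cutoff_fun d L 0 = 1" using d by (simp add: cutoff_fun_def flat_def exp_minus)
  show "cutoff_fun d L x = 0" if "x \<ge> L" for x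
  proof -
    have "?t x \<le> 0" using that L by (simp add: divide_simps)
    then have "?t x / d \<le> 0" using d by (simp add: divide_le_0_iff)
    then have "flat 0 (?t x / d) = 0" by (simp only: flat_def not_less[symmetric] if_False)
    then show ?thesis by (simp add: cutoff_fun_def)
  qed
  show "\<bar>cutoff_fun d L x\<bar> \<le> 1" if "x \<ge> 0" for x
  proof (cases "?t x > 0")
    case True
    have t1: "?t x \<le> 1" using that L by simp
    have "flat 0 (?t x / d) = exp (- (d / ?t x))" using True d by (simp add: flat_def)
    also have "\<dots> \<le> exp (- d)" using True t1 d by (simp add: pos_le_divide_eq mult_left_le)
    finally have "?t x * flat 0 (?t x / d) \<le> 1 * exp (- d)" using True t1 by (intro mult_mono flat_nonneg) simp_all
    then have "exp d * (?t x * flat 0 (?t x / d)) \<le> exp d * exp (- d)" by simp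
    moreover have "0 \<le> exp d * (?t x * flat 0 (?t x / d))" using True by (intro mult_nonneg_nonneg flat_nonneg) simp_all
    ultimately show ?thesis unfolding cutoff_fun_def by (simp add: exp_minus)
  next
    case False
    then have "\<not> ?t x / d > 0" using d by (simp only: zero_less_divide_iff) simp
    then have "flat 0 (?t x / d) = 0" by (simp only: flat_def if_False)
    then show ?thesis by (simp add: cutoff_fun_def)
  qed
  show "\<bar>deriv (cutoff_fun d L) x\<bar> \<le> exp d / L"
  proof -
    let ?D = "exp d * ((- 1 / L) * flat 0 (?t x / d) + (flat 2 (?t x / d) * ((- 1 / L) / d)) * ?t x)"
    have dt: "(?t has_real_derivative - 1 / L) (at x)" using L by (auto intro!: derivative_eq_intros)
    have df: "((\<lambda>x. flat 0 (?t x / d)) has_real_derivative (flat 2 (?t x / d) * ((- 1 / L) / d))) (at x)"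
      using DERIV_chain2[OF flat_deriv[of 0] DERIV_cdivide[OF dt, of d]] by (simp add: numeral_2_eq_2)
    have "(cutoff_fun d L has_real_derivative ?D) (at x)"
      unfolding cutoff_fun_def[abs_def] by (rule DERIV_cmult[OF DERIV_mult[OF dt df]])
    then have D: "deriv (cutoff_fun d L) x = ?D" by (rule DERIV_imp_deriv)
    show ?thesis
    proof (cases "?t x > 0")
      case True
      define s where "s = ?t x / d"
      have s: "s > 0" using True d by (simp add: s_def)
      have "?D = - (exp d / L) * (exp (- (1 / s)) * (1 + 1 / s))"
      proof -
        have t: "?t x = s * d" using d by (simp add: s_def)
        show ?thesis unfolding s_def[symmetric] t flat_def using s d L
          by (simp add: field_simps power2_eq_square)
      qed
      moreover have "exp (- (1 / s)) * (1 + 1 / s) \<le> 1"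
      proof -
        have "1 + 1 / s \<le> exp (1 / s)" by (rule exp_ge_add_one_self)
        then have "exp (- (1 / s)) * (1 + 1 / s) \<le> exp (- (1 / s)) * exp (1 / s)" by (intro mult_left_mono) simp_all
        then show ?thesis by (simp add: exp_minus)
      qed
      moreover have "0 \<le> exp (- (1 / s)) * (1 + 1 / s)" using s by simp
      ultimately have "\<bar>?D\<bar> = (exp d / L) * (exp (- (1 / s)) * (1 + 1 / s))" using L abs_of_pos[of "1 + 1 / s"] add_pos_pos[OF zero_less_one divide_pos_pos[OF zero_less_one s]] by (simp add: abs_mult)
      also have "\<dots> \<le> (exp d / L) * 1" using L \<open>exp (- (1 / s)) * (1 + 1 / s) \<le> 1\<close> by (intro mult_left_mono) simp_all
      finally show ?thesis unfolding D by simp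
    next
      case False
      then have "\<not> ?t x / d > 0" using d by (simp only: zero_less_divide_iff) simp
      then have "flat 0 (?t x / d) = 0" "flat 2 (?t x / d) = 0" by (simp_all only: flat_def if_False)
      then show ?thesis using L by (simp add: D)
    qed
  qed
qed

section \<open>Energy of the competitor\<close>

lemma cos_sum_bound: "\<bar>cos_sum k a t\<bar> \<le> (\<Sum>j\<le>k. \<bar>a j\<bar>)"
proof -
  have "\<bar>cos_sum k a t\<bar> \<le> (\<Sum>j\<le>k. \<bar>a j * cos (real j * t)\<bar>)" unfolding cos_sum_def by (rule sum_abs)
  also have "\<dots> \<le> (\<Sum>j\<le>k. \<bar>a j\<bar>)" by (intro sum_mono) (simp add: abs_mult mult_left_le)
  finally show ?thesis .
qed

lemma integral_box_const: "L \<ge> 0 \<Longrightarrow> integral (cbox (0, 0) (L, 2 * pi)) (\<lambda>z::real \<times> real. c) = 2 * pi * L * c"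
  by (simp add: content_Pair)

lemma integral_box_exp:
  assumes "L \<ge> 0" shows "integral (cbox (0, 0) (L, 2 * pi)) (\<lambda>z::real \<times> real. exp (- fst z)) \<le> 2 * pi"
proof -
  have c: "continuous_on (cbox (0, 0) (L, 2 * pi)) (\<lambda>z::real \<times> real. exp (- fst z))" by (intro continuous_intros)
  have "((\<lambda>x. exp (- x) * (2 * pi)) has_integral (- exp (- L) * (2 * pi) - (- exp (- 0) * (2 * pi)))) {0..L}"
    by (intro fundamental_theorem_of_calculus assms)
       (auto intro!: derivative_eq_intros simp: has_real_derivative_iff_has_vector_derivative[symmetric])
  then have "integral {0..L} (\<lambda>x. exp (- x) * (2 * pi)) = - exp (- L) * (2 * pi) - (- exp (- 0) * (2 * pi))"
    by (rule integral_unique)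
  moreover have "integral (cbox (0, 0) (L, 2 * pi)) (\<lambda>z::real \<times> real. exp (- fst z)) = integral {0..L} (\<lambda>x. exp (- x) * (2 * pi))"
    using integral_prod_continuous[OF c] by (simp add: mult.commute)
  ultimately show ?thesis by simp
qed

lemma norm_pair_sq: "(norm (a :: real, b :: real))\<^sup>2 = a\<^sup>2 + b\<^sup>2"
  by (simp add: norm_Pair)

text \<open>Here \<open>\<xi>\<close> is the cutoff, as a function of the first coordinate. Young's
  inequality separates the remainder, which thanks to \<open>exp (- x)\<close> costs only a multiple
  of \<open>m\<^sup>2\<close> even on a high strip. In the main part the slope of the cutoff enters
  squared over an area 2 pi L, and once in a cross term; both contributions are of order 1 /
  L.\<close>

lemma strip_energy_bound:
  fixes L \<kappa> t m :: real and b :: "nat \<Rightarrow> real" and k :: nat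
  assumes L: "L > 0" and \<kappa>: "\<kappa> \<ge> 0" and t: "t > 0"
    and \<xi>: "\<And>x. x \<ge> 0 \<Longrightarrow> \<bar>\<xi> x\<bar> \<le> 1" "\<And>x. \<bar>\<xi>' x\<bar> \<le> \<kappa> / L" "continuous_on UNIV \<xi>" "continuous_on UNIV \<xi>'"
    and R: "\<And>y. \<bar>R y\<bar> \<le> m" "\<And>y. \<bar>R' y\<bar> \<le> m" "continuous_on UNIV R" "continuous_on UNIV R'"
  defines "H0 \<equiv> \<lambda>x y. cos_sum k (\<lambda>j. b j * exp (- (real j * x))) y"
    and "H0x \<equiv> \<lambda>x y. cos_sum k (\<lambda>j. - (real j * b j * exp (- (real j * x)))) y"
    and "H0y \<equiv> \<lambda>x y. - (\<Sum>j\<le>k. b j * exp (- (real j * x)) * (real j * sin (real j * y)))"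
  shows "integral (cbox (0, 0) (L, 2 * pi)) (\<lambda>z.
      (\<xi>' (fst z) * (H0 (fst z) (snd z) + exp (- fst z) * R (snd z)) + (H0x (fst z) (snd z) + - exp (- fst z) * R (snd z)) * \<xi> (fst z))\<^sup>2
      + (\<xi> (fst z) * (H0y (fst z) (snd z) + exp (- fst z) * R' (snd z)))\<^sup>2)
    \<le> (1 + t) * (pi * (\<Sum>j=1..k. real j * (b j)\<^sup>2) + 2 * pi * \<kappa>\<^sup>2 * (\<Sum>j\<le>k. \<bar>b j\<bar>)\<^sup>2 / L
          + 4 * pi * \<kappa> * (\<Sum>j\<le>k. \<bar>b j\<bar>) * (\<Sum>j\<le>k. real j * \<bar>b j\<bar>) / L)
      + (1 + 1 / t) * (4 * pi * (\<kappa> / L + 1)\<^sup>2 * m\<^sup>2)"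
proof -
  let ?B = "cbox (0, 0) (L, 2 * pi) :: (real \<times> real) set"
  define D where "D = (\<Sum>j\<le>k. \<bar>b j\<bar>)"
  define D1 where "D1 = (\<Sum>j\<le>k. real j * \<bar>b j\<bar>)"
  have D: "D \<ge> 0" "D1 \<ge> 0" unfolding D_def D1_def by (intro sum_nonneg; simp)+
  have m: "m \<ge> 0" using R(1)[of 0] by linarith
  have H0b: "\<bar>H0 x y\<bar> \<le> D" if "x \<ge> 0" for x y
  proof -
    have "\<bar>H0 x y\<bar> \<le> (\<Sum>j\<le>k. \<bar>b j * exp (- (real j * x))\<bar>)" unfolding H0_def by (rule cos_sum_bound)
    also have "\<dots> \<le> D" unfolding D_def using that by (intro sum_mono) (simp add: abs_mult mult_left_le)
    finally show ?thesis .
  qed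
  \<comment> \<open>The constant mode drops out of the \<xi>-derivative, which therefore decays.
    Without this decay the cross term, integrated over height L, would not be of order 1 /
    L.\<close>
  have H0xb: "\<bar>H0x x y\<bar> \<le> D1 * exp (- x)" if "x \<ge> 0" for x y
  proof -
    have "\<bar>H0x x y\<bar> \<le> (\<Sum>j\<le>k. \<bar>- (real j * b j * exp (- (real j * x)))\<bar>)" unfolding H0x_def by (rule cos_sum_bound)
    also have "\<dots> \<le> (\<Sum>j\<le>k. real j * \<bar>b j\<bar> * exp (- x))"
    proof (intro sum_mono)
      fix j
      show "\<bar>- (real j * b j * exp (- (real j * x)))\<bar> \<le> real j * \<bar>b j\<bar> * exp (- x)"
      proof (cases "j = 0")
        case False
        then have "1 * x \<le> real j * x" using that by (intro mult_right_mono) simp_all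
        then show ?thesis by (simp add: abs_mult mult_left_mono)
      qed simp
    qed
    finally show ?thesis by (simp add: D1_def sum_distrib_right)
  qed
  have cH: "continuous_on UNIV (\<lambda>z. H0 (fst z) (snd z))" "continuous_on UNIV (\<lambda>z. H0x (fst z) (snd z))" "continuous_on UNIV (\<lambda>z. H0y (fst z) (snd z))"
    unfolding H0_def H0x_def H0y_def cos_sum_def by (intro continuous_intros)+
  have cxi: "continuous_on UNIV (\<lambda>z::real \<times> real. \<xi> (fst z))" "continuous_on UNIV (\<lambda>z::real \<times> real. \<xi>' (fst z))"
    by (rule continuous_on_compose2[OF \<xi>(3) continuous_on_fst[OF continuous_on_id]], simp)
       (rule continuous_on_compose2[OF \<xi>(4) continuous_on_fst[OF continuous_on_id]], simp)
  have cR: "continuous_on UNIV (\<lambda>z::real \<times> real. R (snd z))" "continuous_on UNIV (\<lambda>z::real \<times> real. R' (snd z))"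
    by (rule continuous_on_compose2[OF R(3) continuous_on_snd[OF continuous_on_id]], simp)
       (rule continuous_on_compose2[OF R(4) continuous_on_snd[OF continuous_on_id]], simp)
  have int: "f integrable_on ?B" if "continuous_on UNIV f" for f :: "real \<times> real \<Rightarrow> real"
    by (rule integrable_continuous[OF continuous_on_subset[OF that subset_UNIV]])
  let ?h = "\<lambda>z. (H0x (fst z) (snd z))\<^sup>2 + (H0y (fst z) (snd z))\<^sup>2"
  let ?c1 = "(1 + t) * (\<kappa>\<^sup>2 * D\<^sup>2 / L\<^sup>2)" and ?c2 = "(1 + t) * (2 * (\<kappa> / L) * D * D1) + (1 + 1 / t) * (2 * (\<kappa> / L + 1)\<^sup>2 * m\<^sup>2)"
  have "integral ?B (\<lambda>z.
      (\<xi>' (fst z) * (H0 (fst z) (snd z) + exp (- fst z) * R (snd z)) + (H0x (fst z) (snd z) + - exp (- fst z) * R (snd z)) * \<xi> (fst z))\<^sup>2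
      + (\<xi> (fst z) * (H0y (fst z) (snd z) + exp (- fst z) * R' (snd z)))\<^sup>2)
    \<le> integral ?B (\<lambda>z. (?c1 + ?c2 * exp (- fst z)) + (1 + t) * ?h z)"
  proof (rule integral_le)
    show "(\<lambda>z. (\<xi>' (fst z) * (H0 (fst z) (snd z) + exp (- fst z) * R (snd z)) + (H0x (fst z) (snd z) + - exp (- fst z) * R (snd z)) * \<xi> (fst z))\<^sup>2
      + (\<xi> (fst z) * (H0y (fst z) (snd z) + exp (- fst z) * R' (snd z)))\<^sup>2) integrable_on ?B"
      by (rule int) (intro continuous_intros cH cxi cR)
    show "(\<lambda>z. (?c1 + ?c2 * exp (- fst z)) + (1 + t) * ?h z) integrable_on ?B"
      by (rule int) (intro continuous_intros cH)
    fix z assume "z \<in> ?B"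
    then have x: "fst z \<ge> 0" by (cases z) auto
    let ?x = "fst z" and ?y = "snd z"
    \<comment> \<open>The gradients of the two parts of the competitor: \<open>?a\<close> belongs to
      the harmonic extension times the cutoff, \<open>?b\<close> to the extended remainder times the
      cutoff.\<close>
    let ?a = "(\<xi>' ?x * H0 ?x ?y + H0x ?x ?y * \<xi> ?x, \<xi> ?x * H0y ?x ?y)"
    let ?b = "((\<xi>' ?x - \<xi> ?x) * (exp (- ?x) * R ?y), \<xi> ?x * (exp (- ?x) * R' ?y))"
    have E: "(\<xi>' ?x * (H0 ?x ?y + exp (- ?x) * R ?y) + (H0x ?x ?y + - exp (- ?x) * R ?y) * \<xi> ?x)\<^sup>2
      + (\<xi> ?x * (H0y ?x ?y + exp (- ?x) * R' ?y))\<^sup>2 = (norm (?a + ?b))\<^sup>2"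
      unfolding add_Pair norm_pair_sq by (simp add: algebra_simps)
    have chi: "\<bar>\<xi> ?x\<bar> \<le> 1" "\<bar>\<xi>' ?x\<bar> \<le> \<kappa> / L" using \<xi> x by auto
    have kL: "\<kappa> / L \<ge> 0" using \<kappa> L by simp
    have Ea: "(norm ?a)\<^sup>2 \<le> \<kappa>\<^sup>2 * D\<^sup>2 / L\<^sup>2 + 2 * (\<kappa> / L) * D * D1 * exp (- ?x) + ?h z"
    proof -
      have "(norm ?a)\<^sup>2 = (\<xi>' ?x * H0 ?x ?y)\<^sup>2 + 2 * (\<xi>' ?x * H0 ?x ?y * (H0x ?x ?y * \<xi> ?x)) + (\<xi> ?x)\<^sup>2 * ?h z"
        unfolding norm_pair_sq by (simp add: power2_eq_square algebra_simps)
      moreover have "(\<xi>' ?x * H0 ?x ?y)\<^sup>2 \<le> (\<kappa> / L * D)\<^sup>2"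
      proof -
        have "\<bar>\<xi>' ?x * H0 ?x ?y\<bar> \<le> \<kappa> / L * D" unfolding abs_mult using chi(2) H0b[OF x] kL by (intro mult_mono) simp_all
        then have "\<bar>\<xi>' ?x * H0 ?x ?y\<bar>\<^sup>2 \<le> (\<kappa> / L * D)\<^sup>2" by (intro power_mono) simp_all
        then show ?thesis by simp
      qed
      moreover have "\<xi>' ?x * H0 ?x ?y * (H0x ?x ?y * \<xi> ?x) \<le> \<kappa> / L * D * (D1 * exp (- ?x) * 1)"
      proof -
        have "\<bar>\<xi>' ?x * H0 ?x ?y * (H0x ?x ?y * \<xi> ?x)\<bar> \<le> \<kappa> / L * D * (D1 * exp (- ?x) * 1)"
          unfolding abs_mult using chi H0b[OF x] H0xb[OF x] kL D mult_nonneg_nonneg[OF kL D(1)] by (intro mult_mono) simp_all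
        then show ?thesis by linarith
      qed
      moreover have "(\<xi> ?x)\<^sup>2 * ?h z \<le> 1 * ?h z"
      proof (intro mult_right_mono)
        show "(\<xi> ?x)\<^sup>2 \<le> 1" using chi(1) abs_square_le_1 by blast
      qed simp
      ultimately have "(norm ?a)\<^sup>2 \<le> (\<kappa> / L * D)\<^sup>2 + 2 * (\<kappa> / L * D * (D1 * exp (- ?x) * 1)) + 1 * ?h z" by linarith
      also have "\<dots> = \<kappa>\<^sup>2 * D\<^sup>2 / L\<^sup>2 + 2 * (\<kappa> / L) * D * D1 * exp (- ?x) + ?h z"
        by (simp add: power_mult_distrib power_divide)
      finally show ?thesis .
    qed
    have Eb: "(norm ?b)\<^sup>2 \<le> 2 * (\<kappa> / L + 1)\<^sup>2 * m\<^sup>2 * exp (- ?x)"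
    proof -
      have ex: "exp (- ?x) \<le> 1" "0 \<le> exp (- ?x)" using x by simp_all
      have sq: "u\<^sup>2 \<le> (\<kappa> / L + 1)\<^sup>2 * m\<^sup>2 * exp (- ?x)" if "\<bar>u\<bar> \<le> (\<kappa> / L + 1) * (exp (- ?x) * m)" for u
      proof -
        have "\<bar>u\<bar>\<^sup>2 \<le> ((\<kappa> / L + 1) * (exp (- ?x) * m))\<^sup>2" using that by (intro power_mono) simp_all
        also have "\<dots> = (\<kappa> / L + 1)\<^sup>2 * m\<^sup>2 * (exp (- ?x) * exp (- ?x))" by (simp add: power2_eq_square algebra_simps)
        also have "\<dots> \<le> (\<kappa> / L + 1)\<^sup>2 * m\<^sup>2 * (exp (- ?x) * 1)" using ex by (intro mult_left_mono) simp_all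
        finally show ?thesis by simp
      qed
      have "\<bar>(\<xi>' ?x - \<xi> ?x) * (exp (- ?x) * R ?y)\<bar> \<le> (\<kappa> / L + 1) * (exp (- ?x) * m)"
        unfolding abs_mult using chi kL R(1)[of ?y] ex by (intro mult_mono) (simp_all add: abs_le_iff)
      moreover have "\<bar>\<xi> ?x * (exp (- ?x) * R' ?y)\<bar> \<le> (\<kappa> / L + 1) * (exp (- ?x) * m)"
        unfolding abs_mult using chi kL R(2)[of ?y] ex by (intro mult_mono) (simp_all add: abs_le_iff)
      ultimately have "((\<xi>' ?x - \<xi> ?x) * (exp (- ?x) * R ?y))\<^sup>2 + (\<xi> ?x * (exp (- ?x) * R' ?y))\<^sup>2
          \<le> (\<kappa> / L + 1)\<^sup>2 * m\<^sup>2 * exp (- ?x) + (\<kappa> / L + 1)\<^sup>2 * m\<^sup>2 * exp (- ?x)" by (intro add_mono sq)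
      moreover have "(norm ?b)\<^sup>2 = ((\<xi>' ?x - \<xi> ?x) * (exp (- ?x) * R ?y))\<^sup>2 + (\<xi> ?x * (exp (- ?x) * R' ?y))\<^sup>2"
        by (rule norm_pair_sq)
      ultimately show ?thesis by (simp add: mult_ac)
    qed
    have "(norm (?a + ?b))\<^sup>2 \<le> (1 + t) * (norm ?a)\<^sup>2 + (1 + 1 / t) * (norm ?b)\<^sup>2" by (rule norm_sq_add_le[OF t])
    also have "\<dots> \<le> (1 + t) * (\<kappa>\<^sup>2 * D\<^sup>2 / L\<^sup>2 + 2 * (\<kappa> / L) * D * D1 * exp (- ?x) + ?h z) + (1 + 1 / t) * (2 * (\<kappa> / L + 1)\<^sup>2 * m\<^sup>2 * exp (- ?x))"
      using t Ea Eb by (intro add_mono mult_left_mono) simp_all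
    also have "\<dots> = (?c1 + ?c2 * exp (- fst z)) + (1 + t) * ?h z" by (simp add: distrib_left distrib_right mult.assoc)
    finally show "(\<xi>' ?x * (H0 ?x ?y + exp (- ?x) * R ?y) + (H0x ?x ?y + - exp (- ?x) * R ?y) * \<xi> ?x)\<^sup>2
      + (\<xi> ?x * (H0y ?x ?y + exp (- ?x) * R' ?y))\<^sup>2 \<le> (?c1 + ?c2 * exp (- fst z)) + (1 + t) * ?h z"
      unfolding E .
  qed
  also have "integral ?B (\<lambda>z. (?c1 + ?c2 * exp (- fst z)) + (1 + t) * ?h z)
    = (integral ?B (\<lambda>z. ?c1) + ?c2 * integral ?B (\<lambda>z. exp (- fst z))) + (1 + t) * integral ?B ?h"
  proof -
    have i: "(\<lambda>z. ?c1) integrable_on ?B" "(\<lambda>z. ?c2 * exp (- fst z)) integrable_on ?B" "(\<lambda>z. (1 + t) * ?h z) integrable_on ?B"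
      "(\<lambda>z. ?c1 + ?c2 * exp (- fst z)) integrable_on ?B"
      by (rule int, intro continuous_intros cH)+
    show ?thesis
      by (simp only: Henstock_Kurzweil_Integration.integral_add[OF i(4,3)] Henstock_Kurzweil_Integration.integral_add[OF i(1,2)]
          Henstock_Kurzweil_Integration.integral_mult_right)
  qed
  also have "integral ?B (\<lambda>z. ?c1) = (1 + t) * (2 * pi * \<kappa>\<^sup>2 * D\<^sup>2 / L)"
    using L by (subst integral_box_const) (simp_all add: power2_eq_square)
  also have "?c2 * integral ?B (\<lambda>z. exp (- fst z)) \<le> ?c2 * (2 * pi)"
    using L \<kappa> t D by (intro mult_left_mono integral_box_exp) simp_all
  also have "(1 + t) * integral ?B ?h \<le> (1 + t) * (pi * (\<Sum>j=1..k. real j * (b j)\<^sup>2))"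
  proof (rule mult_left_mono)
    have "integral ?B ?h = (2 * pi * (b 0 * exp (- (real 0 * L)) * - (real 0 * b 0 * exp (- (real 0 * L))))
        + pi * (\<Sum>j=1..k. b j * exp (- (real j * L)) * - (real j * b j * exp (- (real j * L)))))
      - (2 * pi * (b 0 * exp (- (real 0 * 0)) * - (real 0 * b 0 * exp (- (real 0 * 0))))
        + pi * (\<Sum>j=1..k. b j * exp (- (real j * 0)) * - (real j * b j * exp (- (real j * 0)))))"
      unfolding H0x_def H0y_def
      by (rule harmonic_energy) (use L in \<open>auto intro!: derivative_eq_intros simp: power2_eq_square\<close>)
    also have "\<dots> = pi * (\<Sum>j=1..k. b j * exp (- (real j * L)) * - (real j * b j * exp (- (real j * L)))) + pi * (\<Sum>j=1..k. real j * (b j)\<^sup>2)"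
      by (simp add: sum_negf power2_eq_square mult_ac)
    also have "(\<Sum>j=1..k. b j * exp (- (real j * L)) * - (real j * b j * exp (- (real j * L)))) \<le> 0"
    proof (rule sum_nonpos)
      fix j
      have "b j * exp (- (real j * L)) * - (real j * b j * exp (- (real j * L))) = - (real j * (b j * exp (- (real j * L)))\<^sup>2)"
        by (simp add: power2_eq_square)
      also have "\<dots> \<le> 0" by simp
      finally show "b j * exp (- (real j * L)) * - (real j * b j * exp (- (real j * L))) \<le> 0" .
    qed
    finally show "integral ?B ?h \<le> pi * (\<Sum>j=1..k. real j * (b j)\<^sup>2)" by simp
  qed (use t in simp)
  also have "(1 + t) * (2 * pi * \<kappa>\<^sup>2 * D\<^sup>2 / L) + ?c2 * (2 * pi) + (1 + t) * (pi * (\<Sum>j=1..k. real j * (b j)\<^sup>2))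
    = (1 + t) * (pi * (\<Sum>j=1..k. real j * (b j)\<^sup>2) + 2 * pi * \<kappa>\<^sup>2 * D\<^sup>2 / L + 4 * pi * \<kappa> * D * D1 / L)
      + (1 + 1 / t) * (4 * pi * (\<kappa> / L + 1)\<^sup>2 * m\<^sup>2)"
    by (simp add: algebra_simps)
  finally show ?thesis unfolding D_def[symmetric] D1_def[symmetric] by simp
qed

text \<open>The competitor is the harmonic extension of the cosine part plus
  \<open>exp (- x)\<close> times the remainder, cut off at height L. The second summand need not be
  harmonic; it only has to take the right boundary values with energy of order
  \<open>m\<^sup>2\<close>. The bound on \<open>deriv r\<close> carries a factor e because the chain
  rule for \<open>r (e * cos y)\<close> produces one.\<close>

lemma u_capacity_upper:
  fixes e L \<kappa> t m :: real and b :: "nat \<Rightarrow> real" and r :: "real \<Rightarrow> real"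
  assumes \<Omega>: "open \<Omega>" and u: "smooth_on \<Omega> u" "u \<in> H10 \<Omega>" and e: "e > 0" and L: "L > 0"
    and sub: "cball 0 (e * cosh L) \<subseteq> \<Omega>" and \<kappa>: "\<kappa> > 1" and t: "t > 0"
    and T: "open T" "{- e..e} \<subseteq> T" "smooth_on T r"
    and r: "\<And>x. x \<in> {- e..e} \<Longrightarrow> \<bar>r x\<bar> \<le> m" "\<And>x. x \<in> {- e..e} \<Longrightarrow> \<bar>deriv r x\<bar> * e \<le> m"
    and eq: "\<And>y. cos_sum k b y + r (e * cos y) = u (e * cos y, 0)"
  shows "u_capacity \<Omega> (segm e) u \<le> (1 + t) * (pi * (\<Sum>j=1..k. real j * (b j)\<^sup>2) + 2 * pi * \<kappa>\<^sup>2 * (\<Sum>j\<le>k. \<bar>b j\<bar>)\<^sup>2 / L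
          + 4 * pi * \<kappa> * (\<Sum>j\<le>k. \<bar>b j\<bar>) * (\<Sum>j\<le>k. real j * \<bar>b j\<bar>) / L)
      + (1 + 1 / t) * (4 * pi * (\<kappa> / L + 1)\<^sup>2 * m\<^sup>2)"
proof -
  \<comment> \<open>With this d the slope bound of the cutoff is \<kappa> / L, so \<kappa> > 1
    measures the loss against the linear cutoff.\<close>
  define d where "d = ln \<kappa>"
  have d: "d > 0" "exp d = \<kappa>" using \<kappa> by (simp_all add: d_def)
  let ?c = "cutoff_fun d L"
  note cut = cutoff_fun[OF d(1) L]
  note cut' = smooth_on_real_deriv[OF open_UNIV cut(1)]
  define H0 where "H0 x y = cos_sum k (\<lambda>j. b j * exp (- (real j * x))) y" for x y
  define H0x where "H0x x y = cos_sum k (\<lambda>j. - (real j * b j * exp (- (real j * x)))) y" for x y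
  define H0y where "H0y x y = - (\<Sum>j\<le>k. b j * exp (- (real j * x)) * (real j * sin (real j * y)))" for x y
  define R where "R y = r (e * cos y)" for y
  define R' where "R' y = deriv r (e * cos y) * (- (e * sin y))" for y
  define V where "V x y = ?c x * (H0 x y + exp (- x) * R y)" for x y
  define Vx where "Vx x y = deriv ?c x * (H0 x y + exp (- x) * R y) + (H0x x y + - exp (- x) * R y) * ?c x" for x y
  define Vy where "Vy x y = ?c x * (H0y x y + exp (- x) * R' y)" for x y
  have ecos: "e * cos y \<in> {- e..e}" for y
  proof -
    have "\<bar>e * cos y\<bar> \<le> e" using e by (simp add: abs_mult mult_le_cancel_left1)
    then show ?thesis by (simp add: abs_le_iff)
  qed
  have eT: "e * cos y \<in> T" for y using ecos T(2) by blast
  have dR: "(R has_real_derivative R' y) (at y)" for y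
    unfolding R_def[abs_def] R'_def
    by (rule DERIV_chain2[where f = r and g = "\<lambda>y. e * cos y", OF smooth_on_real_deriv(1)[OF T(1,3) eT]]) (auto intro!: derivative_eq_intros)
  have cR: "continuous_on UNIV R" "continuous_on UNIV R'"
    unfolding R_def[abs_def] R'_def[abs_def]
    by (intro continuous_intros continuous_on_compose2[OF smooth_on_imp_continuous[OF T(3)]]
       continuous_on_compose2[OF smooth_on_imp_continuous[OF smooth_on_real_deriv(2)[OF T(1,3)]]]; use eT in auto)+
  have Rm: "\<bar>R y\<bar> \<le> m" "\<bar>R' y\<bar> \<le> m" for y
  proof -
    show "\<bar>R y\<bar> \<le> m" unfolding R_def by (rule r(1)[OF ecos])
    have "\<bar>R' y\<bar> = \<bar>deriv r (e * cos y)\<bar> * e * \<bar>sin y\<bar>" using e by (simp add: R'_def abs_mult)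
    also have "\<dots> \<le> \<bar>deriv r (e * cos y)\<bar> * e * 1" using e by (intro mult_left_mono) simp_all
    also have "\<dots> \<le> m" using r(2)[OF ecos] by simp
    finally show "\<bar>R' y\<bar> \<le> m" .
  qed
  have dH: "((\<lambda>x. H0 x y) has_real_derivative H0x x y) (at x)" "((\<lambda>y. H0 x y) has_real_derivative H0y x y) (at y)" for x y
  proof -
    show "((\<lambda>x. H0 x y) has_real_derivative H0x x y) (at x)"
      unfolding H0_def H0x_def cos_sum_def
      by (intro DERIV_sum DERIV_cmult_right) (auto intro!: derivative_eq_intros)
    show "((\<lambda>y. H0 x y) has_real_derivative H0y x y) (at y)"
      unfolding H0_def H0y_def by (rule cos_sum_deriv)
  qed
  have dE: "((\<lambda>x. exp (- x) * R y) has_real_derivative - exp (- x) * R y) (at x)" for x y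
    by (auto intro!: derivative_eq_intros)
  have dV: "((\<lambda>x. V x y) has_real_derivative Vx x y) (at x)" "((\<lambda>y. V x y) has_real_derivative Vy x y) (at y)" for x y
  proof -
    show "((\<lambda>x. V x y) has_real_derivative Vx x y) (at x)"
      unfolding V_def Vx_def by (intro DERIV_mult DERIV_add dH dE cut') simp
    show "((\<lambda>y. V x y) has_real_derivative Vy x y) (at y)"
      unfolding V_def Vy_def by (intro DERIV_cmult DERIV_add dH dR)
  qed
  have cc: "continuous_on UNIV ?c" "continuous_on UNIV (deriv ?c)"
    by (rule smooth_on_imp_continuous[OF cut(1)], rule smooth_on_imp_continuous[OF cut'(2)])
  have ccz: "continuous_on UNIV (\<lambda>z::real \<times> real. ?c (fst z))" "continuous_on UNIV (\<lambda>z::real \<times> real. deriv ?c (fst z))"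
    "continuous_on UNIV (\<lambda>z::real \<times> real. R (snd z))" "continuous_on UNIV (\<lambda>z::real \<times> real. R' (snd z))"
    by (rule continuous_on_compose2[OF cc(1) continuous_on_fst[OF continuous_on_id]], simp)
       (rule continuous_on_compose2[OF cc(2) continuous_on_fst[OF continuous_on_id]], simp,
        rule continuous_on_compose2[OF cR(1) continuous_on_snd[OF continuous_on_id]], simp,
        rule continuous_on_compose2[OF cR(2) continuous_on_snd[OF continuous_on_id]], simp)
  have cH: "continuous_on UNIV (\<lambda>z. H0 (fst z) (snd z))" "continuous_on UNIV (\<lambda>z. H0x (fst z) (snd z))" "continuous_on UNIV (\<lambda>z. H0y (fst z) (snd z))"
    unfolding H0_def H0x_def H0y_def cos_sum_def by (intro continuous_intros)+
  have cV: "continuous_on UNIV (\<lambda>z. Vx (fst z) (snd z))" "continuous_on UNIV (\<lambda>z. Vy (fst z) (snd z))"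
    unfolding Vx_def Vy_def by (intro continuous_intros cH ccz)+
  \<comment> \<open>This is cos \<eta> as a function on the plane; \<open>e * N z\<close> stays in
    the domain T of r.\<close>
  define N where "N z = fst z / (e * foci_sum e z)" for z
  define v where "v z = ?c (ell_fst e z) * ((\<Sum>j\<le>k. b j * exp (- (real j * ell_fst e z)) * cheb j (N z)) + exp (- ell_fst e z) * r (e * N z))" for z
  have N: "N (ell e (x, y)) = cos y" for x y
    using e cosh_real_pos[of x] by (simp add: N_def foci_sum_ell) (simp add: ell_def)
  have Nz: "e * N z \<in> T" for z
  proof -
    obtain x y where "z = ell e (x, y)" by (rule ell_surj[OF e, of z])
    then show ?thesis using N eT by simp
  qed
  let ?S = "- segm e"
  note oS = open_compl_segm[of e]
  note sX = smooth_ell_fst[OF e]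
  have sN: "smooth_on ?S N"
    unfolding N_def[abs_def]
  proof (rule smooth_on_divide[OF oS smooth_on_fst])
    show "smooth_on ?S (\<lambda>z. e * foci_sum e z)" by (intro smooth_on_mult oS smooth_on_const smooth_foci_sum[OF e])
    show "e * foci_sum e z \<noteq> 0" for z using e foci_sum_ge_1[OF e, of z] by simp
  qed
  have sexp: "smooth_on ?S (\<lambda>z. exp (- (c * ell_fst e z)))" for c
    by (rule smooth_on_compose_real[OF smooth_on_exp open_UNIV oS smooth_on_uminus[OF oS smooth_on_mult[OF oS smooth_on_const sX]]]) simp
  have sexp1: "smooth_on ?S (\<lambda>z. exp (- ell_fst e z))" using sexp[of 1] by simp
  have sr: "smooth_on ?S (\<lambda>z. r (e * N z))"
    by (rule smooth_on_compose_real[OF T(3,1) oS smooth_on_mult[OF oS smooth_on_const sN] Nz])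
  have sc: "smooth_on ?S (\<lambda>z. ?c (ell_fst e z))"
    by (rule smooth_on_compose_real[OF cut(1) open_UNIV oS sX]) simp
  have sv: "smooth_on ?S v"
    unfolding v_def[abs_def]
    by (intro smooth_on_mult[OF oS sc] smooth_on_add[OF oS] smooth_on_sum[OF oS] smooth_on_mult[OF oS] smooth_on_const
        smooth_on_cheb[OF oS sN] sexp sexp1 sr)
  have "u_capacity \<Omega> (segm e) u \<le> integral (cbox (0, 0) (L, 2 * pi)) (\<lambda>z. (Vx (fst z) (snd z))\<^sup>2 + (Vy (fst z) (snd z))\<^sup>2)"
  proof (rule u_capacity_le_strip[OF \<Omega> u e L sub sv _ _ _ dV cV])
    show "v z = 0" if "ell_fst e z \<ge> L" for z using cut(3)[OF that] by (simp add: v_def)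
    show "v (ell e (x, y)) = V x y" if "x > 0" for x y
      using that by (simp add: v_def V_def H0_def R_def cos_sum_def N ell_fst_ell[OF e] cheb_cos)
    show "V 0 y = u (e * cos y, 0)" for y
      using eq[of y] cut(2) by (simp add: V_def H0_def R_def)
  qed
  also have "\<dots> \<le> (1 + t) * (pi * (\<Sum>j=1..k. real j * (b j)\<^sup>2) + 2 * pi * \<kappa>\<^sup>2 * (\<Sum>j\<le>k. \<bar>b j\<bar>)\<^sup>2 / L
          + 4 * pi * \<kappa> * (\<Sum>j\<le>k. \<bar>b j\<bar>) * (\<Sum>j\<le>k. real j * \<bar>b j\<bar>) / L)
      + (1 + 1 / t) * (4 * pi * (\<kappa> / L + 1)\<^sup>2 * m\<^sup>2)"
    unfolding Vx_def Vy_def H0_def H0x_def H0y_def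
    by (rule strip_energy_bound[OF L _ t cut(4) _ cc Rm cR]) (use \<kappa> cut(5) d(2) in simp_all)
  finally show ?thesis .
qed

section \<open>Taylor expansion along the axis\<close>

lemma taylor_remainder_bound:
  fixes r :: "real \<Rightarrow> real"
  assumes T: "open T" "{- d..d} \<subseteq> T" "smooth_on T r" and d: "d > 0"
  obtains B where "B \<ge> 0" "\<And>x. x \<in> {- d..d} \<Longrightarrow> \<bar>r x - (\<Sum>m<n. (deriv ^^ m) r 0 / fact m * x ^ m)\<bar> \<le> B * \<bar>x\<bar> ^ n"
proof -
  have sm: "smooth_on T ((deriv ^^ m) r)" for m
    by (induction m) (use T smooth_on_real_deriv(2)[OF T(1)] in simp_all)
  have D: "((deriv ^^ m) r has_real_derivative (deriv ^^ Suc m) r x) (at x)" if "x \<in> T" for m x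
    using smooth_on_real_deriv(1)[OF T(1) sm that] by simp
  have "compact ((deriv ^^ n) r ` {- d..d})"
    by (rule compact_continuous_image[OF continuous_on_subset[OF smooth_on_imp_continuous[OF sm] T(2)]]) simp
  then have "bounded ((deriv ^^ n) r ` {- d..d})" by (rule compact_imp_bounded)
  then obtain B where B: "B > 0" "\<And>x. x \<in> {- d..d} \<Longrightarrow> \<bar>(deriv ^^ n) r x\<bar> \<le> B" by (auto simp: bounded_pos)
  have "\<bar>r x - (\<Sum>m<n. (deriv ^^ m) r 0 / fact m * x ^ m)\<bar> \<le> B / fact n * \<bar>x\<bar> ^ n" if x: "x \<in> {- d..d}" for x
  proof -
    have "\<forall>m t. m < n \<and> \<bar>t\<bar> \<le> \<bar>x\<bar> \<longrightarrow> ((deriv ^^ m) r has_real_derivative (deriv ^^ Suc m) r t) (at t)"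
    proof (intro allI impI D)
      fix m and t :: real assume "m < n \<and> \<bar>t\<bar> \<le> \<bar>x\<bar>"
      then have "t \<in> {- d..d}" using x by auto
      then show "t \<in> T" using T(2) by blast
    qed
    then obtain t where t: "\<bar>t\<bar> \<le> \<bar>x\<bar>" "r x = (\<Sum>m<n. (deriv ^^ m) r 0 / fact m * x ^ m) + (deriv ^^ n) r t / fact n * x ^ n"
      using Maclaurin_bi_le[of "\<lambda>m. (deriv ^^ m) r" r n x] by auto
    have "t \<in> {- d..d}" using t(1) x by auto
    then have "\<bar>(deriv ^^ n) r t\<bar> / fact n * \<bar>x\<bar> ^ n \<le> B / fact n * \<bar>x\<bar> ^ n"
      using B(2) by (intro mult_right_mono divide_right_mono) simp_all
    then show ?thesis using t(2) by (simp add: abs_mult power_abs)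
  qed
  then show ?thesis using B(1) by (intro that[of "B / fact n"]) auto
qed

text \<open>A nonzero Taylor coefficient of order at most k would, at the first such order,
  contradict the limit. The limit is one-sided, but the coefficients are those of a smooth function
  at 0, so the resulting bounds hold on both halves of the segment.\<close>

lemma vanishing_order:
  fixes r :: "real \<Rightarrow> real"
  assumes T: "open T" "{- d..d} \<subseteq> T" "smooth_on T r" and d: "d > 0"
    and lim: "((\<lambda>x. r x / x ^ k) \<longlongrightarrow> 0) (at_right 0)"
  obtains M where "M \<ge> 0" "\<And>x. x \<in> {- d..d} \<Longrightarrow> \<bar>r x\<bar> \<le> M * \<bar>x\<bar> ^ (k + 1)"
    "\<And>x. x \<in> {- d..d} \<Longrightarrow> \<bar>deriv r x\<bar> \<le> M * \<bar>x\<bar> ^ k"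
proof -
  have z: "(deriv ^^ m) r 0 = 0" if "m \<le> k" for m
    using that
  proof (induction m rule: less_induct)
    case (less m)
    obtain B where B: "B \<ge> 0" "\<And>x. x \<in> {- d..d} \<Longrightarrow> \<bar>r x - (\<Sum>i<Suc m. (deriv ^^ i) r 0 / fact i * x ^ i)\<bar> \<le> B * \<bar>x\<bar> ^ Suc m"
      by (rule taylor_remainder_bound[OF T d]) blast
    let ?c = "(deriv ^^ m) r 0 / fact m"
    have "(\<Sum>i<m. (deriv ^^ i) r 0 / fact i * x ^ i) = 0" for x
      using less by (intro sum.neutral) auto
    then have bd: "\<bar>r x - ?c * x ^ m\<bar> \<le> B * \<bar>x\<bar> ^ Suc m" if "x \<in> {- d..d}" for x
      using B(2)[OF that] by simp
    have "((\<lambda>x. r x / x ^ m - ?c) \<longlongrightarrow> 0) (at_right 0)"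
    proof (rule Lim_null_comparison)
      show "((\<lambda>x. B * \<bar>x\<bar>) \<longlongrightarrow> 0) (at_right 0)" by (auto intro!: tendsto_eq_intros)
      show "\<forall>\<^sub>F x in at_right 0. norm (r x / x ^ m - ?c) \<le> B * \<bar>x\<bar>"
      proof (rule eventually_mono[OF eventually_at_right_real[OF d]])
        fix x assume x: "x \<in> {0<..<d}"
        have "r x / x ^ m - ?c = (r x - ?c * x ^ m) / x ^ m" using x by (simp add: diff_divide_distrib)
        then have "norm (r x / x ^ m - ?c) = \<bar>r x - ?c * x ^ m\<bar> / x ^ m" using x by simp
        also have "\<dots> \<le> (B * \<bar>x\<bar> ^ Suc m) / x ^ m" using bd[of x] x by (intro divide_right_mono) auto
        also have "\<dots> = B * \<bar>x\<bar>" using x by simp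
        finally show "norm (r x / x ^ m - ?c) \<le> B * \<bar>x\<bar>" .
      qed
    qed
    then have 1: "((\<lambda>x. r x / x ^ m) \<longlongrightarrow> ?c) (at_right 0)" by (simp add: Lim_null[symmetric])
    have "((\<lambda>x. r x / x ^ k * x ^ (k - m)) \<longlongrightarrow> 0 * 0 ^ (k - m)) (at_right 0)"
      by (intro tendsto_mult lim tendsto_power tendsto_ident_at)
    moreover have "\<forall>\<^sub>F x in at_right 0. r x / x ^ k * x ^ (k - m) = r x / x ^ m"
    proof (rule eventually_mono[OF eventually_at_right_real[OF d]])
      fix x assume x: "x \<in> {0<..<d}"
      have "x ^ k = x ^ m * x ^ (k - m)" using less(2) by (simp add: power_add[symmetric])
      then show "r x / x ^ k * x ^ (k - m) = r x / x ^ m" using x by simp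
    qed
    ultimately have "((\<lambda>x. r x / x ^ m) \<longlongrightarrow> 0) (at_right 0)"
      using Lim_transform_eventually by fastforce
    then have "?c = 0" using tendsto_unique[OF _ 1] by simp
    then show ?case by simp
  qed
  obtain B where B: "B \<ge> 0" "\<And>x. x \<in> {- d..d} \<Longrightarrow> \<bar>r x - (\<Sum>i<k + 1. (deriv ^^ i) r 0 / fact i * x ^ i)\<bar> \<le> B * \<bar>x\<bar> ^ (k + 1)"
    by (rule taylor_remainder_bound[OF T d]) blast
  obtain B' where B': "B' \<ge> 0" "\<And>x. x \<in> {- d..d} \<Longrightarrow> \<bar>deriv r x - (\<Sum>i<k. (deriv ^^ i) (deriv r) 0 / fact i * x ^ i)\<bar> \<le> B' * \<bar>x\<bar> ^ k"
    by (rule taylor_remainder_bound[OF T(1,2) smooth_on_real_deriv(2)[OF T(1,3)] d]) blast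
  have s1: "(\<Sum>i<k + 1. (deriv ^^ i) r 0 / fact i * x ^ i) = 0" for x using z by (intro sum.neutral) auto
  \<comment> \<open>The Taylor coefficients of the derivative are derivatives of r of one order
    higher; vanishing up to order k for r covers exactly the indices i < k here.\<close>
  have s2: "(\<Sum>i<k. (deriv ^^ i) (deriv r) 0 / fact i * x ^ i) = 0" for x
    using z[of "Suc i" for i] by (intro sum.neutral) (auto simp: funpow_swap1[symmetric])
  show ?thesis
  proof (rule that[of "max B B'"])
    show "0 \<le> max B B'" using B(1) by simp
    fix x assume x: "x \<in> {- d..d}"
    have "\<bar>r x\<bar> \<le> B * \<bar>x\<bar> ^ (k + 1)" using B(2)[OF x] unfolding s1 by simp
    also have "\<dots> \<le> max B B' * \<bar>x\<bar> ^ (k + 1)" by (intro mult_right_mono) simp_all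
    finally show "\<bar>r x\<bar> \<le> max B B' * \<bar>x\<bar> ^ (k + 1)" .
    have "\<bar>deriv r x\<bar> \<le> B' * \<bar>x\<bar> ^ k" using B'(2)[OF x] unfolding s2 by simp
    also have "\<dots> \<le> max B B' * \<bar>x\<bar> ^ k" by (intro mult_right_mono) simp_all
    finally show "\<bar>deriv r x\<bar> \<le> max B B' * \<bar>x\<bar> ^ k" .
  qed
qed

section \<open>The cosine coefficients of a power of the cosine\<close>

lemma cos_power_expansion:
  obtains a where "\<And>y. cos y ^ k = cos_sum k a y" "a k > 0"
proof -
  have "\<exists>a. (\<forall>y. cos y ^ k = cos_sum k a y) \<and> a k > 0"
  proof (induction k)
    case 0
    show ?case by (rule exI[of _ "\<lambda>_. 1"]) (simp add: cos_sum_def)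
  next
    case (Suc k)
    then obtain a where a: "\<And>y. cos y ^ k = cos_sum k a y" "a k > 0" by blast
    \<comment> \<open>\<open>w j i\<close> is the coefficient of cos (i y) in cos y * cos (j y),
      from the product formula; for j = 0 the two halves coincide and add up to 1.\<close>
    define w :: "nat \<Rightarrow> nat \<Rightarrow> real" where "w j i = (if j = 0 then (if i = 1 then 1 else 0)
        else (if i = j + 1 then 1 / 2 else 0) + (if i = j - 1 then 1 / 2 else 0))" for j i
    have w: "(\<Sum>i\<le>Suc k. w j i * cos (real i * y)) = cos y * cos (real j * y)" if j: "j \<le> k" for j y
    proof (cases "j = 0")
      case True
      have "(\<Sum>i\<le>Suc k. w j i * cos (real i * y)) = (\<Sum>i\<le>Suc k. if i = 1 then cos (real i * y) else 0)"
        by (intro sum.cong refl) (simp add: w_def True)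
      also have "\<dots> = cos y" by simp
      finally show ?thesis by (simp add: True)
    next
      case False
      have "(\<Sum>i\<le>Suc k. w j i * cos (real i * y))
         = (\<Sum>i\<le>Suc k. if i = j + 1 then cos (real i * y) / 2 else 0) + (\<Sum>i\<le>Suc k. if i = j - 1 then cos (real i * y) / 2 else 0)"
        unfolding sum.distrib[symmetric] by (intro sum.cong refl) (simp add: w_def False algebra_simps)
      also have "\<dots> = cos (real (j + 1) * y) / 2 + cos (real (j - 1) * y) / 2" using j False by auto
      also have "\<dots> = cos y * cos (real j * y)"
      proof -
        have "real (j + 1) * y = real j * y + y" "real (j - 1) * y = real j * y - y"
          using False by (simp_all add: algebra_simps of_nat_diff)
        then show ?thesis by (simp only: cos_add cos_diff) (simp add: field_simps)
      qed
      finally show ?thesis .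
    qed
    define a' where "a' i = (\<Sum>j\<le>k. a j * w j i)" for i
    have "cos y ^ Suc k = cos_sum (Suc k) a' y" for y
    proof -
      have "cos y ^ Suc k = (\<Sum>j\<le>k. a j * (cos y * cos (real j * y)))"
        by (simp add: a(1) cos_sum_def sum_distrib_left mult_ac)
      also have "\<dots> = (\<Sum>j\<le>k. a j * (\<Sum>i\<le>Suc k. w j i * cos (real i * y)))"
        by (intro sum.cong refl) (simp only: w atMost_iff)
      also have "\<dots> = (\<Sum>j\<le>k. \<Sum>i\<le>Suc k. a j * w j i * cos (real i * y))"
        by (simp only: sum_distrib_left mult.assoc)
      also have "\<dots> = (\<Sum>i\<le>Suc k. \<Sum>j\<le>k. a j * w j i * cos (real i * y))" by (rule sum.swap)
      also have "\<dots> = cos_sum (Suc k) a' y" by (simp only: cos_sum_def a'_def sum_distrib_right)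
      finally show ?thesis .
    qed
    \<comment> \<open>Only the mode j = k reaches k + 1. The sign of the top coefficient is carried
      through the induction since it yields the positivity of \<open>C_const k\<close>.\<close>
    moreover have "a' (Suc k) > 0"
    proof -
      have "a' (Suc k) = (\<Sum>j\<le>k. if j = k then a k * w k (Suc k) else 0)"
        unfolding a'_def by (intro sum.cong refl) (auto simp: w_def)
      also have "\<dots> = a k * w k (Suc k)" by simp
      finally show ?thesis using a(2) by (auto simp: w_def)
    qed
    ultimately show ?case by blast
  qed
  then show ?thesis using that by blast
qed

text \<open>Orthogonality with cos (j t). The index 0 has to be excluded: the squared norm of the
  constant mode is 2 pi, so \<open>A_coeff 0 k\<close> is twice the constant coefficient.\<close>

lemma A_coeff_eq:
  assumes a: "\<And>y. cos y ^ k = cos_sum k a y" and j: "j \<in> {1..k}"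
  shows "A_coeff j k = a j"
proof -
  have "((\<lambda>t. cos_sum k a t * cos_sum k (\<lambda>i. if i = j then 1 else 0) t) has_integral
     (2 * pi * (a 0 * (if 0 = j then 1 else 0)) + pi * (\<Sum>i=1..k. a i * (if i = j then 1 else 0)))) {0..2 * pi}"
    by (rule has_integral_cos_sum_mult)
  moreover have "(\<Sum>i=1..k. a i * (if i = j then 1 else 0)) = (\<Sum>i=1..k. if i = j then a i else 0)"
    by (intro sum.cong refl) simp
  moreover have "cos_sum k (\<lambda>i. if i = j then 1 else 0) t = cos (real j * t)" for t
  proof -
    have "cos_sum k (\<lambda>i. if i = j then 1 else 0) t = (\<Sum>i\<le>k. if i = j then cos (real i * t) else 0)"
      unfolding cos_sum_def by (intro sum.cong refl) simp
    then show ?thesis using j by simp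
  qed
  ultimately have "((\<lambda>t. cos t ^ k * cos (real j * t)) has_integral (pi * a j)) {0..2 * pi}"
    using j by (simp add: a)
  then show ?thesis unfolding A_coeff_def by (simp add: integral_unique)
qed

lemma C_const_eq:
  assumes a: "\<And>y. cos y ^ k = cos_sum k a y"
  shows "C_const k = (\<Sum>j=1..k. real j * (a j)\<^sup>2)"
  unfolding C_const_def by (intro sum.cong refl) (simp add: A_coeff_eq[OF a])

lemma C_const_pos:
  assumes "k \<ge> 1" shows "C_const k > 0"
proof -
  obtain a where a: "\<And>y. cos y ^ k = cos_sum k a y" "a k > 0" by (rule cos_power_expansion[of k]) blast
  have "0 < real k * (a k)\<^sup>2" using a(2) assms by simp
  also have "\<dots> \<le> (\<Sum>j=1..k. real j * (a j)\<^sup>2)" using assms by (intro member_le_sum) auto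
  finally show ?thesis using C_const_eq[OF a(1)] by simp
qed

subsection \<open>Asymptotics\<close>

lemma C1_holder_diff:
  assumes a: "a < b" and w: "w \<in> C1_holder \<tau> {a..b}" and v: "v \<in> C1_holder \<tau> {a..b}"
  shows "(\<lambda>t. w t - v t) \<in> C1_holder \<tau> {a..b}"
proof -
  let ?I = "{a..b}"
  let ?d = "\<lambda>w t. vector_derivative w (at t within ?I)"
  have dw: "w differentiable (at t within ?I)" and dv: "v differentiable (at t within ?I)" if "t \<in> ?I" for t
    using w v that by (auto simp: C1_holder_def)
  obtain C1 where C1: "\<And>s t. s \<in> ?I \<Longrightarrow> t \<in> ?I \<Longrightarrow> \<bar>?d w s - ?d w t\<bar> \<le> C1 * \<bar>s - t\<bar> powr \<tau>" using w unfolding C1_holder_def by blast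
  obtain C2 where C2: "\<And>s t. s \<in> ?I \<Longrightarrow> t \<in> ?I \<Longrightarrow> \<bar>?d v s - ?d v t\<bar> \<le> C2 * \<bar>s - t\<bar> powr \<tau>" using v unfolding C1_holder_def by blast
  have d: "?d (\<lambda>t. w t - v t) t = ?d w t - ?d v t" if "t \<in> ?I" for t
    using dw[OF that] dv[OF that]
    by (intro vector_derivative_within_closed_interval[OF a that] has_vector_derivative_diff)
       (simp_all add: vector_derivative_works)
  have "\<bar>?d (\<lambda>t. w t - v t) s - ?d (\<lambda>t. w t - v t) t\<bar> \<le> (C1 + C2) * \<bar>s - t\<bar> powr \<tau>" if st: "s \<in> ?I" "t \<in> ?I" for s t
  proof -
    have "\<bar>?d (\<lambda>t. w t - v t) s - ?d (\<lambda>t. w t - v t) t\<bar> \<le> \<bar>?d w s - ?d w t\<bar> + \<bar>?d v s - ?d v t\<bar>"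
      unfolding d[OF st(1)] d[OF st(2)] by linarith
    also have "\<dots> \<le> C1 * \<bar>s - t\<bar> powr \<tau> + C2 * \<bar>s - t\<bar> powr \<tau>" by (intro add_mono C1 C2 st)
    finally show ?thesis by (simp add: distrib_right)
  qed
  moreover have "(\<lambda>t. w t - v t) differentiable (at t within ?I)" if "t \<in> ?I" for t
    by (intro differentiable_diff dw dv that)
  ultimately show ?thesis unfolding C1_holder_def by blast
qed

text \<open>All three suprema in the norm are over nonempty bounded sets, hence nonnegative.\<close>

lemma C1_holder_norm_ge:
  assumes a: "a < b" and \<tau>: "\<tau> > 0" and w: "w \<in> C1_holder \<tau> {a..b}" and t: "t \<in> {a..b}"
  shows "\<bar>w t\<bar> \<le> C1_holder_norm \<tau> {a..b} w"
proof -
  let ?I = "{a..b}"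
  let ?d = "\<lambda>t. vector_derivative w (at t within ?I)"
  have dw: "w differentiable (at t within ?I)" if "t \<in> ?I" for t using w that by (auto simp: C1_holder_def)
  obtain C where C: "\<And>s t. s \<in> ?I \<Longrightarrow> t \<in> ?I \<Longrightarrow> \<bar>?d s - ?d t\<bar> \<le> C * \<bar>s - t\<bar> powr \<tau>" using w unfolding C1_holder_def by blast
  have "continuous_on ?I w"
    unfolding continuous_on_eq_continuous_within using dw differentiable_imp_continuous_within by blast
  then have "bounded (w ` ?I)" by (intro compact_imp_bounded compact_continuous_image) simp_all
  then obtain B where "\<forall>x\<in>w ` ?I. norm x \<le> B" unfolding bounded_iff by blast
  then have B: "\<bar>w t\<bar> \<le> B" if "t \<in> ?I" for t using that by simp
  have "bdd_above ((\<lambda>t. \<bar>w t\<bar>) ` ?I)" using B by (intro bdd_aboveI2)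
  then have 1: "\<bar>w t\<bar> \<le> (SUP t\<in>?I. \<bar>w t\<bar>)" using t by (rule cSUP_upper[rotated])
  have "\<bar>?d s\<bar> \<le> \<bar>?d t\<bar> + \<bar>C\<bar> * (b - a) powr \<tau>" if s: "s \<in> ?I" for s
  proof -
    have "\<bar>?d s\<bar> \<le> \<bar>?d t\<bar> + C * \<bar>s - t\<bar> powr \<tau>" using C[OF s t] by linarith
    also have "C * \<bar>s - t\<bar> powr \<tau> \<le> \<bar>C\<bar> * (b - a) powr \<tau>"
      using s t \<tau> by (intro mult_mono powr_mono2) auto
    finally show ?thesis by simp
  qed
  then have "bdd_above ((\<lambda>t. \<bar>?d t\<bar>) ` ?I)" by (intro bdd_aboveI2)
  then have "\<bar>?d t\<bar> \<le> (SUP t\<in>?I. \<bar>?d t\<bar>)" using t by (rule cSUP_upper[rotated])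
  then have 2: "0 \<le> (SUP t\<in>?I. \<bar>?d t\<bar>)" by linarith
  let ?S = "{(s, t). s \<in> ?I \<and> t \<in> ?I \<and> s \<noteq> t}"
  let ?q = "\<lambda>(s, t). \<bar>?d s - ?d t\<bar> / \<bar>s - t\<bar> powr \<tau>"
  have "?q p \<le> C" if "p \<in> ?S" for p
    using that C by (auto simp: divide_le_eq)
  then have "bdd_above (?q ` ?S)" by (intro bdd_aboveI2)
  moreover have "(a, b) \<in> ?S" using a by auto
  ultimately have "?q (a, b) \<le> (SUP p\<in>?S. ?q p)" by (rule cSUP_upper[rotated])
  moreover have "0 \<le> ?q (a, b)" by simp
  ultimately have 3: "0 \<le> (SUP p\<in>?S. ?q p)" by linarith
  show ?thesis unfolding C1_holder_norm_def using 1 2 3 by linarith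
qed

text \<open>The difference lies in the Hoelder space, so the suprema in its norm are taken over
  bounded sets and the norm dominates each value. At the angle t = 0 this gives the limit of u along
  the positive half-axis.\<close>

lemma tendsto_C1_holder_pointwise:
  assumes "a < b" "\<tau> > 0" "tendsto_C1_holder \<tau> {a..b} w v F" "t \<in> {a..b}"
  shows "((\<lambda>r. w r t) \<longlongrightarrow> v t) F"
proof -
  have v: "v \<in> C1_holder \<tau> {a..b}" and w: "\<forall>\<^sub>F r in F. w r \<in> C1_holder \<tau> {a..b}"
    and n: "((\<lambda>r. C1_holder_norm \<tau> {a..b} (\<lambda>t. w r t - v t)) \<longlongrightarrow> 0) F"
    using assms(3) by (simp_all add: tendsto_C1_holder_def)
  have "\<forall>\<^sub>F r in F. norm (w r t - v t) \<le> C1_holder_norm \<tau> {a..b} (\<lambda>t. w r t - v t)"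
    using w
  proof eventually_elim
    fix r assume "w r \<in> C1_holder \<tau> {a..b}"
    from C1_holder_norm_ge[OF assms(1,2) C1_holder_diff[OF assms(1) this v] assms(4)]
    show "norm (w r t - v t) \<le> C1_holder_norm \<tau> {a..b} (\<lambda>t. w r t - v t)" by simp
  qed
  then have "((\<lambda>r. w r t - v t) \<longlongrightarrow> 0) F" by (rule Lim_null_comparison[OF _ n])
  then show ?thesis by (simp add: Lim_null[symmetric])
qed

section \<open>Two-sided bounds for a fixed small segment\<close>

lemma norm_ell_ge:
  assumes "e > 0" "x \<ge> 0" shows "e * sinh x \<le> norm (ell e (x, y))"
proof -
  have "(e * sinh x)\<^sup>2 = e\<^sup>2 * ((sinh x)\<^sup>2 * (cos y)\<^sup>2 + (sinh x)\<^sup>2 * (sin y)\<^sup>2)"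
    by (simp add: distrib_left[symmetric] power_mult_distrib)
  also have "\<dots> \<le> e\<^sup>2 * ((cosh x)\<^sup>2 * (cos y)\<^sup>2 + (sinh x)\<^sup>2 * (sin y)\<^sup>2)"
    using hyperbolic_pythagoras[of x] by (intro mult_left_mono add_right_mono mult_right_mono) simp_all
  also have "\<dots> = (e * cosh x * cos y)\<^sup>2 + (e * sinh x * sin y)\<^sup>2"
    by (simp add: power2_eq_square algebra_simps)
  also have "\<dots> = (norm (ell e (x, y)))\<^sup>2" by (simp add: ell_def norm_Pair)
  finally show ?thesis by (rule power2_le_imp_le) simp
qed

text \<open>\<rho> is the radius of a disc inside \<Omega> and R that of one containing it. The
  confocal ellipse of height arcosh (\<rho> / e) fits into the small disc, and points of height at
  least arsinh (R / e) lie outside the large one. M controls the Taylor remainder on the axis. The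
  parameters \<kappa>, t and s stay free, to be chosen according to k and c.\<close>

lemma capacity_bounds:
  fixes u :: "real \<times> real \<Rightarrow> real" and a :: "nat \<Rightarrow> real" and k :: nat and c :: real
  assumes \<Omega>: "open \<Omega>" "bounded \<Omega>" "(0, 0) \<in> \<Omega>" and u: "smooth_on \<Omega> u" "u \<in> H10 \<Omega>"
    and lim: "((\<lambda>x. u (x, 0) / x ^ k) \<longlongrightarrow> c) (at_right 0)" and a: "\<And>y. cos y ^ k = cos_sum k a y"
  obtains \<rho> R M where "\<rho> > 0" "R > 0" "M \<ge> 0"
    "\<And>e \<kappa> t. 0 < e \<Longrightarrow> e < \<rho> \<Longrightarrow> \<kappa> > 1 \<Longrightarrow> t > 0 \<Longrightarrow> u_capacity \<Omega> (segm e) u \<le>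
        (1 + t) * (c\<^sup>2 * e ^ (2 * k) * (pi * C_const k + 2 * pi * \<kappa>\<^sup>2 * (\<Sum>j\<le>k. \<bar>a j\<bar>)\<^sup>2 / arcosh (\<rho> / e)
          + 4 * pi * \<kappa> * (\<Sum>j\<le>k. \<bar>a j\<bar>) * (\<Sum>j\<le>k. real j * \<bar>a j\<bar>) / arcosh (\<rho> / e)))
        + (1 + 1 / t) * (4 * pi * (\<kappa> / arcosh (\<rho> / e) + 1)\<^sup>2 * (M * e ^ (k + 1))\<^sup>2)"
    "\<And>e s. 0 < e \<Longrightarrow> e < \<rho> \<Longrightarrow>
        2 * (2 * pi * (c * e ^ k * a 0 * s) + pi * (c\<^sup>2 * e ^ (2 * k) * C_const k))
        - 4 * pi * (M * e ^ (k + 1) * (\<bar>s\<bar> + \<bar>c\<bar> * e ^ k * (\<Sum>j\<le>k. real j * \<bar>a j\<bar>)))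
        - (2 * pi * s\<^sup>2 * arsinh (R / e) + pi * (c\<^sup>2 * e ^ (2 * k) * C_const k)) \<le> u_capacity \<Omega> (segm e) u"
    "\<And>e. 0 < e \<Longrightarrow> e < \<rho> \<Longrightarrow> 0 \<le> u_capacity \<Omega> (segm e) u"
proof -
  obtain \<rho> where \<rho>: "\<rho> > 0" "cball 0 \<rho> \<subseteq> \<Omega>"
    using open_contains_cball[THEN iffD1, OF \<Omega>(1)] \<Omega>(3) by (auto simp: zero_prod_def)
  obtain R where R: "R > 0" "\<And>z. z \<in> \<Omega> \<Longrightarrow> norm z < R"
    using \<Omega>(2) unfolding bounded_pos_less by blast
  define T where "T = {x. (x, 0::real) \<in> \<Omega>}"
  define r where "r x = u (x, 0) - c * x ^ k" for x
  have "open ((\<lambda>x. (x, 0::real)) -` \<Omega>)" by (intro open_vimage \<Omega>(1) continuous_intros)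
  then have oT: "open T" by (simp add: T_def vimage_def)
  have dT: "{- \<rho>..\<rho>} \<subseteq> T"
  proof
    fix x assume "x \<in> {- \<rho>..\<rho>}"
    then have "(x, 0::real) \<in> cball 0 \<rho>" by (auto simp: norm_Pair)
    then show "x \<in> T" using \<rho>(2) by (auto simp: T_def)
  qed
  have sT: "smooth_on T r"
  proof -
    have "smooth_on T (\<lambda>x. u (x, 0))"
      by (rule smooth_on_compose_pair[OF u(1) \<Omega>(1) oT smooth_on_ident smooth_on_const]) (simp add: T_def)
    then show ?thesis
      unfolding r_def[abs_def] by (intro smooth_on_diff[OF oT] smooth_on_mult[OF oT] smooth_on_const smooth_on_power[OF oT] smooth_on_ident)
  qed
  have rlim: "((\<lambda>x. r x / x ^ k) \<longlongrightarrow> 0) (at_right 0)"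
  proof (rule Lim_transform_eventually)
    show "((\<lambda>x. u (x, 0) / x ^ k - c) \<longlongrightarrow> 0) (at_right 0)" using lim by (simp add: Lim_null[symmetric])
    show "\<forall>\<^sub>F x in at_right 0. u (x, 0) / x ^ k - c = r x / x ^ k"
      by (rule eventually_mono[OF eventually_at_right_real[OF \<rho>(1)]]) (auto simp: r_def diff_divide_distrib)
  qed
  obtain M where M: "M \<ge> 0" "\<And>x. x \<in> {- \<rho>..\<rho>} \<Longrightarrow> \<bar>r x\<bar> \<le> M * \<bar>x\<bar> ^ (k + 1)" "\<And>x. x \<in> {- \<rho>..\<rho>} \<Longrightarrow> \<bar>deriv r x\<bar> \<le> M * \<bar>x\<bar> ^ k"
    by (rule vanishing_order[OF oT dT sT \<rho>(1) rlim]) blast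
  have rb: "\<bar>r x\<bar> \<le> M * e ^ (k + 1)" "\<bar>deriv r x\<bar> * e \<le> M * e ^ (k + 1)" if "0 < e" "e < \<rho>" "x \<in> {- e..e}" for e x
  proof -
    have x: "x \<in> {- \<rho>..\<rho>}" "\<bar>x\<bar> \<le> e" using that by auto
    have "\<bar>r x\<bar> \<le> M * \<bar>x\<bar> ^ (k + 1)" by (rule M(2)[OF x(1)])
    also have "\<dots> \<le> M * e ^ (k + 1)" using x(2) M(1) by (intro mult_left_mono power_mono) simp_all
    finally show "\<bar>r x\<bar> \<le> M * e ^ (k + 1)" .
    have "\<bar>deriv r x\<bar> * e \<le> (M * \<bar>x\<bar> ^ k) * e" using M(3)[OF x(1)] that(1) by (intro mult_right_mono) simp_all
    also have "\<dots> \<le> (M * e ^ k) * e" using x(2) M(1) that(1) by (intro mult_right_mono mult_left_mono power_mono) simp_all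
    finally show "\<bar>deriv r x\<bar> * e \<le> M * e ^ (k + 1)" by (simp add: mult.assoc mult.commute[of e])
  qed
  have ecos: "e * cos y \<in> {- e..e}" if "e > 0" for e y :: real
  proof -
    have "\<bar>e * cos y\<bar> \<le> e" using that by (simp add: abs_mult mult_le_cancel_left1)
    then show ?thesis by (simp add: abs_le_iff)
  qed
  \<comment> \<open>On the segment x = e cos y, so the leading monomial \<open>c * x ^ k\<close>
    becomes the cosine sum with coefficients \<open>c * e ^ k * a j\<close>.\<close>
  have ur: "cos_sum k (\<lambda>j. c * e ^ k * a j) y + r (e * cos y) = u (e * cos y, 0)" for e y
  proof -
    have "cos_sum k (\<lambda>j. c * e ^ k * a j) y = c * e ^ k * cos_sum k a y"
      by (simp add: cos_sum_def sum_distrib_left mult.assoc)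
    then show ?thesis by (simp add: r_def a[symmetric] power_mult_distrib)
  qed
  have S: "(\<Sum>j=1..k. real j * (c * e ^ k * a j)\<^sup>2) = c\<^sup>2 * e ^ (2 * k) * C_const k" for e
    unfolding C_const_eq[OF a] sum_distrib_left
    by (intro sum.cong refl) (simp add: power_mult_distrib power_mult[symmetric] mult.commute[of 2])
  define D where "D = (\<Sum>j\<le>k. \<bar>a j\<bar>)"
  define D1 where "D1 = (\<Sum>j\<le>k. real j * \<bar>a j\<bar>)"
  have up: "u_capacity \<Omega> (segm e) u \<le>
        (1 + t) * (c\<^sup>2 * e ^ (2 * k) * (pi * C_const k + 2 * pi * \<kappa>\<^sup>2 * D\<^sup>2 / arcosh (\<rho> / e) + 4 * pi * \<kappa> * D * D1 / arcosh (\<rho> / e)))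
        + (1 + 1 / t) * (4 * pi * (\<kappa> / arcosh (\<rho> / e) + 1)\<^sup>2 * (M * e ^ (k + 1))\<^sup>2)"
    if e: "0 < e" "e < \<rho>" and \<kappa>: "\<kappa> > 1" and t: "t > 0" for e \<kappa> t
  proof -
    let ?L = "arcosh (\<rho> / e)" and ?b = "\<lambda>j. c * e ^ k * a j"
    have q: "\<rho> / e > 1" using e by simp
    then have cL: "cosh ?L = \<rho> / e" by (simp add: cosh_arcosh_real)
    have L0: "?L \<ge> 0" using q by (simp add: arcosh_nonneg_real)
    moreover have "?L \<noteq> 0" using cL q by auto
    ultimately have L: "?L > 0" by simp
    have D': "(\<Sum>j\<le>k. \<bar>?b j\<bar>) = \<bar>c\<bar> * e ^ k * D" "(\<Sum>j\<le>k. real j * \<bar>?b j\<bar>) = \<bar>c\<bar> * e ^ k * D1"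
      unfolding D_def D1_def sum_distrib_left using e by (auto intro!: sum.cong simp: abs_mult)
    have "u_capacity \<Omega> (segm e) u \<le> (1 + t) * (pi * (\<Sum>j=1..k. real j * (?b j)\<^sup>2) + 2 * pi * \<kappa>\<^sup>2 * (\<Sum>j\<le>k. \<bar>?b j\<bar>)\<^sup>2 / ?L
          + 4 * pi * \<kappa> * (\<Sum>j\<le>k. \<bar>?b j\<bar>) * (\<Sum>j\<le>k. real j * \<bar>?b j\<bar>) / ?L)
      + (1 + 1 / t) * (4 * pi * (\<kappa> / ?L + 1)\<^sup>2 * (M * e ^ (k + 1))\<^sup>2)"
    proof (rule u_capacity_upper[OF \<Omega>(1) u e(1) L _ \<kappa> t oT _ sT rb(1)[OF e] rb(2)[OF e] ur])
      show "cball 0 (e * cosh ?L) \<subseteq> \<Omega>" using \<rho>(2) e by (simp add: cL)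
      show "{- e..e} \<subseteq> T" using dT e by auto
    qed
    also have "pi * (\<Sum>j=1..k. real j * (?b j)\<^sup>2) + 2 * pi * \<kappa>\<^sup>2 * (\<Sum>j\<le>k. \<bar>?b j\<bar>)\<^sup>2 / ?L
          + 4 * pi * \<kappa> * (\<Sum>j\<le>k. \<bar>?b j\<bar>) * (\<Sum>j\<le>k. real j * \<bar>?b j\<bar>) / ?L
        = c\<^sup>2 * e ^ (2 * k) * (pi * C_const k + 2 * pi * \<kappa>\<^sup>2 * D\<^sup>2 / ?L + 4 * pi * \<kappa> * D * D1 / ?L)"
    proof -
      have "(e ^ k)\<^sup>2 = e ^ (2 * k)" "\<bar>c\<bar>\<^sup>2 = c\<^sup>2" by (simp_all add: power_mult[symmetric] mult.commute[of 2])
      moreover have "4 * pi * \<kappa> * (\<bar>c\<bar> * e ^ k * D) * (\<bar>c\<bar> * e ^ k * D1) = 4 * pi * \<kappa> * D * D1 * (\<bar>c\<bar>\<^sup>2 * (e ^ k)\<^sup>2)"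
        by (simp add: power2_eq_square)
      moreover have "2 * pi * \<kappa>\<^sup>2 * (\<bar>c\<bar> * e ^ k * D)\<^sup>2 = 2 * pi * \<kappa>\<^sup>2 * D\<^sup>2 * (\<bar>c\<bar>\<^sup>2 * (e ^ k)\<^sup>2)"
        by (simp only: power_mult_distrib mult_ac)
      ultimately show ?thesis unfolding S D' by (simp only: distrib_left times_divide_eq_right mult_ac)
    qed
    finally show ?thesis .
  qed
  have cutoff: "u_capacity \<Omega> (segm e) u \<ge> B" if e: "0 < e" "e < \<rho>"
    and B: "\<And>g. g \<in> test_functions \<Omega> \<Longrightarrow> (\<And>x. x \<in> segm e \<Longrightarrow> g x = u x) \<Longrightarrow> B \<le> (LINT x|lebesgue_on \<Omega>. (norm (grad g x))\<^sup>2)" for e B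
  proof -
    \<comment> \<open>Half the available height, so that the support of the cutoff, \<xi> \<le> 2 d,
      just fits into the disc of radius \<rho>.\<close>
    define d where "d = arcosh (\<rho> / e) / 2"
    have q: "\<rho> / e > 1" using e by simp
    then have cL: "cosh (2 * d) = \<rho> / e" by (simp add: d_def cosh_arcosh_real)
    have "d \<ge> 0" using q by (simp add: d_def arcosh_nonneg_real)
    moreover have "d \<noteq> 0" using cL q by auto
    ultimately have d: "d > 0" by simp
    have tt: "ell_cut e d \<in> test_functions \<Omega>"
      by (rule ell_cut_test[OF e(1) d]) (use cL e \<rho>(2) in simp)
    have oW: "open {z. ell_fst e z < d}" using open_ell_fst_less(1)[OF e(1), of d] d by simp
    have KW: "segm e \<subseteq> {z. ell_fst e z < d}" using segm_ell_fst[OF e(1)] d by auto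
    show ?thesis
      by (rule u_capacity_ge[OF \<Omega>(1) closed_segm negligible_segm u tt _ _ oW KW _ B])
         (use ell_cut_1[OF d] in \<open>auto simp: ell_cut_def smooth_step_nonneg smooth_step_le_1\<close>)
  qed
  have lo: "2 * (2 * pi * (c * e ^ k * a 0 * s) + pi * (c\<^sup>2 * e ^ (2 * k) * C_const k))
        - 4 * pi * (M * e ^ (k + 1) * (\<bar>s\<bar> + \<bar>c\<bar> * e ^ k * D1))
        - (2 * pi * s\<^sup>2 * arsinh (R / e) + pi * (c\<^sup>2 * e ^ (2 * k) * C_const k)) \<le> u_capacity \<Omega> (segm e) u"
    if e: "0 < e" "e < \<rho>" for e s
  proof (rule cutoff[OF e])
    fix g assume g: "g \<in> test_functions \<Omega>" and gu: "\<And>x. x \<in> segm e \<Longrightarrow> g x = u x"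
    obtain K where K: "K \<subseteq> \<Omega>" "\<And>x. x \<notin> K \<Longrightarrow> g x = 0" "\<And>x. x \<notin> K \<Longrightarrow> grad g x = 0"
      by (rule test_functionsE[OF g]) blast
    let ?L = "arsinh (R / e)"
    have sL: "sinh ?L = R / e" by (simp add: sinh_arsinh_real)
    have "sinh 0 \<le> sinh ?L" using R(1) e by (simp only: sL) simp
    then have L: "?L \<ge> 0" by (simp only: sinh_real_le_iff)
    \<comment> \<open>Points of height at least \<open>?L\<close> have norm at least R, hence lie
      outside \<Omega>, where g and its gradient vanish.\<close>
    have out: "ell e (x, y) \<notin> K" if "x \<ge> ?L" for x y
    proof -
      have "R = e * sinh ?L" using sL e by simp
      also have "\<dots> \<le> e * sinh x"
        by (rule mult_left_mono) (use that e in \<open>simp_all only: sinh_real_le_iff less_imp_le\<close>)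
      also have "\<dots> \<le> norm (ell e (x, y))" using L that by (intro norm_ell_ge e) simp
      finally have "\<not> norm (ell e (x, y)) < R" by simp
      then show ?thesis using R(2) K(1) by blast
    qed
    \<comment> \<open>The weights are the coefficients of the boundary values themselves, which
      makes the inequality sharp for the modes j \<ge> 1: the same sum enters twice through the
      pairing and is subtracted once as energy.\<close>
    let ?l = "\<lambda>j. c * e ^ k * a j" and ?q = "\<lambda>j. if j = 0 then s else real j * (c * e ^ k * a j)"
    have E: "2 * integral {0..2 * pi} (\<lambda>t. g (e * cos t, 0) * cos_sum k ?q t)
      - (2 * pi * s\<^sup>2 * ?L + pi * (\<Sum>j=1..k. real j * (?l j)\<^sup>2)) \<le> (LINT x|lebesgue_on \<Omega>. (norm (grad g x))\<^sup>2)"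
      by (rule energy_lower[OF e(1) \<Omega>(1) g L]) (use out K in auto)
    have ge: "g (e * cos y, 0) = cos_sum k ?l y + r (e * cos y)" for y
    proof -
      have "(e * cos y, 0) \<in> segm e" using ecos[OF e(1), of y] by (simp add: segm_def)
      then show ?thesis using gu ur[of e y] by simp
    qed
    have i1: "((\<lambda>t. cos_sum k ?l t * cos_sum k ?q t) has_integral
        (2 * pi * (?l 0 * ?q 0) + pi * (\<Sum>j=1..k. ?l j * ?q j))) {0..2 * pi}" by (rule has_integral_cos_sum_mult)
    have sq: "(\<Sum>j=1..k. ?l j * ?q j) = c\<^sup>2 * e ^ (2 * k) * C_const k"
      unfolding S[symmetric] by (intro sum.cong refl) (simp add: power2_eq_square)
    have crc: "continuous_on UNIV (\<lambda>t. r (e * cos t))"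
    proof (rule continuous_on_compose2[OF smooth_on_imp_continuous[OF sT]])
      show "continuous_on UNIV (\<lambda>t. e * cos t)" by (intro continuous_intros)
      have "e * cos t \<in> T" for t
      proof -
        have "- e \<le> e * cos t \<and> e * cos t \<le> e" using ecos[OF e(1), of t] by (simp only: atLeastAtMost_iff)
        then have "- \<rho> \<le> e * cos t" "e * cos t \<le> \<rho>" using e by linarith+
        then show ?thesis using dT by (simp add: subset_iff)
      qed
      then show "range (\<lambda>t. e * cos t) \<subseteq> T" by blast
    qed
    have ccs: "continuous_on UNIV (cos_sum k ?q)" unfolding cos_sum_def[abs_def] by (intro continuous_intros)
    have i2: "(\<lambda>t. r (e * cos t) * cos_sum k ?q t) integrable_on {0..2 * pi}"
      by (rule integrable_continuous_real[OF continuous_on_subset[OF continuous_on_mult[OF crc ccs] subset_UNIV]])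
    have qb: "\<bar>cos_sum k ?q t\<bar> \<le> \<bar>s\<bar> + \<bar>c\<bar> * e ^ k * D1" for t
    proof -
      have "\<bar>cos_sum k ?q t\<bar> \<le> (\<Sum>j\<le>k. \<bar>?q j\<bar>)" by (rule cos_sum_bound)
      also have "\<dots> = (\<Sum>j\<le>k. (if j = 0 then \<bar>s\<bar> else 0) + \<bar>c\<bar> * e ^ k * (real j * \<bar>a j\<bar>))"
        using e by (intro sum.cong refl) (simp add: abs_mult)
      also have "\<dots> = \<bar>s\<bar> + \<bar>c\<bar> * e ^ k * D1" by (simp add: sum.distrib D1_def sum_distrib_left)
      finally show ?thesis .
    qed
    have "norm (integral {0..2 * pi} (\<lambda>t. r (e * cos t) * cos_sum k ?q t))
      \<le> integral {0..2 * pi} (\<lambda>t. M * e ^ (k + 1) * (\<bar>s\<bar> + \<bar>c\<bar> * e ^ k * D1))"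
    proof (rule integral_norm_bound_integral[OF i2])
      show "(\<lambda>t. M * e ^ (k + 1) * (\<bar>s\<bar> + \<bar>c\<bar> * e ^ k * D1)) integrable_on {0..2 * pi}" by (rule integrable_const_ivl)
      show "norm (r (e * cos t) * cos_sum k ?q t) \<le> M * e ^ (k + 1) * (\<bar>s\<bar> + \<bar>c\<bar> * e ^ k * D1)" for t
        unfolding real_norm_def abs_mult using rb(1)[OF e ecos[OF e(1)], of t] qb[of t] M(1) e by (intro mult_mono) simp_all
    qed
    then have I2: "\<bar>integral {0..2 * pi} (\<lambda>t. r (e * cos t) * cos_sum k ?q t)\<bar> \<le> 2 * pi * (M * e ^ (k + 1) * (\<bar>s\<bar> + \<bar>c\<bar> * e ^ k * D1))"
      by (simp add: mult_ac)
    have "integral {0..2 * pi} (\<lambda>t. g (e * cos t, 0) * cos_sum k ?q t)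
        = integral {0..2 * pi} (\<lambda>t. cos_sum k ?l t * cos_sum k ?q t) + integral {0..2 * pi} (\<lambda>t. r (e * cos t) * cos_sum k ?q t)"
      unfolding ge distrib_right
      by (rule Henstock_Kurzweil_Integration.integral_add[OF has_integral_integrable[OF i1] i2])
    also have "integral {0..2 * pi} (\<lambda>t. cos_sum k ?l t * cos_sum k ?q t) = 2 * pi * (?l 0 * s) + pi * (c\<^sup>2 * e ^ (2 * k) * C_const k)"
      using integral_unique[OF i1] unfolding sq by simp
    finally have I: "integral {0..2 * pi} (\<lambda>t. g (e * cos t, 0) * cos_sum k ?q t) = (2 * pi * (?l 0 * s) + pi * (c\<^sup>2 * e ^ (2 * k) * C_const k))
        + integral {0..2 * pi} (\<lambda>t. r (e * cos t) * cos_sum k ?q t)" .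
    have comb: "2 * P - 4 * pi * Z - X \<le> Y" if "G = P + J" "2 * G - X \<le> Y" "\<bar>J\<bar> \<le> 2 * pi * Z" for G P J X Y Z :: real
      using that by linarith
    show "2 * (2 * pi * (c * e ^ k * a 0 * s) + pi * (c\<^sup>2 * e ^ (2 * k) * C_const k))
        - 4 * pi * (M * e ^ (k + 1) * (\<bar>s\<bar> + \<bar>c\<bar> * e ^ k * D1))
        - (2 * pi * s\<^sup>2 * arsinh (R / e) + pi * (c\<^sup>2 * e ^ (2 * k) * C_const k)) \<le> (LINT x|lebesgue_on \<Omega>. (norm (grad g x))\<^sup>2)"
      by (rule comb[OF I E[unfolded S] I2])
  qed
  have nn: "0 \<le> u_capacity \<Omega> (segm e) u" if "0 < e" "e < \<rho>" for e
    by (rule cutoff[OF that]) (rule integral_nonneg_AE, simp)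
  show ?thesis
    by (rule that[OF \<rho>(1) R(1) M(1) up[unfolded D_def D1_def] lo[unfolded D1_def] nn])
qed


section \<open>Letting the segment shrink\<close>

lemma
  assumes "\<rho> > 0"
  shows arcosh_at_top: "filterlim (\<lambda>e. arcosh (\<rho> / e)) at_top (at_right (0::real))"
    and arcosh_asymp: "((\<lambda>e. \<bar>ln e\<bar> / arcosh (\<rho> / e)) \<longlongrightarrow> 1) (at_right 0)"
    and arsinh_asymp: "((\<lambda>e. \<bar>ln e\<bar> / arsinh (\<rho> / e)) \<longlongrightarrow> 1) (at_right 0)"
proof -
  \<comment> \<open>The logarithmic formula for arcosh requires \<rho> / e \<ge> 1, so it is
    available only for small e; the one for arsinh holds throughout.\<close>
  have ev: "\<forall>\<^sub>F e in at_right 0. arcosh (\<rho> / e) = ln (\<rho> / e + sqrt ((\<rho> / e)\<^sup>2 - 1))"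
    by (rule eventually_mono[OF eventually_at_right_real[OF assms]]) (auto intro!: arcosh_real_def)
  have as: "arsinh (\<rho> / e) = ln (\<rho> / e + sqrt ((\<rho> / e)\<^sup>2 + 1))" for e :: real by (rule arsinh_real_def)
  have "filterlim (\<lambda>e. ln (\<rho> / e + sqrt ((\<rho> / e)\<^sup>2 - 1))) at_top (at_right (0::real))"
    using assms by real_asymp
  then show "filterlim (\<lambda>e. arcosh (\<rho> / e)) at_top (at_right (0::real))"
    by (subst filterlim_cong[OF refl refl ev])
  have "((\<lambda>e. \<bar>ln e\<bar> / ln (\<rho> / e + sqrt ((\<rho> / e)\<^sup>2 - 1))) \<longlongrightarrow> 1) (at_right 0)"
    using assms by real_asymp
  moreover have "\<forall>\<^sub>F e in at_right 0. \<bar>ln e\<bar> / ln (\<rho> / e + sqrt ((\<rho> / e)\<^sup>2 - 1)) = \<bar>ln e\<bar> / arcosh (\<rho> / e)"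
    using ev by eventually_elim simp
  ultimately show "((\<lambda>e. \<bar>ln e\<bar> / arcosh (\<rho> / e)) \<longlongrightarrow> 1) (at_right 0)" by (rule Lim_transform_eventually)
  show "((\<lambda>e. \<bar>ln e\<bar> / arsinh (\<rho> / e)) \<longlongrightarrow> 1) (at_right 0)"
    unfolding as using assms by real_asymp
qed

text \<open>Each upper bound converges only to h t, but h t tends to A. Fixing t, passing to the
  limit along F and shrinking t afterwards replaces a choice of t depending on the small
  parameter.\<close>

lemma tendsto_sandwich_param:
  fixes f l :: "'a \<Rightarrow> real"
  assumes l: "(l \<longlongrightarrow> A) F" "\<forall>\<^sub>F x in F. l x \<le> f x"
    and U: "\<And>t. t > 0 \<Longrightarrow> (U t \<longlongrightarrow> h t) F" "\<And>t. t > 0 \<Longrightarrow> \<forall>\<^sub>F x in F. f x \<le> U t x"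
    and h: "(h \<longlongrightarrow> A) (at_right (0::real))"
  shows "(f \<longlongrightarrow> A) F"
proof (rule order_tendstoI)
  fix a assume "a < A"
  then have "\<forall>\<^sub>F x in F. a < l x" using order_tendstoD(1)[OF l(1)] by blast
  with l(2) show "\<forall>\<^sub>F x in F. a < f x" by eventually_elim simp
next
  fix a assume "a > A"
  then have "\<forall>\<^sub>F t in at_right 0. h t < a" using order_tendstoD(2)[OF h] by blast
  moreover have "\<forall>\<^sub>F t in at_right (0::real). t > 0" by (simp add: eventually_at_filter)
  ultimately have "\<forall>\<^sub>F t in at_right 0. h t < a \<and> t > 0" by (rule eventually_conj)
  then obtain t where t: "h t < a" "t > 0" using eventually_happens'[of "at_right (0::real)"] by auto
  have "\<forall>\<^sub>F x in F. U t x < a" by (rule order_tendstoD(2)[OF U(1)[OF t(2)] t(1)])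
  with U(2)[OF t(2)] show "\<forall>\<^sub>F x in F. f x < a" by eventually_elim simp
qed

theorem theorem1p9:
  fixes \<Omega> :: "(real \<times> real) set" and u :: "real \<times> real \<Rightarrow> real"
    and k :: nat and \<beta> \<alpha> :: real
  assumes "open \<Omega>" and "bounded \<Omega>" and "connected \<Omega>" and "(0, 0) \<in> \<Omega>"
    and "dirichlet_eigenfunction \<Omega> u"
    and "(LINT x|lebesgue_on \<Omega>. (u x)\<^sup>2) = 1"
    and "\<beta> \<noteq> 0" and "0 \<le> \<alpha>" and "\<alpha> < pi"
    and "\<And>\<tau>. 0 < \<tau> \<Longrightarrow> \<tau> < 1 \<Longrightarrow>
           tendsto_C1_holder \<tau> {0..2*pi}
             (\<lambda>r t. u (r * cos t, r * sin t) / r ^ k)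
             (\<lambda>t. \<beta> * sin (\<alpha> - real k * t)) (at_right 0)"
  shows
    "(\<alpha> \<noteq> 0 \<longrightarrow>
        (k = 0 \<longrightarrow>
           (\<lambda>\<epsilon>. u_capacity \<Omega> (segm \<epsilon>) u)
             \<sim>[at_right 0] (\<lambda>\<epsilon>. 2 * pi / \<bar>ln \<epsilon>\<bar> * (u (0, 0))\<^sup>2)) \<and>
        (k \<ge> 1 \<longrightarrow>
           (\<lambda>\<epsilon>. u_capacity \<Omega> (segm \<epsilon>) u)
             \<sim>[at_right 0] (\<lambda>\<epsilon>. \<epsilon> ^ (2 * k) * pi * \<beta>\<^sup>2 * (sin \<alpha>)\<^sup>2 * C_const k))) \<and>
     (k \<ge> 1 \<longrightarrow> C_const k > 0) \<and>
     (\<alpha> = 0 \<longrightarrow>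
        (\<lambda>\<epsilon>. u_capacity \<Omega> (segm \<epsilon>) u) \<in> O[at_right 0](\<lambda>\<epsilon>. \<epsilon> ^ (2 * k + 2)))"
proof -
  define c where "c = \<beta> * sin \<alpha>"
  define f where "f e = u_capacity \<Omega> (segm e) u" for e
  have u: "smooth_on \<Omega> u" "u \<in> H10 \<Omega>" using assms(5) by (simp_all add: dirichlet_eigenfunction_def)
  have lim: "((\<lambda>x. u (x, 0) / x ^ k) \<longlongrightarrow> c) (at_right 0)"
    using tendsto_C1_holder_pointwise[OF _ _ assms(10)[of "1 / 2"], of 0] by (simp add: c_def)
  obtain a where a: "\<And>y. cos y ^ k = cos_sum k a y" "a k > 0" by (rule cos_power_expansion[of k]) blast
  define D where "D = (\<Sum>j\<le>k. \<bar>a j\<bar>)"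
  define D1 where "D1 = (\<Sum>j\<le>k. real j * \<bar>a j\<bar>)"
  obtain \<rho> R M where \<rho>: "\<rho> > 0" and R: "R > 0" and M: "M \<ge> 0"
    and up: "\<And>e \<kappa> t. 0 < e \<Longrightarrow> e < \<rho> \<Longrightarrow> \<kappa> > 1 \<Longrightarrow> t > 0 \<Longrightarrow> f e \<le>
        (1 + t) * (c\<^sup>2 * e ^ (2 * k) * (pi * C_const k + 2 * pi * \<kappa>\<^sup>2 * D\<^sup>2 / arcosh (\<rho> / e)
          + 4 * pi * \<kappa> * D * D1 / arcosh (\<rho> / e)))
        + (1 + 1 / t) * (4 * pi * (\<kappa> / arcosh (\<rho> / e) + 1)\<^sup>2 * (M * e ^ (k + 1))\<^sup>2)"
    and lo: "\<And>e s. 0 < e \<Longrightarrow> e < \<rho> \<Longrightarrow>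
        2 * (2 * pi * (c * e ^ k * a 0 * s) + pi * (c\<^sup>2 * e ^ (2 * k) * C_const k))
        - 4 * pi * (M * e ^ (k + 1) * (\<bar>s\<bar> + \<bar>c\<bar> * e ^ k * D1))
        - (2 * pi * s\<^sup>2 * arsinh (R / e) + pi * (c\<^sup>2 * e ^ (2 * k) * C_const k)) \<le> f e"
    and nn: "\<And>e. 0 < e \<Longrightarrow> e < \<rho> \<Longrightarrow> 0 \<le> f e"
    unfolding f_def D_def D1_def by (rule capacity_bounds[OF assms(1,2,4) u lim a(1)]) blast
  have ev: "\<forall>\<^sub>F e in at_right 0. e \<in> {0<..<\<rho>}" by (rule eventually_at_right_real[OF \<rho>])
  have invL: "((\<lambda>e. C / arcosh (\<rho> / e)) \<longlongrightarrow> 0) (at_right 0)" for C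
    by (rule tendsto_divide_0[OF tendsto_const filterlim_at_top_imp_at_infinity[OF arcosh_at_top[OF \<rho>]]])
  have id0: "((\<lambda>e::real. e) \<longlongrightarrow> 0) (at_right 0)" by (rule tendsto_ident_at)
  have part1: "f \<sim>[at_right 0] (\<lambda>e. 2 * pi / \<bar>ln e\<bar> * (u (0, 0))\<^sup>2)" if c: "c \<noteq> 0" and k: "k = 0"
  proof -
    have a0: "a 0 = 1" using a(1)[of 0] by (simp add: k cos_sum_def)
    have DD: "D = 1" "D1 = 0" "C_const k = 0" using a0 by (simp_all add: D_def D1_def k C_const_def)
    have u0: "u (0, 0) = c"
    proof -
      have "isCont u (0, 0)"
        using smooth_on_imp_continuous[OF u(1)] assms(1,4) by (simp add: continuous_on_eq_continuous_at)
      moreover have "((\<lambda>x. (x, 0 :: real)) \<longlongrightarrow> (0, 0)) (at_right 0)" by (intro tendsto_Pair tendsto_ident_at tendsto_const)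
      ultimately have "((\<lambda>x. u (x, 0)) \<longlongrightarrow> u (0, 0)) (at_right 0)" by (rule isCont_tendsto_compose)
      moreover have "((\<lambda>x. u (x, 0)) \<longlongrightarrow> c) (at_right 0)" using lim by (simp add: k)
      ultimately show ?thesis using tendsto_unique[of "at_right (0::real)"] by simp
    qed
    have l1: "((\<lambda>e. \<bar>ln e\<bar> / arcosh (\<rho> / e)) \<longlongrightarrow> 1) (at_right 0)" "((\<lambda>e. \<bar>ln e\<bar> / arsinh (R / e)) \<longlongrightarrow> 1) (at_right 0)"
      by (rule arcosh_asymp[OF \<rho>], rule arsinh_asymp[OF R])
    \<comment> \<open>With \<kappa> = 1 + t the loss in the cutoff slope and the loss in Young's
      inequality vanish together as t tends to 0. The factor
      \<open>e\<^sup>2 * \<bar>ln e\<bar>\<close> comes from the Taylor remainder, after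
      multiplication by \<bar>ln e\<bar>.\<close>
    let ?U = "\<lambda>t e. (1 + t) * (c\<^sup>2 * (2 * pi * (1 + t)\<^sup>2 * (\<bar>ln e\<bar> / arcosh (\<rho> / e))))
        + (1 + 1 / t) * (4 * pi * ((1 + t) / arcosh (\<rho> / e) + 1)\<^sup>2 * M\<^sup>2) * (e\<^sup>2 * \<bar>ln e\<bar>)"
    have "((\<lambda>e. f e * \<bar>ln e\<bar>) \<longlongrightarrow> 2 * pi * c\<^sup>2) (at_right 0)"
    proof (rule tendsto_sandwich_param[where U = ?U])
      show "((\<lambda>e. (2 * pi * c\<^sup>2 - 4 * pi * M * \<bar>c\<bar> * e) * (\<bar>ln e\<bar> / arsinh (R / e))) \<longlongrightarrow> 2 * pi * c\<^sup>2) (at_right 0)"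
        by (rule tendsto_eq_rhs[OF tendsto_mult[OF tendsto_diff[OF tendsto_const tendsto_mult[OF tendsto_const id0]] l1(2)]]) simp
      show "\<forall>\<^sub>F e in at_right 0. (2 * pi * c\<^sup>2 - 4 * pi * M * \<bar>c\<bar> * e) * (\<bar>ln e\<bar> / arsinh (R / e)) \<le> f e * \<bar>ln e\<bar>"
        using ev
      proof eventually_elim
        fix e assume e: "e \<in> {0<..<\<rho>}"
        define L where "L = arsinh (R / e)"
        have "sinh 0 < sinh L" using R e by (simp add: L_def sinh_arsinh_real)
        then have L: "L > 0" by (simp only: sinh_real_less_iff)
        \<comment> \<open>The slope s = c / L maximizes 4 pi c s - 2 pi L \<open>s\<^sup>2\<close>,
          the part of the lower bound that remains without the remainder; the maximum is 2 pi
          \<open>c\<^sup>2\<close> / L.\<close>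
        have "2 * (2 * pi * (c * 1 * 1 * (c / L)) + pi * (c\<^sup>2 * 1 * 0)) - 4 * pi * (M * e * (\<bar>c / L\<bar> + \<bar>c\<bar> * 1 * 0))
          - (2 * pi * (c / L)\<^sup>2 * L + pi * (c\<^sup>2 * 1 * 0)) \<le> f e"
          using lo[of e "c / L"] e by (simp add: k a0 DD L_def C_const_def)
        moreover have "2 * (2 * pi * (c * 1 * 1 * (c / L)) + pi * (c\<^sup>2 * 1 * 0)) - 4 * pi * (M * e * (\<bar>c / L\<bar> + \<bar>c\<bar> * 1 * 0))
          - (2 * pi * (c / L)\<^sup>2 * L + pi * (c\<^sup>2 * 1 * 0)) = (2 * pi * c\<^sup>2 - 4 * pi * M * \<bar>c\<bar> * e) / L"
          using L by (simp add: field_simps power2_eq_square)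
        ultimately have "(2 * pi * c\<^sup>2 - 4 * pi * M * \<bar>c\<bar> * e) / L * \<bar>ln e\<bar> \<le> f e * \<bar>ln e\<bar>"
          by (intro mult_right_mono) simp_all
        then show "(2 * pi * c\<^sup>2 - 4 * pi * M * \<bar>c\<bar> * e) * (\<bar>ln e\<bar> / arsinh (R / e)) \<le> f e * \<bar>ln e\<bar>"
          by (simp add: L_def)
      qed
      show "((\<lambda>t. (1 + t) * (c\<^sup>2 * (2 * pi * (1 + t)\<^sup>2))) \<longlongrightarrow> 2 * pi * c\<^sup>2) (at_right 0)"
        by (auto intro!: tendsto_eq_intros)
      fix t :: real assume t: "t > 0"
      have "((\<lambda>e::real. e\<^sup>2 * \<bar>ln e\<bar>) \<longlongrightarrow> 0) (at_right 0)" by real_asymp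
      then have "(?U t \<longlongrightarrow> (1 + t) * (c\<^sup>2 * (2 * pi * (1 + t)\<^sup>2 * 1)) + (1 + 1 / t) * (4 * pi * (0 + 1)\<^sup>2 * M\<^sup>2) * 0) (at_right 0)"
        by (intro tendsto_add tendsto_mult tendsto_const tendsto_power l1 invL)
      then show "(?U t \<longlongrightarrow> (1 + t) * (c\<^sup>2 * (2 * pi * (1 + t)\<^sup>2))) (at_right 0)" by simp
      show "\<forall>\<^sub>F e in at_right 0. f e * \<bar>ln e\<bar> \<le> ?U t e"
        using ev
      proof eventually_elim
        fix e assume e: "e \<in> {0<..<\<rho>}"
        let ?L = "arcosh (\<rho> / e)"
        have "f e \<le> (1 + t) * (c\<^sup>2 * (2 * pi * (1 + t)\<^sup>2 / ?L)) + (1 + 1 / t) * (4 * pi * ((1 + t) / ?L + 1)\<^sup>2 * (M * e)\<^sup>2)"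
          using up[of e "1 + t" t] e t by (simp add: k DD C_const_def)
        then have "f e * \<bar>ln e\<bar> \<le> ((1 + t) * (c\<^sup>2 * (2 * pi * (1 + t)\<^sup>2 / ?L)) + (1 + 1 / t) * (4 * pi * ((1 + t) / ?L + 1)\<^sup>2 * (M * e)\<^sup>2)) * \<bar>ln e\<bar>"
          by (rule mult_right_mono) simp
        also have "\<dots> = ?U t e" unfolding divide_inverse by (simp add: algebra_simps power_mult_distrib)
        finally show "f e * \<bar>ln e\<bar> \<le> ?U t e" .
      qed
    qed
    from tendsto_divide[OF this tendsto_const, of "2 * pi * c\<^sup>2"] c
    have "((\<lambda>e. f e * \<bar>ln e\<bar> / (2 * pi * c\<^sup>2)) \<longlongrightarrow> 1) (at_right 0)" by simp
    moreover have "f e * \<bar>ln e\<bar> / (2 * pi * c\<^sup>2) = f e / (2 * pi / \<bar>ln e\<bar> * (u (0, 0))\<^sup>2)" for e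
      by (simp add: u0)
    ultimately show ?thesis by (intro asymp_equivI') simp
  qed
  have part2: "f \<sim>[at_right 0] (\<lambda>e. e ^ (2 * k) * pi * \<beta>\<^sup>2 * (sin \<alpha>)\<^sup>2 * C_const k)" if c: "c \<noteq> 0" and k: "k \<ge> 1"
  proof -
    let ?A = "pi * c\<^sup>2 * C_const k"
    have A: "?A > 0" using c C_const_pos[OF k] by simp
    \<comment> \<open>Here \<kappa> = 2 is good enough: \<kappa> occurs only in terms divided by the
      height of the strip, which tend to 0 anyway.\<close>
    let ?U = "\<lambda>t e. (1 + t) * (c\<^sup>2 * (pi * C_const k + 2 * pi * 2\<^sup>2 * D\<^sup>2 / arcosh (\<rho> / e) + 4 * pi * 2 * D * D1 / arcosh (\<rho> / e)))
        + (1 + 1 / t) * (4 * pi * (2 / arcosh (\<rho> / e) + 1)\<^sup>2 * M\<^sup>2) * e\<^sup>2"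
    have lim: "((\<lambda>e. f e / e ^ (2 * k)) \<longlongrightarrow> ?A) (at_right 0)"
    proof (rule tendsto_sandwich_param[where U = ?U])
      show "((\<lambda>e. ?A - 4 * pi * M * \<bar>c\<bar> * D1 * e) \<longlongrightarrow> ?A) (at_right 0)"
        by (rule tendsto_eq_rhs[OF tendsto_diff[OF tendsto_const tendsto_mult[OF tendsto_const id0]]]) simp
      show "\<forall>\<^sub>F e in at_right 0. ?A - 4 * pi * M * \<bar>c\<bar> * D1 * e \<le> f e / e ^ (2 * k)"
        using ev
      proof eventually_elim
        fix e assume e: "e \<in> {0<..<\<rho>}"
        have p: "e ^ (k + 1) * e ^ k = e * e ^ (2 * k)" by (simp add: power_add[symmetric] mult_2)
        have "(?A - 4 * pi * M * \<bar>c\<bar> * D1 * e) * e ^ (2 * k) = ?A * e ^ (2 * k) - 4 * pi * M * \<bar>c\<bar> * D1 * (e ^ (k + 1) * e ^ k)"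
          unfolding p by (simp add: algebra_simps)
        \<comment> \<open>The constant mode is left out, s = 0: its contribution is of relative
          order 1 / \<bar>ln e\<bar>, below the leading term.\<close>
        also have "\<dots> \<le> f e" using lo[of e 0] e by (simp add: algebra_simps)
        finally show "?A - 4 * pi * M * \<bar>c\<bar> * D1 * e \<le> f e / e ^ (2 * k)" using e by (simp add: pos_le_divide_eq)
      qed
      show "((\<lambda>t. (1 + t) * (c\<^sup>2 * (pi * C_const k))) \<longlongrightarrow> ?A) (at_right 0)"
        by (auto intro!: tendsto_eq_intros)
      fix t :: real assume t: "t > 0"
      have "(?U t \<longlongrightarrow> (1 + t) * (c\<^sup>2 * (pi * C_const k + 0 + 0)) + (1 + 1 / t) * (4 * pi * (0 + 1)\<^sup>2 * M\<^sup>2) * 0\<^sup>2) (at_right 0)"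
        by (intro tendsto_add tendsto_mult tendsto_const tendsto_power invL id0)
      then show "(?U t \<longlongrightarrow> (1 + t) * (c\<^sup>2 * (pi * C_const k))) (at_right 0)" by simp
      show "\<forall>\<^sub>F e in at_right 0. f e / e ^ (2 * k) \<le> ?U t e"
        using ev
      proof eventually_elim
        fix e assume e: "e \<in> {0<..<\<rho>}"
        have p: "(M * e ^ (k + 1))\<^sup>2 = M\<^sup>2 * e\<^sup>2 * e ^ (2 * k)"
          by (simp add: power_mult_distrib power_mult[symmetric] mult_ac)
        have "f e \<le> ?U t e * e ^ (2 * k)"
          using up[of e 2 t] e t unfolding p by (simp add: algebra_simps)
        then show "f e / e ^ (2 * k) \<le> ?U t e" using e by (simp add: pos_divide_le_eq)
      qed
    qed
    have A0: "?A \<noteq> 0" using A by linarith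
    have "((\<lambda>e. f e / e ^ (2 * k) / ?A) \<longlongrightarrow> ?A / ?A) (at_right 0)"
      by (rule tendsto_divide[OF lim tendsto_const A0])
    then have "((\<lambda>e. f e / e ^ (2 * k) / ?A) \<longlongrightarrow> 1) (at_right 0)" unfolding divide_self[OF A0] .
    moreover have "f e / e ^ (2 * k) / ?A = f e / (e ^ (2 * k) * pi * \<beta>\<^sup>2 * (sin \<alpha>)\<^sup>2 * C_const k)" for e
      by (simp add: c_def power_mult_distrib mult_ac)
    ultimately show ?thesis by (intro asymp_equivI') (simp only:)
  qed
  have part3: "f \<in> O[at_right 0](\<lambda>e. e ^ (2 * k + 2))" if c: "c = 0"
  \<comment> \<open>With c = 0 only the remainder term survives. Taking t = 1 gives the factor 8 pi
    \<open>?q\<^sup>2\<close>, and \<kappa> = 2 makes \<open>?q\<close> at most 2 once the height is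
    at least 2; hence 8 * 4 = 32.\<close>
  proof (rule bigoI[where c = "32 * pi * M\<^sup>2"])
    have "\<forall>\<^sub>F e in at_right 0. arcosh (\<rho> / e) \<ge> 2"
      using arcosh_at_top[OF \<rho>] by (simp add: filterlim_at_top)
    with ev show "\<forall>\<^sub>F e in at_right 0. norm (f e) \<le> 32 * pi * M\<^sup>2 * norm (e ^ (2 * k + 2))"
    proof eventually_elim
      fix e assume e: "e \<in> {0<..<\<rho>}" and L: "arcosh (\<rho> / e) \<ge> 2"
      let ?q = "2 / arcosh (\<rho> / e) + 1"
      have q: "0 \<le> ?q" "?q \<le> 2" using L by (simp_all add: divide_simps)
      have "(k + 1) * 2 = 2 * k + 2" by simp
      then have p: "(M * e ^ (k + 1))\<^sup>2 = M\<^sup>2 * e ^ (2 * k + 2)"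
        by (simp only: power_mult_distrib power_mult[symmetric])
      have "f e \<le> 8 * pi * ?q\<^sup>2 * (M\<^sup>2 * e ^ (2 * k + 2))"
        using up[of e 2 1] e unfolding p c by simp
      also have "\<dots> \<le> 8 * pi * 2\<^sup>2 * (M\<^sup>2 * e ^ (2 * k + 2))"
        using q e by (intro mult_right_mono mult_left_mono power_mono) simp_all
      finally show "norm (f e) \<le> 32 * pi * M\<^sup>2 * norm (e ^ (2 * k + 2))"
        using nn[of e] e by simp
    qed
  qed
  have "c \<noteq> 0" if "\<alpha> \<noteq> 0" using that assms(7-9) sin_gt_zero[of \<alpha>] by (simp add: c_def)
  moreover have "c = 0" if "\<alpha> = 0" using that by (simp add: c_def)
  ultimately show ?thesis
    using part1 part2 part3 C_const_pos[of k] unfolding f_def[abs_def] by blast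
qed

end
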